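(* Let $A$ be an o-minimal structure over $\mathbb{R}$ and let $X=\{X_1,\ldots,X_k\}$ be a finite collection of nonempty, closed, pairwise disjoint subsets of $\mathbb{R}^n$, definable in $A$. Let $x_0\in\mathbb{R}^n$. Then: (1) $T_{x_0}\big(\mathrm{Ter}_{\mathbb{R}^n}(X_i,X)\big)$ has nonempty interior in $\mathbb{R}^n$ for every $i$ such that $x_0\in \mathrm{Ter}_{\mathbb{R}^n}(X_i,X)$; (2) if $x_0\in \mathrm{Conf}_{\mathbb{R}^n}(X)$, then $\dim\big(T_{x_0}\mathrm{Conf}_{\mathbb{R}^n}(X)\big)=n-1$.
   Context: $\mathbb{R}^n$ carries the Euclidean metric $d$, and $d(x,B)=\inf_{b\in B}d(x,b)$. The territory of $X_i$ is $\mathrm{Ter}_{\mathbb{R}^n}(X_i,X)=\{x\in\mathbb{R}^n : d(x,X_i)\le d(x,X_j)\text{ for all } j\}$, and the conflict set is $\mathrm{Conf}_{\mathbb{R}^n}(X)=\{x\in\mathbb{R}^n : x\in \mathrm{Ter}_{\mathbb{R}^n}(X_i,X)\cap \mathrm{Ter}_{\mathbb{R}^n}(X_j,X)\text{ for some } i\neq j\}$. The o-minimal structure is assumed to expand the real field, and $\dim$ is the dimension of definable sets. For a definable set $Y\subset\mathbb{R}^n$ and $x_0\in Y$, the tangent cone $T_{x_0}Y$ is the set of all one-sided tangent vectors at $t=0$ of definable arcs $\gamma:[0,\varepsilon)\to Y$ with $\gamma(0)=x_0$ (translated by $x_0$, it is regarded as a subset of $\mathbb{R}^n$ with vertex $x_0$).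 Equivalently, it is the union of $\{x_0\}$ and all rays from $x_0$ through the points of the Hausdorff limit, as $\varepsilon\to 0^+$, of $N_\varepsilon(Y)=\frac{1}{\varepsilon}\big[(Y\cap S_{x_0,\varepsilon})-x_0\big]+x_0$, where $S_{x_0,\varepsilon}$ is the sphere of radius $\varepsilon$ centered at $x_0$. *)

theory Defs
  imports "HOL-Analysis.Analysis"
begin

section \<open>O-minimal expansions of the real field\<close>

text \<open>
  A structure assigns to every natural number \<open>m\<close> a family of subsets of \<open>\<real>\<^sup>m\<close>, so \<open>m\<close> cannot be a
  type here: a point of \<open>\<real>\<^sup>m\<close> is a sequence vanishing from index \<open>m\<close> on. On \<open>rspace m\<close> the product
  topology of \<^typ>\<open>nat \<Rightarrow> real\<close> induces the Euclidean topology.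
\<close>

definition rspace :: "nat \<Rightarrow> (nat \<Rightarrow> real) set" where
  "rspace m = {x. \<forall>i\<ge>m. x i = 0}"

text \<open>
  \<open>D m\<close> is the collection of definable subsets of \<open>\<real>\<^sup>m\<close>. Since \<open>D 1\<close> consists of exactly the finite
  unions of intervals (degenerate ones included), real parameters are always allowed.
\<close>

locale omin_real_field =
  fixes D :: "nat \<Rightarrow> (nat \<Rightarrow> real) set set"
  assumes subset_rspace: "A \<in> D m \<Longrightarrow> A \<subseteq> rspace m"
    and empty: "{} \<in> D m"
    and union: "A \<in> D m \<Longrightarrow> B \<in> D m \<Longrightarrow> A \<union> B \<in> D m"
    and complement: "A \<in> D m \<Longrightarrow> rspace m - A \<in> D m"
    and times_real: "A \<in> D m \<Longrightarrow> {x(m := t) | x t. x \<in> A} \<in> D (Suc m)"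
    and real_times: "A \<in> D m \<Longrightarrow> {case_nat t x | t x. x \<in> A} \<in> D (Suc m)"
    and diagonal: "m \<ge> 1 \<Longrightarrow> {x \<in> rspace m. x 0 = x (m - 1)} \<in> D m"
    and projection: "A \<in> D (Suc m) \<Longrightarrow> (\<lambda>x. x(m := 0)) ` A \<in> D m"
    and less: "{x \<in> rspace 2. x 0 < x 1} \<in> D 2"
    and o_minimal:
      "D 1 = {{x \<in> rspace 1. x 0 \<in> \<Union>F} | F. finite F \<and> (\<forall>J\<in>F. is_interval (J :: real set))}"
    and add: "{x \<in> rspace 3. x 0 + x 1 = x 2} \<in> D 3"
    and mult: "{x \<in> rspace 3. x 0 * x 1 = x 2} \<in> D 3"


section \<open>Cells and dimension\<close>

text \<open>\<open>cgraph m C f\<close> is the graph in \<open>\<real>\<^sup>m\<^sup>+\<^sup>1\<close> of a function on \<open>C \<subseteq> \<real>\<^sup>m\<close>.\<close>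

definition cgraph :: "nat \<Rightarrow> (nat \<Rightarrow> real) set \<Rightarrow> ((nat \<Rightarrow> real) \<Rightarrow> real) \<Rightarrow> (nat \<Rightarrow> real) set" where
  "cgraph m C f = (\<lambda>x. x(m := f x)) ` C"

text \<open>
  The functions bounding a band over a cell: continuous and definable, or constantly
  \<open>-\<infinity>\<close>, or constantly \<open>\<infinity>\<close>.
\<close>

definition cell_bound ::
  "(nat \<Rightarrow> (nat \<Rightarrow> real) set set) \<Rightarrow> nat \<Rightarrow> (nat \<Rightarrow> real) set \<Rightarrow> ((nat \<Rightarrow> real) \<Rightarrow> ereal) \<Rightarrow> bool" where
  "cell_bound D m C f \<longleftrightarrow>
     (\<exists>h. continuous_on C h \<and> cgraph m C h \<in> D (Suc m) \<and> (\<forall>x\<in>C. f x = ereal (h x))) \<or>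
     (\<forall>x\<in>C. f x = -\<infinity>) \<or> (\<forall>x\<in>C. f x = \<infinity>)"

text \<open>
  \<open>cell D [i\<^sub>1, \<dots>, i\<^sub>m] C\<close> means that \<open>C\<close> is an \<open>(i\<^sub>1, \<dots>, i\<^sub>m)\<close>-cell in \<open>\<real>\<^sup>m\<close>, as in van den Dries'
  book \<^emph>\<open>Tame Topology and O-minimal Structures\<close>.
\<close>

inductive cell :: "(nat \<Rightarrow> (nat \<Rightarrow> real) set set) \<Rightarrow> nat list \<Rightarrow> (nat \<Rightarrow> real) set \<Rightarrow> bool"
  for D where
  point: "cell D [] {\<lambda>_. 0}"
| graph: "cell D js C \<Longrightarrow> continuous_on C f \<Longrightarrow> cgraph (length js) C f \<in> D (Suc (length js)) \<Longrightarrow>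
    cell D (js @ [0]) (cgraph (length js) C f)"
| band: "cell D js C \<Longrightarrow> cell_bound D (length js) C f \<Longrightarrow> cell_bound D (length js) C g \<Longrightarrow>
    (\<And>x. x \<in> C \<Longrightarrow> f x < g x) \<Longrightarrow>
    cell D (js @ [1]) {x(length js := t) | x t. x \<in> C \<and> f x < ereal t \<and> ereal t < g x}"

text \<open>
  The largest dimension \<open>i\<^sub>1 + \<dots> + i\<^sub>m\<close> of a cell of \<open>\<real>\<^sup>m\<close> contained in \<open>S\<close>; the supremum is over a
  finite set, and is \<open>-\<infinity>\<close> for \<open>S = {}\<close>.
\<close>

definition omin_dim :: "(nat \<Rightarrow> (nat \<Rightarrow> real) set set) \<Rightarrow> nat \<Rightarrow> (nat \<Rightarrow> real) set \<Rightarrow> ereal" where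
  "omin_dim D m S =
     (SUP js \<in> {js. length js = m \<and> (\<exists>C. cell D js C \<and> C \<subseteq> S)}. ereal (real (sum_list js)))"


section \<open>Definable subsets of \<open>\<real>\<^sup>n\<close> and their tangent cones\<close>

text \<open>
  The coordinates of a vector, listed along the library's enumeration of the finite index type. The
  choice of enumeration is immaterial, since structures are closed under permutations of coordinates.
\<close>

definition coords :: "real ^ 'n \<Rightarrow> nat \<Rightarrow> real" where
  "coords x = (\<lambda>i. if i < CARD('n) then x $ from_nat_into UNIV i else 0)"

definition definable :: "(nat \<Rightarrow> (nat \<Rightarrow> real) set set) \<Rightarrow> (real ^ 'n) set \<Rightarrow> bool" where
  "definable D S \<longleftrightarrow> coords ` S \<in> D CARD('n)"

definition ddim :: "(nat \<Rightarrow> (nat \<Rightarrow> real) set set) \<Rightarrow> (real ^ 'n) set \<Rightarrow> ereal" where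
  "ddim D S = omin_dim D CARD('n) (coords ` S)"

text \<open>\<open>definable_arc D \<gamma> \<epsilon> Y\<close>: the restriction of \<open>\<gamma>\<close> to \<open>[0,\<epsilon>)\<close> is a definable arc in \<open>Y\<close>.\<close>

definition definable_arc ::
  "(nat \<Rightarrow> (nat \<Rightarrow> real) set set) \<Rightarrow> (real \<Rightarrow> real ^ 'n) \<Rightarrow> real \<Rightarrow> (real ^ 'n) set \<Rightarrow> bool" where
  "definable_arc D \<gamma> \<epsilon> Y \<longleftrightarrow>
     \<gamma> ` {0..<\<epsilon>} \<subseteq> Y \<and> continuous_on {0..<\<epsilon>} \<gamma> \<and>
     (\<lambda>t. case_nat t (coords (\<gamma> t))) ` {0..<\<epsilon>} \<in> D (Suc CARD('n))"

text \<open>The cone is translated so that its vertex is \<open>x\<^sub>0\<close>.\<close>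

definition tangent_cone ::
  "(nat \<Rightarrow> (nat \<Rightarrow> real) set set) \<Rightarrow> real ^ 'n \<Rightarrow> (real ^ 'n) set \<Rightarrow> (real ^ 'n) set" where
  "tangent_cone D x\<^sub>0 Y =
     {x\<^sub>0 + v | v. \<exists>\<gamma> \<epsilon>. \<epsilon> > 0 \<and> definable_arc D \<gamma> \<epsilon> Y \<and> \<gamma> 0 = x\<^sub>0 \<and>
        (\<gamma> has_vector_derivative v) (at 0 within {0..<\<epsilon>})}"


section \<open>Territories and conflict sets\<close>

definition territory :: "nat \<Rightarrow> (nat \<Rightarrow> (real ^ 'n) set) \<Rightarrow> nat \<Rightarrow> (real ^ 'n) set" where
  "territory k X i = {x. \<forall>j\<in>{1..k}. infdist x (X i) \<le> infdist x (X j)}"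

definition conflict_set :: "nat \<Rightarrow> (nat \<Rightarrow> (real ^ 'n) set) \<Rightarrow> (real ^ 'n) set" where
  "conflict_set k X =
     {x. \<exists>i\<in>{1..k}. \<exists>j\<in>{1..k}. i \<noteq> j \<and> x \<in> territory k X i \<inter> territory k X j}"

end

theory Submission
  imports Defs
begin

text \<open>
  The squared distance to a closed set \<open>K\<close> expands as
  \<open>d(x + t w, K)\<^sup>2 = d(x, K)\<^sup>2 + 2 t E\<^sub>K(w) + t\<^sup>2 |w|\<^sup>2 + o(t)\<close>, where \<open>E\<^sub>K(w)\<close> is the minimum of
  \<open>w \<bullet> (x - p)\<close> over the points \<open>p\<close> of \<open>K\<close> nearest to \<open>x\<close>. So to first order territories and conflict
  sets at \<open>x\<close> are governed by the functions \<open>E\<^sub>i\<close> of those \<open>X\<^sub>i\<close> that are at minimal distance from \<open>x\<close>.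

  (1) For \<open>p\<close> nearest in \<open>X\<^sub>i\<close> and \<open>w\<close> close to \<open>p - x\<close>, \<open>E\<^sub>i(w)\<close> is strictly the smallest, so a segment
  in direction \<open>w\<close> stays in the territory. (2) A tangent vector \<open>v\<close> of the conflict set attains
  the smallest value \<open>E\<^sub>i(v)\<close> for two indices, and moving \<open>v\<close> towards a minimizing foot of \<open>X\<^sub>i\<close> breaks the tie;
  hence the cone has no interior and contains no open cell. Conversely, take feet
  \<open>p\<close>, \<open>q\<close> of different sets with \<open>(x - p) \<bullet> (x - q)\<close> maximal. Near \<open>-(x - p) - (x - q)\<close> all other
  \<open>E\<^sub>l\<close> are larger and \<open>E\<^sub>i - E\<^sub>j\<close> is strictly increasing along a coordinate axis. Its zeros there are tangent
  directions of the conflict set, by an intermediate value argument with a definable choice of the zero, and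
  they project onto a box in a coordinate hyperplane.

  The o-minimal input is one covering principle: if countably many definable sets cover a box,
  then one of them contains a box. It gives generic continuity of definable functions, and from
  that a cell of codimension one in every definable set, compact along coordinate lines, that projects
  onto a box in a coordinate hyperplane.
\<close>

section \<open>Definable predicates and functions\<close>

definition restr :: "nat \<Rightarrow> (nat \<Rightarrow> real) \<Rightarrow> nat \<Rightarrow> real" where
  "restr m e = (\<lambda>i. if i < m then e i else 0)"

lemma restr_simps [simp]: "restr m e \<in> rspace m" "restr m (restr m e) = restr m e"
  "i < m \<Longrightarrow> restr m e i = e i" "i \<ge> m \<Longrightarrow> restr m e i = 0"
  by (auto simp: restr_def rspace_def)

lemma restr_rspace: "x \<in> rspace m \<Longrightarrow> restr m x = x"
  by (auto simp: restr_def rspace_def fun_eq_iff)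

lemma restr_cong: "(\<And>i. i < m \<Longrightarrow> e i = e' i) \<Longrightarrow> restr m e = restr m e'"
  by (simp add: restr_def fun_eq_iff)

named_theorems def_intros

context omin_real_field
begin

text \<open>Predicates are read on infinite environments, so that no arity has to be tracked.\<close>

definition bdef :: "nat \<Rightarrow> ((nat \<Rightarrow> real) \<Rightarrow> bool) \<Rightarrow> bool" where
  "bdef N P \<longleftrightarrow> (\<forall>e. P e = P (restr N e)) \<and> {x \<in> rspace N. P x} \<in> D N"

text \<open>The arity is existentially quantified, so closure properties can be stated without it.
  \<open>bdef_mono\<close> brings several predicates to a common arity whenever they are
  combined.\<close>

definition def_pred :: "((nat \<Rightarrow> real) \<Rightarrow> bool) \<Rightarrow> bool" where
  "def_pred P \<longleftrightarrow> (\<exists>N. bdef N P)"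

lemma bdefI: "(\<And>e. P e = P (restr N e)) \<Longrightarrow> {x \<in> rspace N. P x} \<in> D N \<Longrightarrow> bdef N P"
  by (auto simp: bdef_def)

lemma bdef_cong: "bdef N P \<Longrightarrow> (\<And>i. i < N \<Longrightarrow> e i = e' i) \<Longrightarrow> P e = P e'"
proof -
  assume P: "bdef N P" and "\<And>i. i < N \<Longrightarrow> e i = e' i"
  then have "restr N e = restr N e'" by (intro restr_cong)
  then show ?thesis using P unfolding bdef_def by metis
qed

text \<open>Since \<open>P\<close> reads only the variables below \<open>N\<close>, its set in one
  more dimension is a cylinder, and \<open>times_real\<close> applies.\<close>

lemma bdef_Suc: "bdef N P \<Longrightarrow> bdef (Suc N) P"
proof (rule bdefI)
  assume P: "bdef N P"
  show "P e = P (restr (Suc N) e)" for e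
    by (rule bdef_cong[OF P]) simp
  have "{x \<in> rspace (Suc N). P x} = {x(N := t) | x t. x \<in> {x \<in> rspace N. P x}}"
  proof (intro set_eqI iffI)
    fix z assume "z \<in> {x \<in> rspace (Suc N). P x}"
    then have "z = (restr N z)(N := z N)" "P (restr N z)"
      using P by (auto simp: bdef_def restr_def rspace_def fun_eq_iff)
    then show "z \<in> {x(N := t) | x t. x \<in> {x \<in> rspace N. P x}}"
      by (auto intro!: exI[of _ "restr N z"])
  next
    fix z assume "z \<in> {x(N := t) | x t. x \<in> {x \<in> rspace N. P x}}"
    then obtain x t where z: "z = x(N := t)" "x \<in> rspace N" "P x" by auto
    have "P z = P x" by (rule bdef_cong[OF P]) (auto simp: z)
    with z show "z \<in> {x \<in> rspace (Suc N). P x}" by (auto simp: rspace_def)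
  qed
  then show "{x \<in> rspace (Suc N). P x} \<in> D (Suc N)"
    using times_real[of "{x \<in> rspace N. P x}" N] P by (simp add: bdef_def)
qed

lemma bdef_mono: "bdef N P \<Longrightarrow> N \<le> M \<Longrightarrow> bdef M P"
proof (rotate_tac, induction rule: dec_induct)
qed (simp_all add: bdef_Suc)

section \<open>Boolean combinations of definable predicates\<close>

lemma inter: "A \<in> D m \<Longrightarrow> B \<in> D m \<Longrightarrow> A \<inter> B \<in> D m"
proof -
  assume AB: "A \<in> D m" "B \<in> D m"
  have "A \<inter> B = rspace m - ((rspace m - A) \<union> (rspace m - B))"
    using subset_rspace[OF AB(1)] by blast
  with AB show ?thesis by (simp add: complement union)
qed

lemma bdef_not: "bdef N P \<Longrightarrow> bdef N (\<lambda>e. \<not> P e)"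
proof -
  assume P: "bdef N P"
  have "{x \<in> rspace N. \<not> P x} = rspace N - {x \<in> rspace N. P x}" by auto
  with P show ?thesis unfolding bdef_def by (auto intro: complement)
qed

lemma bdef_conj: "bdef N P \<Longrightarrow> bdef N Q \<Longrightarrow> bdef N (\<lambda>e. P e \<and> Q e)"
proof -
  assume P: "bdef N P" "bdef N Q"
  have "{x \<in> rspace N. P x \<and> Q x} = {x \<in> rspace N. P x} \<inter> {x \<in> rspace N. Q x}" by auto
  with P show ?thesis unfolding bdef_def by (auto intro: inter)
qed

lemma def_pred_not [def_intros]: "def_pred P \<Longrightarrow> def_pred (\<lambda>e. \<not> P e)"
  by (auto simp: def_pred_def intro: bdef_not)

lemma def_pred_conj [def_intros]: "def_pred P \<Longrightarrow> def_pred Q \<Longrightarrow> def_pred (\<lambda>e. P e \<and> Q e)"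
  unfolding def_pred_def
proof (elim exE)
  fix N M assume "bdef N P" "bdef M Q"
  then have "bdef (max N M) (\<lambda>e. P e \<and> Q e)"
    by (intro bdef_conj) (auto elim: bdef_mono)
  then show "\<exists>N. bdef N (\<lambda>e. P e \<and> Q e)" ..
qed

lemma def_pred_disj [def_intros]: "def_pred P \<Longrightarrow> def_pred Q \<Longrightarrow> def_pred (\<lambda>e. P e \<or> Q e)"
  using def_pred_not[OF def_pred_conj[OF def_pred_not[of P] def_pred_not[of Q]]] by (simp only: de_Morgan_conj not_not)

lemma def_pred_imp [def_intros]: "def_pred P \<Longrightarrow> def_pred Q \<Longrightarrow> def_pred (\<lambda>e. P e \<longrightarrow> Q e)"
  using def_pred_disj[OF def_pred_not[of P], of Q] by (simp only: imp_conv_disj)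

lemma def_pred_const [def_intros]: "def_pred (\<lambda>e. b)"
proof -
  have "rspace 0 - {} \<in> D 0" by (rule complement, rule empty)
  then have "bdef 0 (\<lambda>e. b)" by (cases b) (auto simp: bdef_def empty)
  then show ?thesis by (auto simp: def_pred_def)
qed

lemma def_pred_ball_finite [def_intros]:
  "finite I \<Longrightarrow> (\<And>i. i \<in> I \<Longrightarrow> def_pred (P i)) \<Longrightarrow> def_pred (\<lambda>e. \<forall>i\<in>I. P i e)"
proof (induction I rule: finite_induct)
  case empty
  show ?case by (simp add: def_pred_const)
next
  case (insert i I)
  have "def_pred (\<lambda>e. P i e \<and> (\<forall>i\<in>I. P i e))"
    by (intro def_pred_conj insert) auto
  then show ?case by simp
qed

lemma def_pred_all_less [def_intros]:
  "(\<And>i. i < n \<Longrightarrow> def_pred (P i)) \<Longrightarrow> def_pred (\<lambda>e. \<forall>i<(n::nat). P i e)"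
  using def_pred_ball_finite[of "{..<n}" P] by (simp add: Ball_def)

section \<open>Renaming of variables and quantification\<close>

lemma def_pred_shift: "def_pred P \<Longrightarrow> def_pred (\<lambda>e. P (\<lambda>i. e (Suc i)))"
proof -
  assume "def_pred P"
  then obtain N where P: "bdef N P" by (auto simp: def_pred_def)
  have "bdef (Suc N) (\<lambda>e. P (\<lambda>i. e (Suc i)))"
  proof (rule bdefI)
    show "P (\<lambda>i. e (Suc i)) = P (\<lambda>i. restr (Suc N) e (Suc i))" for e
      by (rule bdef_cong[OF P]) simp
    have "{x \<in> rspace (Suc N). P (\<lambda>i. x (Suc i))} = {case_nat t x | x t. x \<in> {x \<in> rspace N. P x}}"
    proof (intro set_eqI iffI)
      fix z assume "z \<in> {x \<in> rspace (Suc N). P (\<lambda>i. x (Suc i))}"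
      then show "z \<in> {case_nat t x | x t. x \<in> {x \<in> rspace N. P x}}"
        by (auto intro!: exI[of _ "z 0"] exI[of _ "\<lambda>i. z (Suc i)"]
          simp: fun_eq_iff rspace_def split: nat.split)
    qed (auto simp: rspace_def split: nat.split)
    also have "\<dots> = {case_nat t x | t x. x \<in> {x \<in> rspace N. P x}}" by blast
    finally show "{x \<in> rspace (Suc N). P (\<lambda>i. x (Suc i))} \<in> D (Suc N)"
      using real_times[of "{x \<in> rspace N. P x}" N] P by (simp add: bdef_def)
  qed
  then show ?thesis by (auto simp: def_pred_def)
qed

lemma def_pred_shifts: "def_pred P \<Longrightarrow> def_pred (\<lambda>e. P (\<lambda>i. e (M + i)))"
proof (induction M)
  case (Suc M)
  from def_pred_shift[OF Suc.IH[OF Suc.prems]] show ?case by simp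
qed simp

text \<open>The axiom \<open>diagonal\<close> equates only the first coordinate with the last.
  Shifting by the smaller of the two indices yields every other pair.\<close>

lemma def_pred_var_eq: "def_pred (\<lambda>e. e i = e j)"
proof -
  have *: "def_pred (\<lambda>e. e 0 = e k)" for k
  proof (cases "k = 0")
    case False
    have "bdef (Suc k) (\<lambda>e. e 0 = e k)"
      using diagonal[of "Suc k"] by (intro bdefI) auto
    then show ?thesis by (auto simp: def_pred_def)
  qed (simp add: def_pred_const)
  have **: "def_pred (\<lambda>e. e i = e j)" if "i \<le> j" for i j
    using def_pred_shifts[OF *[of "j - i"], of i] that by simp
  show ?thesis using **[of i j] **[of j i] by (cases "i \<le> j") (auto simp: eq_commute)
qed

text \<open>All variables from index \<open>M\<close> on are quantified at once. Only finitely many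
  of them matter to \<open>P\<close>, and \<open>projection\<close> removes these one by one, the
  last one first.\<close>

lemma bdef_exists_tail:
  assumes "def_pred P"
  shows "bdef M (\<lambda>e. \<exists>y. P (\<lambda>i. if i < M then e i else y i))"
proof -
  have *: "bdef M (\<lambda>e. \<exists>y. P (\<lambda>i. if i < M then e i else y i))" if "bdef (M + k) P" for k P
    using that
  proof (induction k arbitrary: P)
    case 0
    then have P: "bdef M P" by simp
    have "P (\<lambda>i. if i < M then e i else y i) = P e" for e y by (rule bdef_cong[OF P]) simp
    then show ?case using P by simp
  next
    case (Suc k)
    define K where "K = M + k"
    from Suc.prems have P: "bdef (Suc K) P" by (simp add: K_def)
    have "bdef K (\<lambda>e. \<exists>t. P (e(K := t)))"
    proof (rule bdefI)
      have "P (e(K := t)) = P ((restr K e)(K := t))" for e t by (rule bdef_cong[OF P]) auto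
      then show "(\<exists>t. P (e(K := t))) = (\<exists>t. P ((restr K e)(K := t)))" for e by simp
      have "{x \<in> rspace K. \<exists>t. P (x(K := t))} = (\<lambda>x. x(K := 0)) ` {x \<in> rspace (Suc K). P x}"
      proof (intro set_eqI iffI)
        fix z assume "z \<in> {x \<in> rspace K. \<exists>t. P (x(K := t))}"
        then obtain t where "z \<in> rspace K" "P (z(K := t))" by auto
        then show "z \<in> (\<lambda>x. x(K := 0)) ` {x \<in> rspace (Suc K). P x}"
          by (intro image_eqI[of _ _ "z(K := t)"]) (auto simp: rspace_def)
      next
        fix z assume "z \<in> (\<lambda>x. x(K := 0)) ` {x \<in> rspace (Suc K). P x}"
        then obtain x where "z = x(K := 0)" "x \<in> rspace (Suc K)" "P x" by auto
        then show "z \<in> {x \<in> rspace K. \<exists>t. P (x(K := t))}"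
          by (auto simp: rspace_def intro!: exI[of _ "x K"])
      qed
      then show "{x \<in> rspace K. \<exists>t. P (x(K := t))} \<in> D K"
        using projection P by (simp add: bdef_def)
    qed
    from Suc.IH[OF this[unfolded K_def]]
    have "bdef M (\<lambda>e. \<exists>y t. P ((\<lambda>i. if i < M then e i else y i)(K := t)))" by (simp only: K_def)
    moreover have "(\<exists>y t. P ((\<lambda>i. if i < M then e i else y i)(K := t))) \<longleftrightarrow>
        (\<exists>y. P (\<lambda>i. if i < M then e i else y i))" for e
    proof
      assume "\<exists>y t. P ((\<lambda>i. if i < M then e i else y i)(K := t))"
      then obtain y t where y: "P ((\<lambda>i. if i < M then e i else y i)(K := t))" by blast
      show "\<exists>y. P (\<lambda>i. if i < M then e i else y i)"
        by (rule exI[of _ "y(K := t)"], rule back_subst[of P, OF y]) (auto simp: K_def fun_eq_iff)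
    next
      assume "\<exists>y. P (\<lambda>i. if i < M then e i else y i)"
      then obtain y where y: "P (\<lambda>i. if i < M then e i else y i)" by blast
      show "\<exists>y t. P ((\<lambda>i. if i < M then e i else y i)(K := t))"
        by (rule exI[of _ y], rule exI[of _ "y K"], rule back_subst[of P, OF y])
          (auto simp: K_def fun_eq_iff)
    qed
    ultimately show ?case by (simp only:)
  qed
  from assms obtain N where "bdef N P" by (auto simp: def_pred_def)
  then have "bdef (M + N) P" by (rule bdef_mono) simp
  then show ?thesis by (rule *)
qed

text \<open>The renaming \<open>\<sigma>\<close> need not be injective. A fresh block of variables
  is placed from index \<open>M\<close> on, its \<open>i\<close>-th entry is equated with variable
  \<open>\<sigma> i\<close>, and the block is then quantified away.\<close>

lemma def_pred_reindex:
  assumes "def_pred P"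
  shows "def_pred (\<lambda>e. P (\<lambda>i. e (\<sigma> i)))"
proof -
  obtain N where P: "bdef N P" using assms by (auto simp: def_pred_def)
  \<comment> \<open>\<open>M\<close> exceeds every index \<open>\<sigma> i\<close> that
    \<open>P\<close> can read, so the fresh block does not collide with them. The inserted 0 covers
    the case \<open>N = 0\<close>.\<close>
  define M where "M = Suc (Max (insert 0 (\<sigma> ` {..<N})))"
  have M: "\<sigma> i < M" if "i < N" for i
    unfolding M_def less_Suc_eq_le using that by (intro Max_ge) auto
  define Q where "Q z \<longleftrightarrow> P (\<lambda>i. z (M + i)) \<and> (\<forall>i<N. z (M + i) = z (\<sigma> i))" for z
  have "def_pred Q"
    unfolding Q_def by (intro def_intros def_pred_shifts assms def_pred_var_eq)
  then have "bdef M (\<lambda>e. \<exists>y. Q (\<lambda>i. if i < M then e i else y i))" by (rule bdef_exists_tail)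
  moreover have "(\<exists>y. Q (\<lambda>i. if i < M then e i else y i)) \<longleftrightarrow> P (\<lambda>i. e (\<sigma> i))" for e
  proof
    assume "\<exists>y. Q (\<lambda>i. if i < M then e i else y i)"
    then obtain y where "P (\<lambda>i. y (M + i))" "\<forall>i<N. y (M + i) = e (\<sigma> i)"
      using M by (auto simp: Q_def)
    then show "P (\<lambda>i. e (\<sigma> i))"
      using bdef_cong[OF P, of "\<lambda>i. y (M + i)" "\<lambda>i. e (\<sigma> i)"] by auto
  next
    assume "P (\<lambda>i. e (\<sigma> i))"
    then show "\<exists>y. Q (\<lambda>i. if i < M then e i else y i)"
      using M by (auto simp: Q_def intro!: exI[of _ "\<lambda>i. e (\<sigma> (i - M))"])
  qed
  ultimately show ?thesis by (auto simp: def_pred_def)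
qed

text \<open>Here the quantified block comes first in the environment, while
  \<open>bdef_exists_tail\<close> handles a block at the end. A renaming moves the block behind the
  \<open>N\<close> variables that remain.\<close>

lemma def_pred_exists_vec:
  assumes "def_pred R"
  shows "def_pred (\<lambda>e. \<exists>y. R (\<lambda>i. if i < n then y i else e (i - n)))"
proof -
  obtain N where R: "bdef (N + n) R" using assms bdef_mono[of _ R]
    unfolding def_pred_def by (meson le_add1)
  define R' where "R' z \<longleftrightarrow> R (\<lambda>i. z (if i < n then N + i else i - n))" for z
  have "def_pred R'" unfolding R'_def by (rule def_pred_reindex[OF assms])
  then have "bdef N (\<lambda>e. \<exists>y. R' (\<lambda>i. if i < N then e i else y i))" by (rule bdef_exists_tail)
  moreover have "(\<exists>y. R' (\<lambda>i. if i < N then e i else y i)) \<longleftrightarrow>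
      (\<exists>y. R (\<lambda>i. if i < n then y i else e (i - n)))" for e
  proof
    assume "\<exists>y. R' (\<lambda>i. if i < N then e i else y i)"
    then obtain y where "R' (\<lambda>i. if i < N then e i else y i)" ..
    then have "R (\<lambda>i. if i < n then y (N + i) else e (i - n))"
      unfolding R'_def by (subst (asm) bdef_cong[OF R]) auto
    then show "\<exists>y. R (\<lambda>i. if i < n then y i else e (i - n))" 
      by (intro exI[of _ "\<lambda>i. y (N + i)"])
  next
    assume "\<exists>y. R (\<lambda>i. if i < n then y i else e (i - n))"
    then obtain y where y: "R (\<lambda>i. if i < n then y i else e (i - n))" ..
    show "\<exists>y. R' (\<lambda>i. if i < N then e i else y i)"
      unfolding R'_def using y
      by (intro exI[of _ "\<lambda>i. y (i - N)"], subst bdef_cong[OF R]) auto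
  qed
  ultimately show ?thesis by (auto simp: def_pred_def)
qed

text \<open>The premise follows the convention of de Bruijn indices: the bound variable is variable
  0 and all others move up by one. In this form \<open>def_intros\<close> can descend through nested
  quantifiers.\<close>

lemma def_pred_ex [def_intros]:
  "def_pred (\<lambda>e. P (\<lambda>i. e (Suc i)) (e 0)) \<Longrightarrow> def_pred (\<lambda>e. \<exists>t. P e t)"
proof -
  assume "def_pred (\<lambda>e. P (\<lambda>i. e (Suc i)) (e 0))"
  from def_pred_exists_vec[OF this, of 1]
  have "def_pred (\<lambda>e. \<exists>y :: nat \<Rightarrow> real. P e (y 0))" by simp
  moreover have "(\<exists>y :: nat \<Rightarrow> real. P e (y 0)) = (\<exists>t. P e t)" for e
  proof
    assume "\<exists>t. P e t"
    then obtain t where "P e ((\<lambda>_::nat. t) 0)" by blast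
    then show "\<exists>y :: nat \<Rightarrow> real. P e (y 0)" by (rule exI[of "\<lambda>y. P e (y 0)"])
  qed blast
  ultimately show ?thesis by simp
qed

lemma def_pred_all [def_intros]:
  "def_pred (\<lambda>e. P (\<lambda>i. e (Suc i)) (e 0)) \<Longrightarrow> def_pred (\<lambda>e. \<forall>t. P e t)"
  using def_pred_not[OF def_pred_ex[of "\<lambda>e t. \<not> P e t", OF def_pred_not]] by simp

text \<open>In the first premise the bound sequence is the whole environment, parameters included.
  The second premise makes its entries from index \<open>n\<close> on harmless.\<close>

lemma def_pred_ex_seq:
  assumes "def_pred (\<lambda>e. P (\<lambda>i. e (n + i)) e)" and "\<And>e y. P e y = P e (restr n y)"
  shows "def_pred (\<lambda>e. \<exists>y. P e y)"
proof -
  have "P e (\<lambda>i. if i < n then y i else e (i - n)) = P e y" for e y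
    using assms(2)[of e y] assms(2)[of e "\<lambda>i. if i < n then y i else e (i - n)"]
      restr_cong[of n y "\<lambda>i. if i < n then y i else e (i - n)"] by simp
  with def_pred_exists_vec[OF assms(1), of n] show ?thesis by simp
qed

section \<open>Definable functions, substitution and arithmetic\<close>

definition def_fun :: "((nat \<Rightarrow> real) \<Rightarrow> real) \<Rightarrow> bool" where
  "def_fun f \<longleftrightarrow> def_pred (\<lambda>e. e 0 = f (\<lambda>i. e (Suc i)))"

text \<open>The finitely many values \<open>F i e\<close> that \<open>P\<close> reads become new
  variables, tied to \<open>F\<close> through the graphs of these functions and then quantified
  away.\<close>

lemma def_pred_subst:
  assumes "def_pred P" "\<And>i. def_fun (F i)"
  shows "def_pred (\<lambda>e. P (\<lambda>i. F i e))"
proof -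
  obtain N where P: "bdef N P" using assms by (auto simp: def_pred_def)
  define R where "R z \<longleftrightarrow> P z \<and> (\<forall>i<N. z i = F i (\<lambda>j. z (N + j)))" for z
  have "def_pred (\<lambda>z. z i = F i (\<lambda>j. z (N + j)))" for i
    using def_pred_reindex[OF assms(2)[unfolded def_fun_def],
        of "case_nat i (\<lambda>j. N + j)" i] by simp
  then have "def_pred R" unfolding R_def by (intro def_intros assms(1))
  from def_pred_exists_vec[OF this, of N]
  have "def_pred (\<lambda>e. \<exists>y. P (\<lambda>i. if i < N then y i else e (i - N)) \<and> (\<forall>i<N. y i = F i e))"
    by (simp add: R_def)
  moreover have "(\<exists>y. P (\<lambda>i. if i < N then y i else e (i - N)) \<and> (\<forall>i<N. y i = F i e)) \<longleftrightarrow>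
     P (\<lambda>i. F i e)" for e
  proof
    assume "\<exists>y. P (\<lambda>i. if i < N then y i else e (i - N)) \<and> (\<forall>i<N. y i = F i e)"
    then obtain y where y: "P (\<lambda>i. if i < N then y i else e (i - N))" "\<forall>i<N. y i = F i e" by blast
    show "P (\<lambda>i. F i e)" by (rule bdef_cong[OF P, THEN iffD1, OF _ y(1)]) (simp add: y(2))
  next
    assume "P (\<lambda>i. F i e)"
    then have "P (\<lambda>i. if i < N then F i e else e (i - N))"
      by (rule bdef_cong[OF P, THEN iffD1, rotated]) simp
    then show "\<exists>y. P (\<lambda>i. if i < N then y i else e (i - N)) \<and> (\<forall>i<N. y i = F i e)"
      by (intro exI[of _ "\<lambda>i. F i e"]) simp
  qed
  ultimately show ?thesis by simp
qed

lemma def_fun_reindex: "def_fun f \<Longrightarrow> def_fun (\<lambda>e. f (\<lambda>i. e (\<sigma> i)))"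
  unfolding def_fun_def
  using def_pred_reindex[of "\<lambda>e. e 0 = f (\<lambda>i. e (Suc i))" "case_nat 0 (\<lambda>i. Suc (\<sigma> i))"] by simp

lemma def_fun_var [def_intros]: "def_fun (\<lambda>e. e i)"
  unfolding def_fun_def by (rule def_pred_var_eq)

lemma def_pred_subst_list:
  assumes "def_pred P" "def_fun f" "def_fun g" "def_fun h"
  shows "def_pred (\<lambda>e. P (\<lambda>i. if i = 0 then f e else if i = 1 then g e else h e))"
proof (rule def_pred_subst[OF assms(1)])
  show "def_fun (\<lambda>e. if i = 0 then f e else if i = 1 then g e else h e)" for i :: nat
    using assms by (cases "i = 0"; cases "i = 1") simp_all
qed

lemma def_pred_base:
  "def_pred (\<lambda>e. e 0 < e 1)" "def_pred (\<lambda>e. e 0 + e 1 = e 2)" "def_pred (\<lambda>e. e 0 * e 1 = e 2)"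
  "def_pred (\<lambda>e. e 0 \<in> (J::real set))" if "is_interval J"
proof -
  have "bdef 2 (\<lambda>e. e 0 < e 1)" using less by (auto simp: bdef_def)
  then show "def_pred (\<lambda>e. e 0 < e 1)" by (auto simp: def_pred_def)
  have "bdef 3 (\<lambda>e. e 0 + e 1 = e 2)" using add by (auto simp: bdef_def)
  then show "def_pred (\<lambda>e. e 0 + e 1 = e 2)" by (auto simp: def_pred_def)
  have "bdef 3 (\<lambda>e. e 0 * e 1 = e 2)" using mult by (auto simp: bdef_def)
  then show "def_pred (\<lambda>e. e 0 * e 1 = e 2)" by (auto simp: def_pred_def)
  have "{x \<in> rspace 1. x 0 \<in> \<Union>{J}} \<in> D 1"
    unfolding o_minimal using that by blast
  then have "bdef 1 (\<lambda>e. e 0 \<in> J)" by (auto simp: bdef_def)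
  then show "def_pred (\<lambda>e. e 0 \<in> J)" by (auto simp: def_pred_def)
qed

text \<open>Real parameters enter through o-minimality: a singleton is an interval, hence
  definable.\<close>

lemma def_fun_const [def_intros]: "def_fun (\<lambda>e. c)"
  using def_pred_base(4)[of "{c}"] by (simp add: def_fun_def is_interval_def)

lemma def_pred_less [def_intros]: "def_fun f \<Longrightarrow> def_fun g \<Longrightarrow> def_pred (\<lambda>e. f e < g e)"
  using def_pred_subst_list[OF def_pred_base(1)[OF is_interval_empty], of f g f] by simp

lemma def_pred_le [def_intros]: "def_fun f \<Longrightarrow> def_fun g \<Longrightarrow> def_pred (\<lambda>e. f e \<le> g e)"
  using def_pred_not[OF def_pred_less[of g f]] by (simp add: not_less)

lemma def_pred_eq [def_intros]: "def_fun f \<Longrightarrow> def_fun g \<Longrightarrow> def_pred (\<lambda>e. f e = g e)"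
  using def_pred_conj[OF def_pred_le[of f g] def_pred_le[of g f]] by (simp add: order_eq_iff)

lemma def_fun_shift: "def_fun f \<Longrightarrow> def_fun (\<lambda>e. f (\<lambda>i. e (Suc i)))"
  by (rule def_fun_reindex)

lemma def_fun_add [def_intros]: "def_fun f \<Longrightarrow> def_fun g \<Longrightarrow> def_fun (\<lambda>e. f e + g e)"
  using def_pred_subst_list[OF def_pred_base(2)[OF is_interval_empty] def_fun_shift def_fun_shift
      def_fun_var[of 0], of f g]
  unfolding def_fun_def by (simp add: eq_commute)

lemma def_fun_mult [def_intros]: "def_fun f \<Longrightarrow> def_fun g \<Longrightarrow> def_fun (\<lambda>e. f e * g e)"
  using def_pred_subst_list[OF def_pred_base(3)[OF is_interval_empty] def_fun_shift def_fun_shift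
      def_fun_var[of 0], of f g]
  unfolding def_fun_def by (simp add: eq_commute)

lemma def_fun_minus [def_intros]: "def_fun f \<Longrightarrow> def_fun (\<lambda>e. - f e)"
  using def_fun_mult[OF def_fun_const[of "-1"], of f] by simp

lemma def_fun_diff [def_intros]: "def_fun f \<Longrightarrow> def_fun g \<Longrightarrow> def_fun (\<lambda>e. f e - g e)"
  using def_fun_add[OF _ def_fun_minus[of g], of f] by simp

lemma def_fun_sum [def_intros]:
  "(\<And>i. i \<in> I \<Longrightarrow> def_fun (f i)) \<Longrightarrow> def_fun (\<lambda>e. \<Sum>i\<in>I. f i e)"
proof (induction I rule: infinite_finite_induct)
  case (insert i I)
  have "def_fun (\<lambda>e. f i e + (\<Sum>i\<in>I. f i e))"
    by (intro def_fun_add insert) auto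
  with insert show ?case by simp
qed (simp_all add: def_fun_const)

lemma def_fun_if [def_intros]:
  assumes "def_pred P" "def_fun f" "def_fun g"
  shows "def_fun (\<lambda>e. if P e then f e else g e)"
proof -
  have "def_pred (\<lambda>e. (P (\<lambda>i. e (Suc i)) \<and> e 0 = f (\<lambda>i. e (Suc i))) \<or>
      (\<not> P (\<lambda>i. e (Suc i)) \<and> e 0 = g (\<lambda>i. e (Suc i))))"
    using assms by (intro def_intros def_pred_shift def_fun_shift)
  then show ?thesis unfolding def_fun_def by (rule back_subst[of def_pred]) auto
qed

lemma def_fun_abs [def_intros]: "def_fun f \<Longrightarrow> def_fun (\<lambda>e. \<bar>f e\<bar>)"
  unfolding abs_if by (intro def_intros)

lemma def_fun_subst:
  assumes "def_fun f" "\<And>i. def_fun (F i)"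
  shows "def_fun (\<lambda>e. f (\<lambda>i. F i e))"
proof -
  define G where "G i e = (case i of 0 \<Rightarrow> e 0 | Suc j \<Rightarrow> F j (\<lambda>i. e (Suc i)))" for i and e :: "nat \<Rightarrow> real"
  have "def_fun (G i)" for i
    using def_fun_shift[OF assms(2)] def_fun_var[of 0] unfolding G_def by (cases i) auto
  from def_pred_subst[OF assms(1)[unfolded def_fun_def], of G, OF this]
  show ?thesis by (simp add: def_fun_def G_def)
qed

text \<open>This leads back from predicates to the sets of the structure. Variables from
  \<open>n\<close> up to the arity of \<open>P\<close> are forced to be 0 and quantified away, which
  agrees with the encoding of points in \<open>rspace n\<close>.\<close>

lemma def_pred_D:
  assumes "def_pred P"
  shows "{x \<in> rspace n. P x} \<in> D n"
proof -
  obtain M where P: "bdef M P" using assms by (auto simp: def_pred_def)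
  define Q where "Q e \<longleftrightarrow> P e \<and> (\<forall>i\<in>{n..<M}. e i = 0)" for e
  have "def_pred Q" unfolding Q_def by (intro def_intros assms) auto
  then have "bdef n (\<lambda>e. \<exists>y. Q (\<lambda>i. if i < n then e i else y i))" by (rule bdef_exists_tail)
  then have "{x \<in> rspace n. \<exists>y. Q (\<lambda>i. if i < n then x i else y i)} \<in> D n" by (simp add: bdef_def)
  also have "{x \<in> rspace n. \<exists>y. Q (\<lambda>i. if i < n then x i else y i)} = {x \<in> rspace n. P x}"
  proof (intro Collect_cong conj_cong refl iffI)
    fix x assume x: "x \<in> rspace n" and "\<exists>y. Q (\<lambda>i. if i < n then x i else y i)"
    then obtain y where "Q (\<lambda>i. if i < n then x i else y i)" by blast
    then show "P x" using x unfolding Q_def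
      by (auto simp: rspace_def elim!: bdef_cong[OF P, THEN iffD1, rotated])
  next
    fix x assume x: "x \<in> rspace n" "P x"
    then have "Q (\<lambda>i. if i < n then x i else x i)" by (auto simp: Q_def rspace_def)
    then show "\<exists>y. Q (\<lambda>i. if i < n then x i else y i)" by blast
  qed
  finally show ?thesis .
qed

text \<open>The converse of \<open>def_pred_D\<close>, for a tuple of definable functions in place
  of the variables. The last premise makes the tuple equal to its truncation to \<open>m\<close>
  entries.\<close>

lemma D_mem [def_intros]:
  assumes "A \<in> D m" "\<And>i. i < m \<Longrightarrow> def_fun (F i)" "\<And>i e. i \<ge> m \<Longrightarrow> F i e = 0"
  shows "def_pred (\<lambda>e. (\<lambda>i. F i e) \<in> A)"
proof -
  have "{x \<in> rspace m. restr m x \<in> A} = A"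
    using subset_rspace[OF assms(1)] by (auto simp: restr_rspace subset_iff)
  then have "bdef m (\<lambda>e. restr m e \<in> A)" using assms(1) by (auto simp: bdef_def)
  then have "def_pred (\<lambda>e. restr m e \<in> A)" by (auto simp: def_pred_def)
  moreover have "def_fun (F i)" for i
  proof (cases "i < m")
    case False
    then have "F i = (\<lambda>e. 0)" using assms(3) by (auto simp: fun_eq_iff)
    then show ?thesis using def_fun_const[of 0] by simp
  qed (rule assms(2))
  ultimately have "def_pred (\<lambda>e. restr m (\<lambda>i. F i e) \<in> A)" by (rule def_pred_subst)
  moreover have "restr m (\<lambda>i. F i e) = (\<lambda>i. F i e)" for e
    using assms(3) by (auto simp: restr_def)
  ultimately show ?thesis by simp
qed

end

section \<open>Boxes and cells\<close>

definition obox :: "nat \<Rightarrow> (nat \<Rightarrow> real) \<Rightarrow> (nat \<Rightarrow> real) \<Rightarrow> (nat \<Rightarrow> real) set" where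
  "obox n a b = {x \<in> rspace n. \<forall>i<n. a i < x i \<and> x i < b i}"

definition has_box :: "nat \<Rightarrow> (nat \<Rightarrow> real) set \<Rightarrow> bool" where
  "has_box n A \<longleftrightarrow> (\<exists>a b. (\<forall>i<n. a i < b i) \<and> obox n a b \<subseteq> A)"

text \<open>With rational \<open>q\<close> and \<open>r\<close> there are only countably many slabs
  of a given set. This is what lets pointwise information about fibers enter a countable covering of
  the base.\<close>

definition slab :: "nat \<Rightarrow> (nat \<Rightarrow> real) set \<Rightarrow> real \<Rightarrow> real \<Rightarrow> (nat \<Rightarrow> real) set" where
  "slab n A q r = {y \<in> rspace n. \<forall>t. q < t \<and> t < r \<longrightarrow> y(n := t) \<in> A}"

lemma obox_Suc: "x \<in> obox (Suc n) a b \<longleftrightarrow>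
    x \<in> rspace (Suc n) \<and> restr n x \<in> obox n a b \<and> a n < x n \<and> x n < b n"
  by (auto simp: obox_def less_Suc_eq)

lemma rspace_upd: "i < n \<Longrightarrow> x(i := t) \<in> rspace n \<longleftrightarrow> x \<in> rspace n"
  by (auto simp: rspace_def)

lemma restr_upd: "y \<in> rspace n \<Longrightarrow> restr n (y(n := t)) = y"
  by (auto simp: rspace_def restr_def fun_eq_iff)

lemma restr_upd_self: "x \<in> rspace (Suc n) \<Longrightarrow> (restr n x)(n := x n) = x"
  by (auto simp: rspace_def restr_def fun_eq_iff)

lemma rspace_Suc_upd: "y \<in> rspace n \<Longrightarrow> y(n := t) \<in> rspace (Suc n)"
  by (auto simp: rspace_def)

lemma has_box_slab: "has_box n (slab n A q r) \<Longrightarrow> q < r \<Longrightarrow> has_box (Suc n) A"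
proof -
  assume "has_box n (slab n A q r)" "q < r"
  then obtain a b where ab: "\<forall>i<n. a i < b i" "obox n a b \<subseteq> slab n A q r"
    by (auto simp: has_box_def)
  have "x \<in> A" if x: "x \<in> obox (Suc n) (a(n := q)) (b(n := r))" for x
  proof -
    have "restr n x \<in> obox n a b"
      using x unfolding obox_def by (force simp: less_Suc_eq)
    with ab(2) have "restr n x \<in> slab n A q r" by blast
    moreover have "q < x n" "x n < r" using x by (auto simp: obox_def)
    ultimately have "(restr n x)(n := x n) \<in> A" by (auto simp: slab_def)
    then show "x \<in> A" using x restr_upd_self[of x n] by (auto simp: obox_def)
  qed
  then show ?thesis unfolding has_box_def using ab(1) \<open>q < r\<close>
    by (intro exI[of _ "a(n := q)"] exI[of _ "b(n := r)"]) (auto simp: less_Suc_eq)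
qed

lemma obox_open:
  assumes "y \<in> obox n a b"
  shows "\<exists>\<delta>>0. \<forall>y'. (\<forall>i<n. \<bar>y' i - y i\<bar> < \<delta>) \<longrightarrow> restr n y' \<in> obox n a b"
proof -
  \<comment> \<open>The least distance to a face of the box; the element 1 keeps the set nonempty
    for \<open>n = 0\<close>.\<close>
  define \<delta> where "\<delta> = Min (insert 1 ((\<lambda>i. min (y i - a i) (b i - y i)) ` {..<n}))"
  have "\<delta> > 0" using assms by (auto simp: \<delta>_def obox_def)
  moreover have \<delta>: "\<delta> \<le> y i - a i" "\<delta> \<le> b i - y i" if "i < n" for i
  proof -
    have "\<delta> \<le> min (y i - a i) (b i - y i)"
      unfolding \<delta>_def using that by (intro Min_le) auto
    then show "\<delta> \<le> y i - a i" "\<delta> \<le> b i - y i" by auto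
  qed
  have "restr n y' \<in> obox n a b" if y': "\<forall>i<n. \<bar>y' i - y i\<bar> < \<delta>" for y'
    unfolding obox_def
  proof (intro CollectI conjI allI impI)
    fix i assume "i < n"
    with y' \<delta>[of i] show "a i < restr n y' i" "restr n y' i < b i" by fastforce+
  qed simp
  ultimately show ?thesis by blast
qed

text \<open>Continuity refers to the product topology on sequences. Coordinate maps are continuous
  there, so the finitely many closeness conditions hold eventually near \<open>y\<close>.\<close>

lemma continuous_on_obox:
  assumes f: "\<And>e. f e = f (restr n e)"
    and "\<And>y \<epsilon>. y \<in> C \<Longrightarrow> \<epsilon> > 0 \<Longrightarrow>
      \<exists>\<delta>>0. \<forall>y'. (\<forall>i<n. \<bar>y' i - y i\<bar> < \<delta>) \<longrightarrow> \<bar>f y' - f y\<bar> < (\<epsilon>::real)"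
  shows "continuous_on C f"
  unfolding continuous_on_def
proof (intro ballI tendstoI)
  fix y and \<epsilon> :: real assume "y \<in> C" "\<epsilon> > 0"
  then obtain \<delta> where \<delta>: "\<delta> > 0" "\<And>y'. (\<forall>i<n. \<bar>y' i - y i\<bar> < \<delta>) \<Longrightarrow> \<bar>f y' - f y\<bar> < \<epsilon>"
    using assms(2) by meson
  have "((\<lambda>y'. y' i) \<longlongrightarrow> y i) (at y within C)" for i
  proof -
    have "continuous_on C (\<lambda>y'. y' i)"
      by (rule continuous_on_subset[OF continuous_on_product_coordinates]) simp
    then show ?thesis using \<open>y \<in> C\<close> by (simp add: continuous_on_def)
  qed
  then have "\<forall>\<^sub>F y' in at y within C. \<forall>i\<in>{..<n}. dist (y' i) (y i) < \<delta>"
    using \<delta>(1) by (intro eventually_ball_finite) (auto dest: tendstoD)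
  then show "\<forall>\<^sub>F y' in at y within C. dist (f y') (f y) < \<epsilon>"
    by eventually_elim (auto simp: dist_real_def intro: \<delta>(2))
qed

context omin_real_field
begin

lemma def_pred_all_seq:
  assumes "def_pred (\<lambda>e. P (\<lambda>i. e (n + i)) e)" and "\<And>e y. P e y = P e (restr n y)"
  shows "def_pred (\<lambda>e. \<forall>y. P e y)"
  using def_pred_not[OF def_pred_ex_seq[of "\<lambda>e y. \<not> P e y" n, OF def_pred_not[OF assms(1)]]]
    assms(2) by auto

lemma def_fun_restr [def_intros]: "(\<And>i. i < n \<Longrightarrow> def_fun (\<lambda>e. F e i)) \<Longrightarrow> def_fun (\<lambda>e. restr n (F e) i)"
  using def_fun_const[of 0] by (cases "i < n") auto

lemma def_fun_upd [def_intros]: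
  "(i \<noteq> m \<Longrightarrow> def_fun (\<lambda>e. F e i)) \<Longrightarrow> def_fun G \<Longrightarrow> def_fun (\<lambda>e. ((F e)(m := G e)) i)"
  by (cases "i = m") auto

lemma slab_D:
  assumes "A \<in> D (Suc n)"
  shows "slab n A q r \<in> D n"
proof -
  have "def_pred (\<lambda>e. \<forall>t. q < t \<and> t < r \<longrightarrow> (restr n e)(n := t) \<in> A)"
    by (intro def_intros D_mem[OF assms]) auto
  from def_pred_D[OF this, of n]
  show ?thesis unfolding slab_def by (rule back_subst[of "\<lambda>x. x \<in> D n"]) (auto simp: restr_rspace)
qed

lemma obox_D: "obox n a b \<in> D n"
  unfolding obox_def by (intro def_pred_D def_intros)

section \<open>Sets on the line, the covering principle and generic continuity\<close>

lemma definable_line: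
  assumes "def_pred (\<lambda>e. e 0 \<in> F)"
  obtains \<J> where "finite \<J>" "\<forall>J\<in>\<J>. is_interval (J :: real set)" "F = \<Union>\<J>"
proof -
  from def_pred_D[OF assms, of 1] obtain \<J> where \<J>: "finite \<J>" "\<forall>J\<in>\<J>. is_interval (J :: real set)"
    and eq: "{x \<in> rspace 1. x 0 \<in> F} = {x \<in> rspace 1. x 0 \<in> \<Union>\<J>}"
    unfolding o_minimal by auto
  have "t \<in> F \<longleftrightarrow> t \<in> \<Union>\<J>" for t
  proof -
    define x where "x i = (if i = 0 then t else 0)" for i :: nat
    have "x \<in> rspace 1" "x 0 = t" by (auto simp: rspace_def x_def)
    moreover have "x \<in> {x \<in> rspace 1. x 0 \<in> F} \<longleftrightarrow> x \<in> {x \<in> rspace 1. x 0 \<in> \<Union>\<J>}"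
      by (simp only: eq)
    ultimately show ?thesis by simp
  qed
  then have "F = \<Union>\<J>" by blast
  with \<J> that show thesis by blast
qed

text \<open>A finite union of intervals that is infinite has a member with two points
  \<open>u < v\<close>, and rationals can be chosen between them. Rational end points keep the later
  coverings countable.\<close>

lemma definable_infinite_interval:
  assumes "def_pred (\<lambda>e. e 0 \<in> F)" "infinite F"
  obtains q r where "q \<in> \<rat>" "r \<in> \<rat>" "q < r" "{q<..<r} \<subseteq> F"
proof -
  obtain \<J> where \<J>: "finite \<J>" "\<forall>J\<in>\<J>. is_interval (J :: real set)" and F: "F = \<Union>\<J>"
    using definable_line[OF assms(1)] .
  with assms(2) \<J>(1) obtain J where J: "J \<in> \<J>" "infinite J" by blast
  obtain u where u: "u \<in> J" using J(2) infinite_imp_nonempty by blast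
  have "infinite (J - {u})" using J(2) by simp
  then obtain v where "v \<in> J - {u}" using infinite_imp_nonempty by blast
  then obtain u v where uv: "u \<in> J" "v \<in> J" "u < v" using u by (cases "u < v") auto
  obtain q where q: "q \<in> \<rat>" "u < q" "q < v" using Rats_dense_in_real[OF uv(3)] by blast
  obtain r where r: "r \<in> \<rat>" "q < r" "r < v" using Rats_dense_in_real[OF q(3)] by blast
  have "{q<..<r} \<subseteq> J"
  proof
    fix t assume "t \<in> {q<..<r}"
    with q r have "u \<le> t" "t \<le> v" by auto
    moreover have "is_interval J" using \<J>(2) J(1) by blast
    ultimately show "t \<in> J" using uv unfolding is_interval_1 by blast
  qed
  then show ?thesis using that q r F J(1) by blast
qed

lemma fiber_interval:
  assumes "A \<in> D n" "i < n" "y \<in> rspace n" "infinite {t. y(i := t) \<in> A}"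
  obtains q r where "q \<in> \<rat>" "r \<in> \<rat>" "q < r" "\<And>t. q < t \<Longrightarrow> t < r \<Longrightarrow> y(i := t) \<in> A"
proof -
  have "def_pred (\<lambda>e. y(i := e 0) \<in> A)"
    using assms(2,3) by (intro def_intros D_mem[OF assms(1)]) (auto simp: rspace_def)
  then have "def_pred (\<lambda>e. e 0 \<in> {t. y(i := t) \<in> A})" by simp
  from definable_infinite_interval[OF this assms(4)]
  obtain q r where "q \<in> \<rat>" "r \<in> \<rat>" "q < r" "{q<..<r} \<subseteq> {t. y(i := t) \<in> A}" .
  then show ?thesis by (intro that) auto
qed

abbreviation rat_pairs :: "(real \<times> real) set" where
  "rat_pairs \<equiv> {(q, r). q \<in> \<rat> \<and> r \<in> \<rat> \<and> q < r}"

lemma countable_rat_pairs: "countable rat_pairs"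
  by (rule countable_subset[of _ "\<rat> \<times> \<rat>"]) (auto simp: countable_rat)

text \<open>By induction on \<open>n\<close>: over each point the fibers cover an uncountable interval, so one of them
  is infinite and, by o-minimality, contains an interval with rational end points.\<close>

lemma countable_cover_has_box:
  assumes "countable \<A>" "\<A> \<subseteq> D n" "\<forall>i<n. a i < b i" "obox n a b \<subseteq> \<Union>\<A>"
  shows "\<exists>A\<in>\<A>. has_box n A"
  using assms
proof (induction n arbitrary: \<A>)
  case 0
  have "(\<lambda>_. 0) \<in> obox 0 a b" by (simp add: obox_def rspace_def)
  with 0 obtain A where A: "A \<in> \<A>" "(\<lambda>_. 0) \<in> A" by blast
  then have "obox 0 a b \<subseteq> A" by (auto simp: obox_def rspace_def fun_eq_iff elim!: back_subst[of "\<lambda>x. x \<in> A"])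
  with A show ?case by (auto simp: has_box_def)
next
  case (Suc n)
  define \<B> where "\<B> = (\<lambda>(A, q, r). slab n A q r) ` (\<A> \<times> rat_pairs)"
  have "countable \<B>" unfolding \<B>_def using Suc.prems(1) countable_rat_pairs by auto
  moreover have "\<B> \<subseteq> D n" unfolding \<B>_def using Suc.prems(2) by (auto intro!: slab_D)
  moreover have "obox n a b \<subseteq> \<Union>\<B>"
  proof
    fix y assume y: "y \<in> obox n a b"
    then have yr: "y \<in> rspace n" by (simp add: obox_def)
    have "y(n := t) \<in> obox (Suc n) a b" if "a n < t" "t < b n" for t
      using y that by (auto simp: obox_Suc restr_upd[OF yr] rspace_Suc_upd[OF yr])
    with Suc.prems(4) have "{a n<..<b n} \<subseteq> (\<Union>A\<in>\<A>. {t. y(n := t) \<in> A})" by fastforce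
    moreover have "uncountable {a n<..<b n}" using Suc.prems(3) by (simp add: uncountable_open_interval)
    ultimately have "\<exists>A\<in>\<A>. uncountable {t. y(n := t) \<in> A}"
      using Suc.prems(1) by (meson countable_UN countable_subset)
    then obtain A where A: "A \<in> \<A>" "infinite {t. y(n := t) \<in> A}"
      using countable_finite by blast
    have "y \<in> rspace (Suc n)" using yr by (auto simp: rspace_def)
    then obtain q r where "q \<in> \<rat>" "r \<in> \<rat>" "q < r" "\<And>t. q < t \<Longrightarrow> t < r \<Longrightarrow> y(n := t) \<in> A"
      using fiber_interval[of A "Suc n" n y] A Suc.prems(2) by blast
    then show "y \<in> \<Union>\<B>" using A(1) yr by (auto simp: \<B>_def slab_def intro!: bexI[of _ "(A, q, r)"])
  qed
  ultimately obtain B where "B \<in> \<B>" "has_box n B" using Suc.IH[of \<B>] Suc.prems(3) by auto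
  then show ?case by (auto simp: \<B>_def intro: has_box_slab)
qed

text \<open>Each fiber contains an interval with rational end points, so countably many slabs cover
  the base box. One of them contains a box, and its product with the interval lies in
  \<open>A\<close>.\<close>

lemma infinite_fibers_has_box:
  assumes A: "A \<in> D (Suc n)" and ab: "\<forall>i<n. a i < b i"
    and inf: "\<And>y. y \<in> obox n a b \<Longrightarrow> infinite {t. y(n := t) \<in> A}"
  shows "has_box (Suc n) A"
proof -
  have "\<exists>B\<in>(\<lambda>(q, r). slab n A q r) ` rat_pairs. has_box n B"
  proof (rule countable_cover_has_box[OF _ _ ab])
    show "obox n a b \<subseteq> \<Union>((\<lambda>(q, r). slab n A q r) ` rat_pairs)"
    proof
      fix y assume y: "y \<in> obox n a b"
      then have yr: "y \<in> rspace n" "y \<in> rspace (Suc n)" by (auto simp: obox_def rspace_def)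
      obtain q r where "q \<in> \<rat>" "r \<in> \<rat>" "q < r" "\<And>t. q < t \<Longrightarrow> t < r \<Longrightarrow> y(n := t) \<in> A"
        using fiber_interval[OF A _ yr(2) inf[OF y]] by blast
      then show "y \<in> \<Union>((\<lambda>(q, r). slab n A q r) ` rat_pairs)"
        using yr by (auto simp: slab_def intro!: bexI[of _ "(q, r)"])
    qed
  qed (use A countable_rat_pairs in \<open>auto intro!: slab_D\<close>)
  then show ?thesis by (auto intro: has_box_slab)
qed

text \<open>The box is covered by the set of continuity points and the sets where \<open>f\<close>
  jumps by at least \<open>1 / (k + 1)\<close> arbitrarily close by. If one of the latter contained
  a box, covering it by thin level strips of \<open>f\<close> would give a smaller box on which
  \<open>f\<close> varies too little.\<close>

lemma generic_continuity:
  assumes f: "def_fun f" "\<And>e. f e = f (restr n e)" and ab: "\<forall>i<n. a i < b i"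
  obtains a' b' where "\<forall>i<n. a' i < b' i" "obox n a' b' \<subseteq> obox n a b" "continuous_on (obox n a' b') f"
proof -
  have fs: "def_fun (\<lambda>e. f (\<lambda>i. F e i))" if "\<And>i. def_fun (\<lambda>e. F e i)" for F
    using def_fun_subst[OF f(1), of "\<lambda>i e. F e i"] that by simp
  define close where "close \<delta> y y' \<longleftrightarrow> (\<forall>i<n. \<bar>y' i - y i\<bar> < (\<delta>::real))" for \<delta> and y y' :: "nat \<Rightarrow> real"
  define cont where "cont y \<longleftrightarrow> (\<forall>\<epsilon>. 0 < \<epsilon> \<longrightarrow> (\<exists>\<delta>. 0 < \<delta> \<and>
      (\<forall>y'. close \<delta> y y' \<longrightarrow> \<bar>f y' - f y\<bar> < \<epsilon>)))" for y
  define osc where "osc k y \<longleftrightarrow> (\<forall>\<delta>. 0 < \<delta> \<longrightarrow> (\<exists>y'. close \<delta> y y' \<and> 1 / real (Suc k) \<le> \<bar>f y' - f y\<bar>))" for k y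
  have close_restr: "close \<delta> y (restr n y') = close \<delta> y y'" for \<delta> y y' by (simp add: close_def)
  have "def_pred cont"
    unfolding cont_def close_def
    by (intro def_intros def_pred_all_seq[where n = n] fs) (simp_all add: f(2)[symmetric])
  have "def_pred (osc k)" for k
    unfolding osc_def close_def
    by (intro def_intros def_pred_ex_seq[where n = n] fs) (simp_all add: f(2)[symmetric])
  define \<A> where "\<A> = insert {y \<in> rspace n. cont y} (range (\<lambda>k. {y \<in> rspace n. osc k y}))"
  define \<A>' where "\<A>' = (\<lambda>A. obox n a b \<inter> A) ` \<A>"
  have "\<A> \<subseteq> D n"
    unfolding \<A>_def using \<open>def_pred cont\<close> \<open>\<And>k. def_pred (osc k)\<close> by (auto intro!: def_pred_D)
  then have "\<A>' \<subseteq> D n" by (auto simp: \<A>'_def intro!: inter obox_D)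
  moreover have "countable \<A>'" by (simp add: \<A>_def \<A>'_def)
  moreover have "obox n a b \<subseteq> \<Union>\<A>'"
  proof
    fix y assume y: "y \<in> obox n a b"
    then have yr: "y \<in> rspace n" by (simp add: obox_def)
    show "y \<in> \<Union>\<A>'"
    proof (cases "cont y")
      case True
      then show ?thesis using y yr by (auto simp: \<A>_def \<A>'_def)
    next
      case False
      then obtain \<epsilon> where e: "0 < \<epsilon>" "\<And>\<delta>. 0 < \<delta> \<Longrightarrow> \<exists>y'. close \<delta> y y' \<and> \<epsilon> \<le> \<bar>f y' - f y\<bar>"
        unfolding cont_def by (meson not_less)
      obtain k where "1 / real (Suc k) < \<epsilon>"
        using e(1) nat_approx_posE by metis
      with e(2) have "osc k y" unfolding osc_def by (meson less_imp_le order_trans)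
      then show ?thesis using y yr by (auto simp: \<A>_def \<A>'_def)
    qed
  qed
  ultimately obtain A where A: "A \<in> \<A>" "has_box n (obox n a b \<inter> A)"
    using countable_cover_has_box[of \<A>' n a b] ab by (auto simp: \<A>'_def)
  then obtain a' b' where ab': "\<forall>i<n. a' i < b' i" "obox n a' b' \<subseteq> obox n a b" "obox n a' b' \<subseteq> A"
    by (auto simp: has_box_def)
  consider "A = {y \<in> rspace n. cont y}" | k where "A = {y \<in> rspace n. osc k y}"
    using A(1) by (auto simp: \<A>_def)
  then show thesis
  proof cases
    case 1
    have "continuous_on (obox n a' b') f"
      using ab'(3) 1 by (intro continuous_on_obox[where n = n] f(2)) (auto simp: cont_def close_def)
    with that ab' show thesis by blast
  next
    case (2 k)
    \<comment> \<open>The strips \<open>V j\<close> have width \<open>h\<close>, half the jump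
      bound, so two points of one strip cannot exhibit the jump.\<close>
    define h where "h = 1 / (2 * real (Suc k))"
    have h: "h > 0" "1 / real (Suc k) = 2 * h" by (simp_all add: h_def field_simps)
    define V where "V j = {y \<in> rspace n. real_of_int j * h \<le> f y \<and> f y < (real_of_int j + 1) * h}" for j
    have "\<exists>A\<in>range (\<lambda>j. obox n a' b' \<inter> V j). has_box n A"
    proof (rule countable_cover_has_box[OF _ _ ab'(1)])
      show "range (\<lambda>j. obox n a' b' \<inter> V j) \<subseteq> D n"
        unfolding V_def by (auto intro!: inter obox_D def_pred_D def_intros f(1))
      show "obox n a' b' \<subseteq> (\<Union>j. obox n a' b' \<inter> V j)"
      proof
        fix y assume y: "y \<in> obox n a' b'"
        define j where "j = \<lfloor>f y / h\<rfloor>"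
        have "real_of_int j \<le> f y / h" "f y / h < real_of_int j + 1"
          unfolding j_def by linarith+
        then have "y \<in> V j"
          using y h(1) by (auto simp: V_def obox_def pos_le_divide_eq pos_divide_less_eq)
        with y show "y \<in> (\<Union>j. obox n a' b' \<inter> V j)" by blast
      qed
    qed simp
    then obtain j c d where cd: "\<forall>i<n. c i < d i" "obox n c d \<subseteq> obox n a' b'" "obox n c d \<subseteq> V j"
      by (auto simp: has_box_def)
    define y where "y = restr n (\<lambda>i. (c i + d i) / 2)"
    have y: "y \<in> obox n c d" using cd(1) by (auto simp: obox_def y_def)
    obtain \<delta> where \<delta>: "\<delta> > 0" "\<And>y'. close \<delta> y y' \<Longrightarrow> restr n y' \<in> obox n c d"
      using obox_open[OF y] by (auto simp: close_def)
    have "osc k y" using y cd(2) ab'(3) 2 by auto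
    then obtain y' where y': "close \<delta> y y'" "2 * h \<le> \<bar>f y' - f y\<bar>"
      unfolding osc_def h using \<delta>(1) by blast
    have "restr n y' \<in> V j" "y \<in> V j" using \<delta>(2)[OF y'(1)] y cd(3) by auto
    then have "\<bar>f (restr n y') - f y\<bar> < h" by (auto simp: V_def algebra_simps)
    with y'(2) f(2)[of y'] h(1) show thesis by auto
  qed
qed

section \<open>Definability and construction of cells\<close>

lemma cgraph_iff: "C \<subseteq> rspace n \<Longrightarrow> y \<in> rspace n \<Longrightarrow> y(n := u) \<in> cgraph n C h \<longleftrightarrow> y \<in> C \<and> u = h y"
proof -
  assume C: "C \<subseteq> rspace n" and y: "y \<in> rspace n"
  have "y = x \<and> u = h x" if "x \<in> C" "y(n := u) = x(n := h x)" for x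
    using restr_upd[OF y, of u] restr_upd[of x n "h x"] that C fun_upd_same[of y n u] fun_upd_same[of x n "h x"] by auto
  then show ?thesis by (auto simp: cgraph_def)
qed

text \<open>A real-valued bound is eliminated by quantifying over its value \<open>u\<close>, read
  off from its definable graph. An infinite bound turns the condition into membership in
  \<open>C\<close> or into falsity.\<close>

lemma cell_bound_definable:
  assumes C: "C \<in> D n" and f: "cell_bound D n C f"
  shows "def_pred (\<lambda>z. restr n z \<in> C \<and> f (restr n z) < ereal (z n))" (is ?lo)
    and "def_pred (\<lambda>z. restr n z \<in> C \<and> ereal (z n) < f (restr n z))" (is ?hi)
proof -
  have C': "def_pred (\<lambda>z. restr n z \<in> C)"
    by (intro def_intros D_mem[OF C]) auto
  have "?lo \<and> ?hi"
    using f unfolding cell_bound_def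
  proof (elim disjE exE conjE)
    fix h assume h: "cgraph n C h \<in> D (Suc n)" "\<forall>x\<in>C. f x = ereal (h x)"
    have *: "restr n z \<in> C \<and> P (f (restr n z)) \<longleftrightarrow> (\<exists>u. (restr n z)(n := u) \<in> cgraph n C h \<and> P (ereal u))" for z P
      using h(2) by (auto simp: cgraph_iff[OF subset_rspace[OF C]])
    have "def_pred (\<lambda>z. \<exists>u. (restr n z)(n := u) \<in> cgraph n C h \<and> u < z n)"
      "def_pred (\<lambda>z. \<exists>u. (restr n z)(n := u) \<in> cgraph n C h \<and> z n < u)"
      by (intro def_intros D_mem[OF h(1)]; auto)+
    then show ?thesis using *[of _ "\<lambda>u. u < ereal (z n)" for z] *[of _ "\<lambda>u. ereal (z n) < u" for z] by simp
  next
    assume "\<forall>x\<in>C. f x = -\<infinity>"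
    then have "(restr n z \<in> C \<and> f (restr n z) < ereal (z n)) = (restr n z \<in> C)"
      "(restr n z \<in> C \<and> ereal (z n) < f (restr n z)) = False" for z by auto
    then show ?thesis using C' def_pred_const by (simp only: simp_thms)
  next
    assume "\<forall>x\<in>C. f x = \<infinity>"
    then have "(restr n z \<in> C \<and> f (restr n z) < ereal (z n)) = False"
      "(restr n z \<in> C \<and> ereal (z n) < f (restr n z)) = (restr n z \<in> C)" for z by auto
    then show ?thesis using C' def_pred_const by (simp only: simp_thms)
  qed
  then show ?lo ?hi by blast+
qed

lemma band_eq:
  assumes "C \<subseteq> rspace n"
  shows "{x(n := t) | x t. x \<in> C \<and> f x < ereal t \<and> ereal t < g x} =
    {z \<in> rspace (Suc n). (restr n z \<in> C \<and> f (restr n z) < ereal (z n)) \<and>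
      (restr n z \<in> C \<and> ereal (z n) < g (restr n z))}" (is "?L = ?R")
proof (intro set_eqI iffI)
  fix z assume "z \<in> ?L"
  then show "z \<in> ?R" using assms restr_upd[of _ n] by (auto intro: rspace_Suc_upd)
next
  fix z assume "z \<in> ?R"
  then show "z \<in> ?L" using restr_upd_self[of z n]
    by (auto intro!: exI[of _ "restr n z"] exI[of _ "z n"])
qed

lemma cell_D: "cell D js C \<Longrightarrow> C \<in> D (length js)"
proof (induction rule: cell.induct)
  case point
  have "{x \<in> rspace 0. True} \<in> D 0" by (intro def_pred_D def_pred_const)
  also have "{x \<in> rspace 0. True} = {\<lambda>_. 0}" by (auto simp: rspace_def)
  finally show ?case by simp
next
  case (graph js C f)
  then show ?case by simp
next
  case (band js C f g)
  have "{z \<in> rspace (Suc (length js)).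
      (restr (length js) z \<in> C \<and> f (restr (length js) z) < ereal (z (length js))) \<and>
      (restr (length js) z \<in> C \<and> ereal (z (length js)) < g (restr (length js) z))} \<in> D (Suc (length js))"
    using band by (intro def_pred_D def_pred_conj cell_bound_definable)
  then show ?case by (simp only: band_eq[OF subset_rspace[OF band.IH]] length_append list.size add_Suc_right add_0_right)
qed

lemma cell_le_1: "cell D js C \<Longrightarrow> set js \<subseteq> {0, 1}"
  by (induction rule: cell.induct) auto

text \<open>Over a box in the base the fibers of a band are nonempty open intervals, hence infinite,
  so \<open>infinite_fibers_has_box\<close> applies. This links cells of full dimension to nonempty
  interior.\<close>

lemma open_cell_has_box: "cell D js C \<Longrightarrow> set js \<subseteq> {1} \<Longrightarrow> has_box (length js) C"
proof (induction rule: cell.induct)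
  case point
  have "obox 0 (\<lambda>_. 0) (\<lambda>_. 0) \<subseteq> {\<lambda>_. 0}" by (auto simp: obox_def rspace_def)
  then show ?case by (auto simp: has_box_def)
next
  case (graph js C f)
  then show ?case by simp
next
  case (band js C f g)
  let ?n = "length js"
  let ?B = "{x(?n := t) | x t. x \<in> C \<and> f x < ereal t \<and> ereal t < g x}"
  have B: "?B \<in> D (Suc ?n)" using cell_D[OF cell.band[OF band.hyps]] by simp
  from band.IH band.prems obtain a b where ab: "\<forall>i<?n. a i < b i" "obox ?n a b \<subseteq> C"
    by (auto simp: has_box_def)
  have "has_box (Suc ?n) ?B"
  proof (rule infinite_fibers_has_box[OF B ab(1)])
    fix y assume "y \<in> obox ?n a b"
    then have y: "y \<in> C" using ab(2) by blast
    obtain u where u: "f y < ereal u" "ereal u < g y" using ereal_dense2[OF band.hyps(4)[OF y]] by blast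
    obtain v where v: "ereal u < ereal v" "ereal v < g y" using ereal_dense2[OF u(2)] by blast
    have "{u..v} \<subseteq> {t. y(?n := t) \<in> ?B}"
    proof
      fix t assume t: "t \<in> {u..v}"
      have "f y < ereal t" using u(1) t by (auto elim: less_le_trans)
      moreover have "ereal t < g y" using v(2) t by (auto elim: le_less_trans[rotated])
      ultimately show "t \<in> {t. y(?n := t) \<in> ?B}" using y by blast
    qed
    moreover have "infinite {u..v}" using v(1) by simp
    ultimately show "infinite {t. y(?n := t) \<in> ?B}" using finite_subset by blast
  qed
  then show ?case by simp
qed

lemma band_cell:
  assumes "cell D js C" "q < r"
  shows "cell D (js @ [1]) {x(length js := t) | x t. x \<in> C \<and> q < t \<and> t < r}"
proof -
  have bd: "cell_bound D (length js) C (\<lambda>_. ereal c)" for c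
  proof -
    have C: "C \<in> D (length js)" by (rule cell_D[OF assms(1)])
    have "{z \<in> rspace (Suc (length js)). restr (length js) z \<in> C \<and> z (length js) = c} \<in> D (Suc (length js))"
      by (intro def_pred_D def_intros D_mem[OF C]) auto
    also have "{z \<in> rspace (Suc (length js)). restr (length js) z \<in> C \<and> z (length js) = c} = cgraph (length js) C (\<lambda>_. c)"
      using subset_rspace[OF C] restr_upd[of _ "length js" c] restr_upd_self[of _ "length js"]
      by (auto simp: cgraph_def image_iff intro: rspace_Suc_upd) (metis)
    finally show ?thesis unfolding cell_bound_def by (auto intro!: exI[of _ "\<lambda>_. c"])
  qed
  from cell.band[OF assms(1) bd bd, of q r] assms(2) show ?thesis by simp
qed

lemma obox_cell: "\<forall>i<n. a i < b i \<Longrightarrow> cell D (replicate n 1) (obox n a b)"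
proof (induction n)
  case 0
  have "obox 0 a b = {\<lambda>_. 0}" by (auto simp: obox_def rspace_def)
  then show ?case using cell.point by simp
next
  case (Suc n)
  then have "cell D (replicate n 1 @ [1]) {x(n := t) | x t. x \<in> obox n a b \<and> a n < t \<and> t < b n}"
    using band_cell[of "replicate n 1" "obox n a b" "a n" "b n"] by simp
  also have "{x(n := t) | x t. x \<in> obox n a b \<and> a n < t \<and> t < b n} = obox (Suc n) a b"
  proof (intro set_eqI iffI)
    fix z assume "z \<in> {x(n := t) | x t. x \<in> obox n a b \<and> a n < t \<and> t < b n}"
    then obtain x t where z: "z = x(n := t)" "x \<in> obox n a b" "a n < t" "t < b n" by blast
    then have "x \<in> rspace n" by (simp add: obox_def)
    with z show "z \<in> obox (Suc n) a b" by (simp add: obox_Suc restr_upd rspace_Suc_upd)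
  next
    fix z assume "z \<in> obox (Suc n) a b"
    then show "z \<in> {x(n := t) | x t. x \<in> obox n a b \<and> a n < t \<and> t < b n}"
      using restr_upd_self[of z n] by (auto simp: obox_Suc intro!: exI[of _ "restr n z"] exI[of _ "z n"])
  qed
  finally show ?case by (simp add: replicate_append_same)
qed

text \<open>The section that picks the least point of each fiber, attained by compactness, is
  definable. It is continuous on a smaller box by \<open>generic_continuity\<close>, and its graph
  there is the cell.\<close>

lemma graph_cell:
  assumes S: "S \<in> D (Suc n)" and "has_box n {y \<in> rspace n. \<exists>z. y(n := z) \<in> S}"
    and cpt: "\<And>y. compact {t. y(n := t) \<in> S}"
  shows "\<exists>C. cell D (replicate n 1 @ [0]) C \<and> C \<subseteq> S"
proof -
  obtain a b where ab: "\<forall>i<n. a i < b i" "obox n a b \<subseteq> {y \<in> rspace n. \<exists>z. y(n := z) \<in> S}"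
    using assms(2) by (auto simp: has_box_def)
  \<comment> \<open>The default 0 over empty fibers makes \<open>f\<close> total, and the truncation
    makes it depend on the first \<open>n\<close> variables only, as
    \<open>generic_continuity\<close> requires.\<close>
  define f where "f e = (if \<exists>z. (restr n e)(n := z) \<in> S then Inf {z. (restr n e)(n := z) \<in> S} else 0)" for e
  have fS: "(restr n e)(n := f e) \<in> S" "\<And>z. (restr n e)(n := z) \<in> S \<Longrightarrow> f e \<le> z"
    if "\<exists>z. (restr n e)(n := z) \<in> S" for e
  proof -
    let ?Z = "{z. (restr n e)(n := z) \<in> S}"
    have "Inf ?Z \<in> ?Z" using that cpt[of "restr n e"]
      by (intro closed_contains_Inf) (auto simp: compact_imp_closed compact_imp_bounded bounded_imp_bdd_below)
    with that show "(restr n e)(n := f e) \<in> S" by (simp add: f_def)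
    show "f e \<le> z" if "(restr n e)(n := z) \<in> S" for z
      using that cpt[of "restr n e"] \<open>\<exists>z. _\<close>
      by (auto simp: f_def intro!: cInf_lower bounded_imp_bdd_below compact_imp_bounded)
  qed
  have "e 0 = f (\<lambda>i. e (Suc i)) \<longleftrightarrow>
      ((restr n (\<lambda>i. e (Suc i)))(n := e 0) \<in> S \<and> (\<forall>z. (restr n (\<lambda>i. e (Suc i)))(n := z) \<in> S \<longrightarrow> e 0 \<le> z)) \<or>
      (\<not> (\<exists>z. (restr n (\<lambda>i. e (Suc i)))(n := z) \<in> S) \<and> e 0 = 0)" for e
  proof (cases "\<exists>z. (restr n (\<lambda>i. e (Suc i)))(n := z) \<in> S")
    case True
    from fS[OF this] show ?thesis using True by (metis order_antisym)
  next
    case False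
    then show ?thesis by (auto simp: f_def)
  qed
  moreover have "def_pred (\<lambda>e. ((restr n (\<lambda>i. e (Suc i)))(n := e 0) \<in> S \<and> (\<forall>z. (restr n (\<lambda>i. e (Suc i)))(n := z) \<in> S \<longrightarrow> e 0 \<le> z)) \<or>
      (\<not> (\<exists>z. (restr n (\<lambda>i. e (Suc i)))(n := z) \<in> S) \<and> e 0 = 0))"
    by (intro def_intros D_mem[OF S]) auto
  ultimately have f: "def_fun f" unfolding def_fun_def by simp
  have f_restr: "f e = f (restr n e)" for e by (simp add: f_def)
  from generic_continuity[OF f f_restr ab(1)] obtain c d where
    cd: "\<forall>i<n. c i < d i" "obox n c d \<subseteq> obox n a b" "continuous_on (obox n c d) f" .
  have sub: "obox n c d \<subseteq> rspace n" by (auto simp: obox_def)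
  have "{z \<in> rspace (Suc n). restr n z \<in> obox n c d \<and> z n = f z} \<in> D (Suc n)"
    using f by (intro def_pred_D def_intros D_mem[OF obox_D]) auto
  also have "{z \<in> rspace (Suc n). restr n z \<in> obox n c d \<and> z n = f z} = cgraph n (obox n c d) f"
  proof (intro set_eqI iffI)
    fix z assume "z \<in> {z \<in> rspace (Suc n). restr n z \<in> obox n c d \<and> z n = f z}"
    then show "z \<in> cgraph n (obox n c d) f"
      using restr_upd_self[of z n] f_restr[of z]
      by (auto simp: cgraph_def image_iff intro!: bexI[of _ "restr n z"])
  next
    fix z assume "z \<in> cgraph n (obox n c d) f"
    then obtain x where x: "x \<in> obox n c d" "z = x(n := f x)" by (auto simp: cgraph_def)
    then have "x \<in> rspace n" using sub by auto
    with x f_restr[of z] show "z \<in> {z \<in> rspace (Suc n). restr n z \<in> obox n c d \<and> z n = f z}"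
      by (simp add: restr_upd rspace_Suc_upd)
  qed
  finally have "cell D (replicate n 1 @ [0]) (cgraph n (obox n c d) f)"
    using cell.graph[OF obox_cell[OF cd(1)], of f] cd(3) by simp
  moreover have "cgraph n (obox n c d) f \<subseteq> S"
  proof
    fix z assume "z \<in> cgraph n (obox n c d) f"
    then obtain x where x: "x \<in> obox n c d" "z = x(n := f x)" by (auto simp: cgraph_def)
    then have "x \<in> rspace n" "\<exists>u. x(n := u) \<in> S" using ab(2) cd(2) by auto
    then show "z \<in> S" using fS(1)[of x] x by (simp add: restr_rspace)
  qed
  ultimately show ?thesis by blast
qed

text \<open>If the projection that forgets the last coordinate has a box in its image, the graph of a
  definable section is a cell as desired. Otherwise the fibers of the image in direction \<open>m\<close> are
  generically finite, so \<open>S\<close> contains the product of an interval with a set in one dimension less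
  to which the induction hypothesis applies.\<close>

lemma codim1_cell:
  assumes "S \<in> D n" "m < n" "\<forall>i<n. a i < b i" "\<And>x. x \<in> obox n a b \<Longrightarrow> \<exists>t. x(m := t) \<in> S"
    and "\<And>x i. i < n \<Longrightarrow> compact {t. x(i := t) \<in> S}"
  shows "\<exists>js C. length js = n \<and> Suc (sum_list js) = n \<and> cell D js C \<and> C \<subseteq> S"
  using assms
proof (induction n arbitrary: S a b)
  case (Suc n)
  note S = Suc.prems(1)
  define P where "P = {y \<in> rspace n. \<exists>z. y(n := z) \<in> S}"
  have graph: ?case if box: "has_box n P"
  proof -
    obtain C where "cell D (replicate n 1 @ [0]) C" "C \<subseteq> S"
      using graph_cell[OF S box[unfolded P_def] Suc.prems(5)] by blast
    then show ?thesis by (intro exI[of _ "replicate n 1 @ [0]"] exI[of _ C]) (simp add: sum_list_replicate)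
  qed
  define z0 where "z0 = (a n + b n) / 2"
  have z0: "a n < z0" "z0 < b n" using Suc.prems(3) by (auto simp: z0_def)
  have ext: "y(n := z) \<in> obox (Suc n) a b" if "y \<in> obox n a b" "a n < z" "z < b n" for y z
    using that by (auto simp: obox_def rspace_def)
  show ?case
  proof (cases "m = n")
    case True
    have "obox n a b \<subseteq> P"
    proof
      fix y assume y: "y \<in> obox n a b"
      from Suc.prems(4)[OF ext[OF y z0]] True have "\<exists>z. y(n := z) \<in> S" by (simp only: fun_upd_upd)
      with y show "y \<in> P" by (simp add: P_def obox_def)
    qed
    moreover have "\<forall>i<n. a i < b i" using Suc.prems(3) by simp
    ultimately have "has_box n P" unfolding has_box_def by blast
    then show ?thesis by (rule graph)
  next
    case False
    with Suc.prems(2) have m: "m < n" by simp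
    \<comment> \<open>\<open>N\<close> records where the line in direction \<open>m\<close> meets
      \<open>P\<close> in a whole interval, and \<open>R\<close> where some point of that line has a
      whole interval of \<open>S\<close> above it. Which one occurs depends on whether the fiber
      \<open>F\<close> of \<open>P\<close> is infinite or finite.\<close>
    define N where "N q r = {x \<in> rspace n. \<forall>s. q < s \<and> s < r \<longrightarrow> x(m := s) \<in> P}" for q r
    define R where "R q r = {x \<in> rspace n. \<exists>s. x(m := s) \<in> slab n S q r}" for q r
    have "def_pred (\<lambda>e. \<exists>z. (restr n e)(n := z) \<in> S)"
      by (intro def_intros D_mem[OF S]) auto
    from def_pred_D[OF this, of n] have P: "P \<in> D n"
      unfolding P_def by (rule back_subst[of "\<lambda>x. x \<in> D n"]) (auto simp: restr_rspace)
    have "def_pred (\<lambda>e. \<forall>s. q < s \<and> s < r \<longrightarrow> (restr n e)(m := s) \<in> P)" for q r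
      using m by (intro def_intros D_mem[OF P]) auto
    from def_pred_D[OF this, of n] have N: "N q r \<in> D n" for q r
      unfolding N_def by (rule back_subst[of "\<lambda>x. x \<in> D n"]) (auto simp: restr_rspace)
    have "def_pred (\<lambda>e. \<exists>s. (restr n e)(m := s) \<in> slab n S q r)" for q r
      using m by (intro def_intros D_mem[OF slab_D[OF S]]) auto
    from def_pred_D[OF this, of n] have R: "R q r \<in> D n" for q r
      unfolding R_def by (rule back_subst[of "\<lambda>x. x \<in> D n"]) (auto simp: restr_rspace)
    define \<A> where "\<A> = (\<lambda>(q, r). N q r) ` rat_pairs \<union> (\<lambda>(q, r). R q r) ` rat_pairs"
    have "\<exists>A\<in>\<A>. has_box n A"
    proof (rule countable_cover_has_box)
      show "countable \<A>" using countable_rat_pairs by (simp add: \<A>_def)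
      show "\<A> \<subseteq> D n" using N R by (auto simp: \<A>_def)
      show "\<forall>i<n. a i < b i" using Suc.prems(3) by simp
      show "obox n a b \<subseteq> \<Union>\<A>"
      proof
        fix x assume x: "x \<in> obox n a b"
        then have xr: "x \<in> rspace n" by (simp add: obox_def)
        define F where "F = {s. x(m := s) \<in> P}"
        show "x \<in> \<Union>\<A>"
        proof (cases "finite F")
          case False
          from fiber_interval[OF P m xr False[unfolded F_def]]
          obtain q r where "q \<in> \<rat>" "r \<in> \<rat>" "q < r" "\<And>t. q < t \<Longrightarrow> t < r \<Longrightarrow> x(m := t) \<in> P" by blast
          then have "x \<in> N q r" "(q, r) \<in> rat_pairs" using xr by (auto simp: N_def)
          then show ?thesis by (auto simp: \<A>_def)
        next
          case True
          \<comment> \<open>Every height \<open>z\<close> has a point of \<open>S\<close> over some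
            \<open>s\<close> in the finite set \<open>F\<close>, so a single \<open>s\<close> serves
            infinitely many heights.\<close>
          have "{a n<..<b n} \<subseteq> (\<Union>s\<in>F. {z. (x(m := s))(n := z) \<in> S})"
          proof
            fix z assume z: "z \<in> {a n<..<b n}"
            then have "x(n := z) \<in> obox (Suc n) a b" using ext[OF x] by simp
            from Suc.prems(4)[OF this] obtain s where "(x(n := z))(m := s) \<in> S" ..
            then have "(x(m := s))(n := z) \<in> S" using m by (simp add: fun_upd_twist)
            moreover from this have "s \<in> F" using xr m by (auto simp: F_def P_def rspace_upd)
            ultimately show "z \<in> (\<Union>s\<in>F. {z. (x(m := s))(n := z) \<in> S})" by blast
          qed
          moreover have "infinite {a n<..<b n}" using Suc.prems(3) by simp
          ultimately obtain s where s: "infinite {z. (x(m := s))(n := z) \<in> S}"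
            using True by (meson finite_UN finite_subset)
          have xs: "x(m := s) \<in> rspace n" using xr m by (simp add: rspace_upd)
          then have "x(m := s) \<in> rspace (Suc n)" by (auto simp: rspace_def)
          from fiber_interval[OF S _ this s]
          obtain q r where "q \<in> \<rat>" "r \<in> \<rat>" "q < r" "\<And>t. q < t \<Longrightarrow> t < r \<Longrightarrow> (x(m := s))(n := t) \<in> S" by blast
          then have "x \<in> R q r" "(q, r) \<in> rat_pairs" using xr xs by (auto simp: R_def slab_def)
          then show ?thesis by (auto simp: \<A>_def)
        qed
      qed
    qed
    then consider q r where "q < r" "has_box n (N q r)" | q r where "q < r" "has_box n (R q r)"
      by (auto simp: \<A>_def)
    then show ?thesis
    proof cases
      case (1 q r)
      then obtain c d where cd: "\<forall>i<n. c i < d i" "obox n c d \<subseteq> N q r" by (auto simp: has_box_def)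
      \<comment> \<open>Membership in \<open>N q r\<close> does not depend on coordinate
        \<open>m\<close>. That coordinate may therefore be moved into the box, and the side in
        direction \<open>m\<close> replaced by the interval from \<open>q\<close> to
        \<open>r\<close>.\<close>
      have "obox n (c(m := q)) (d(m := r)) \<subseteq> P"
      proof
        fix y assume y: "y \<in> obox n (c(m := q)) (d(m := r))"
        have "y(m := (c m + d m) / 2) \<in> obox n c d"
          unfolding obox_def
        proof (intro CollectI conjI allI impI)
          show "y(m := (c m + d m) / 2) \<in> rspace n" using y m by (simp add: rspace_upd obox_def)
          fix i assume "i < n"
          then show "c i < (y(m := (c m + d m) / 2)) i" "(y(m := (c m + d m) / 2)) i < d i"
            using y cd(1) m by (auto simp: obox_def split: if_splits)
        qed
        then have "y(m := (c m + d m) / 2) \<in> N q r" using cd(2) by blast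
        moreover have "q < y m" "y m < r" using y m by (auto simp: obox_def)
        ultimately have "y(m := (c m + d m) / 2, m := y m) \<in> P" unfolding N_def by blast
        then show "y \<in> P" by simp
      qed
      with cd(1) 1(1) have "has_box n P" unfolding has_box_def
        by (intro exI[of _ "c(m := q)"] exI[of _ "d(m := r)"]) auto
      then show ?thesis by (rule graph)
    next
      case (2 q r)
      then obtain c d where cd: "\<forall>i<n. c i < d i" "obox n c d \<subseteq> R q r" by (auto simp: has_box_def)
      have cpt: "compact {t. x(i := t) \<in> slab n S q r}" if "i < n" for x i
      proof (cases "x \<in> rspace n")
        case True
        \<comment> \<open>A line section of the slab is an intersection of line sections of
          \<open>S\<close> at the heights \<open>z\<close>. One of them supplies compactness, the
          others closedness.\<close>
        have eq: "{t. x(i := t) \<in> slab n S q r} = (\<Inter>z\<in>{q<..<r}. {t. (x(n := z))(i := t) \<in> S})"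
          using that True by (auto simp: slab_def rspace_upd fun_upd_twist)
        define z where "z = (q + r) / 2"
        have z: "z \<in> {q<..<r}" using 2(1) by (auto simp: z_def)
        have c: "compact {t. (x(n := z))(i := t) \<in> S}" for z
          using that by (intro Suc.prems(5)) simp
        have "{t. x(i := t) \<in> slab n S q r} = {t. (x(n := z))(i := t) \<in> S} \<inter> (\<Inter>z\<in>{q<..<r}. {t. (x(n := z))(i := t) \<in> S})"
          unfolding eq using z by blast
        moreover have "closed (\<Inter>z\<in>{q<..<r}. {t. (x(n := z))(i := t) \<in> S})"
          using c by (intro closed_INT ballI compact_imp_closed)
        ultimately show ?thesis using c compact_Int_closed by metis
      next
        case False
        then have "{t. x(i := t) \<in> slab n S q r} = {}" using that by (auto simp: slab_def rspace_upd)
        then show ?thesis by (simp only: compact_empty)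
      qed
      have "\<And>x. x \<in> obox n c d \<Longrightarrow> \<exists>t. x(m := t) \<in> slab n S q r" using cd(2) by (auto simp: R_def)
      from Suc.IH[OF slab_D[OF S] m cd(1) this cpt] obtain js C where
        C: "length js = n" "Suc (sum_list js) = n" "cell D js C" "C \<subseteq> slab n S q r" by blast
      from band_cell[OF C(3) 2(1)] C(1)
      have "cell D (js @ [1]) {x(n := t) | x t. x \<in> C \<and> q < t \<and> t < r}" by simp
      moreover have "{x(n := t) | x t. x \<in> C \<and> q < t \<and> t < r} \<subseteq> S"
        using C(4) by (auto simp: slab_def)
      ultimately show ?thesis using C(1,2)
        by (intro exI[of _ "js @ [1]"] exI[of _ "{x(n := t) | x t. x \<in> C \<and> q < t \<and> t < r}"]) simp
    qed
  qed
qed simp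

end

section \<open>First-order behaviour of distance functions\<close>

definition foot :: "'a::euclidean_space \<Rightarrow> 'a set \<Rightarrow> 'a set" where
  "foot x K = {p \<in> K. dist x p = infdist x K}"

text \<open>The one-sided directional derivative of half the squared distance, for closed nonempty
  \<open>K\<close>. Squaring avoids a division by the distance, so points of \<open>K\<close> are
  covered too, with slope 0.\<close>

definition slope :: "'a::euclidean_space \<Rightarrow> 'a set \<Rightarrow> 'a \<Rightarrow> real" where
  "slope x K w = Inf ((\<lambda>p. w \<bullet> (x - p)) ` foot x K)"

lemma foot_nonempty: "closed K \<Longrightarrow> K \<noteq> {} \<Longrightarrow> foot x K \<noteq> {}"
proof -
  assume "closed K" "K \<noteq> {}"
  then obtain p where "p \<in> K" "infdist x K = dist x p" by (rule infdist_attains_inf)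
  then have "p \<in> foot x K" by (simp add: foot_def)
  then show ?thesis by blast
qed

lemma compact_foot: "closed K \<Longrightarrow> compact (foot x K)"
proof -
  have "foot x K = K \<inter> sphere x (infdist x K)" by (auto simp: foot_def)
  then show "closed K \<Longrightarrow> ?thesis" by (metis closed_Int_compact compact_sphere)
qed

lemma norm_foot: "p \<in> foot x K \<Longrightarrow> norm (x - p) = infdist x K"
  by (simp add: foot_def dist_norm)

lemma slope_attained:
  assumes "closed K" "K \<noteq> {}"
  obtains p where "p \<in> foot x K" "slope x K w = w \<bullet> (x - p)" "\<And>q. q \<in> foot x K \<Longrightarrow> w \<bullet> (x - p) \<le> w \<bullet> (x - q)"
proof -
  have "continuous_on (foot x K) (\<lambda>p. w \<bullet> (x - p))" by (intro continuous_intros)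
  from continuous_attains_inf[OF compact_foot[OF assms(1)] foot_nonempty[OF assms] this]
  obtain p where p: "p \<in> foot x K" "\<And>q. q \<in> foot x K \<Longrightarrow> w \<bullet> (x - p) \<le> w \<bullet> (x - q)" by blast
  then have "slope x K w = w \<bullet> (x - p)"
    unfolding slope_def by (intro cInf_eq_minimum) auto
  with p that show thesis by blast
qed

lemma slope_le:
  assumes "closed K" "p \<in> foot x K"
  shows "slope x K w \<le> w \<bullet> (x - p)"
proof -
  have "K \<noteq> {}" using assms(2) by (auto simp: foot_def)
  from slope_attained[OF assms(1) this, of x w] assms(2) show ?thesis by metis
qed

text \<open>A minimizing foot for \<open>w'\<close> is a competitor for \<open>w\<close>, and
  \<open>x - p\<close> has length \<open>infdist x K\<close> for every foot
  \<open>p\<close>.\<close>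

lemma slope_diff_le:
  assumes "closed K" "K \<noteq> {}"
  shows "slope x K w - slope x K w' \<le> infdist x K * norm (w - w')"
proof -
  obtain p where p: "p \<in> foot x K" "slope x K w' = w' \<bullet> (x - p)"
    using slope_attained[OF assms, of x w'] by metis
  have "slope x K w - slope x K w' \<le> (w - w') \<bullet> (x - p)"
    using slope_le[OF assms(1) p(1), of w] p(2) by (simp add: inner_diff_left)
  also have "\<dots> \<le> norm (w - w') * norm (x - p)" by (rule norm_cauchy_schwarz)
  finally show ?thesis by (simp add: norm_foot[OF p(1)] mult.commute)
qed

lemma slope_lipschitz:
  assumes "closed K" "K \<noteq> {}"
  shows "\<bar>slope x K w - slope x K w'\<bar> \<le> infdist x K * norm (w - w')"
  using slope_diff_le[OF assms, of x w w'] slope_diff_le[OF assms, of x w' w]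
  by (simp add: norm_minus_commute)

lemma continuous_slope:
  assumes "closed K" "K \<noteq> {}"
  shows "continuous_on A (slope x K)"
proof (rule lipschitz_on_continuous_on)
  show "(infdist x K)-lipschitz_on A (slope x K)"
    using slope_lipschitz[OF assms] by (intro lipschitz_onI) (auto simp: dist_norm infdist_nonneg)
qed

section \<open>First-order expansion and comparison of distances\<close>

lemma near_foot:
  assumes "closed K" "\<epsilon> > 0"
  shows "\<exists>\<eta>>0. \<forall>p\<in>K. dist x p < infdist x K + \<eta> \<longrightarrow> (\<exists>p'\<in>foot x K. dist p p' < \<epsilon>)"
proof -
  \<comment> \<open>The points of \<open>K\<close> near \<open>x\<close> that stay away from all
    feet form a compact set. If it is nonempty, the distance from \<open>x\<close> attains a minimum
    on it, and this exceeds \<open>infdist x K\<close>.\<close>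
  define C where "C = (K \<inter> cball x (infdist x K + 1)) - (\<Union>p'\<in>foot x K. ball p' \<epsilon>)"
  have "compact (K \<inter> cball x (infdist x K + 1))" using assms(1) by (simp add: closed_Int_compact)
  then have C: "compact C" unfolding C_def by (intro compact_diff) auto
  show ?thesis
  proof (cases "C = {}")
    case True
    have "\<exists>p'\<in>foot x K. dist p p' < \<epsilon>" if "p \<in> K" "dist x p < infdist x K + 1" for p
    proof -
      have "p \<in> K \<inter> cball x (infdist x K + 1)" using that by simp
      with True have "p \<in> (\<Union>p'\<in>foot x K. ball p' \<epsilon>)" unfolding C_def by blast
      then show ?thesis by (auto simp: dist_commute)
    qed
    then show ?thesis by (intro exI[of _ 1]) auto
  next
    case False
    have "continuous_on C (dist x)" by (intro continuous_intros)
    from continuous_attains_inf[OF C False this] obtain p0 where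
      p0: "p0 \<in> C" "\<And>p. p \<in> C \<Longrightarrow> dist x p0 \<le> dist x p" by blast
    have "p0 \<in> K" "p0 \<notin> foot x K" using p0(1) assms(2) by (auto simp: C_def)
    then have "infdist x K < dist x p0" using infdist_le[of p0 K x] by (auto simp: foot_def)
    moreover have "\<exists>p'\<in>foot x K. dist p p' < \<epsilon>"
      if "p \<in> K" "dist x p < infdist x K + min 1 (dist x p0 - infdist x K)" for p
    proof -
      have "p \<notin> C" using p0(2)[of p] that(2) by auto
      with that show ?thesis by (auto simp: C_def dist_commute)
    qed
    ultimately show ?thesis
      by (intro exI[of _ "min 1 (dist x p0 - infdist x K)"]) auto
  qed
qed

lemma norm_add_scaleR_sq:
  fixes x w p :: "'a::real_inner"
  shows "(norm (x + t *\<^sub>R w - p))\<^sup>2 = (norm (x - p))\<^sup>2 + 2 * t * (w \<bullet> (x - p)) + t\<^sup>2 * (norm w)\<^sup>2"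
proof -
  have "x + t *\<^sub>R w - p = (x - p) + t *\<^sub>R w" by simp
  then show ?thesis
    by (simp only: power2_norm_eq_inner) (simp add: inner_add_left inner_add_right inner_commute power2_eq_square algebra_simps)
qed

text \<open>First-order expansion of the squared distance, locally uniform in the direction. The term
  \<open>t * (norm w)\<^sup>2\<close> does not depend on \<open>K\<close>, so it cancels when two sets are compared.\<close>

lemma infdist_sq_expansion:
  fixes x v :: "'a::euclidean_space"
  assumes K: "closed K" "K \<noteq> {}" and "\<delta> > 0"
  shows "\<exists>\<eta>>0. \<forall>t w. 0 < t \<and> t < \<eta> \<and> norm (w - v) < \<eta> \<longrightarrow>
    \<bar>((infdist (x + t *\<^sub>R w) K)\<^sup>2 - (infdist x K)\<^sup>2) / t - t * (norm w)\<^sup>2 - 2 * slope x K v\<bar> < \<delta>"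
proof -
  define r where "r = infdist x K"
  have r: "r \<ge> 0" by (simp add: r_def infdist_nonneg)
  \<comment> \<open>\<open>R\<close> bounds all directions within distance 1 of \<open>v\<close>.
    The choice of \<open>\<epsilon>\<close> limits the loss from replacing a nearest point by a foot
    to \<open>\<delta> / 4\<close>. The choice of \<open>\<eta>\<close> keeps nearest points within
    range of \<open>\<mu>\<close> and limits the Lipschitz error of the slope to
    \<open>\<delta> / 4\<close>.\<close>
  define R where "R = norm v + 1"
  have R: "R > 0" by (simp add: R_def add_nonneg_pos)
  define \<epsilon> where "\<epsilon> = \<delta> / (8 * R)"
  have e: "\<epsilon> > 0" "2 * R * \<epsilon> = \<delta> / 4" using R \<open>\<delta> > 0\<close> by (auto simp: \<epsilon>_def)
  obtain \<mu> where \<mu>: "\<mu> > 0" "\<And>p. p \<in> K \<Longrightarrow> dist x p < r + \<mu> \<Longrightarrow> \<exists>p'\<in>foot x K. dist p p' < \<epsilon>"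
    using near_foot[OF K(1) e(1), of x] unfolding r_def by meson
  define \<eta> where "\<eta> = min 1 (min (\<mu> / (2 * R)) (\<delta> / (8 * (r + 1))))"
  have "\<eta> \<le> \<mu> / (2 * R)" by (simp add: \<eta>_def)
  then have "2 * R * \<eta> \<le> \<mu>" using R by (simp add: field_simps)
  moreover have "\<eta> > 0" "\<eta> \<le> 1" using R r \<mu>(1) \<open>\<delta> > 0\<close> by (simp_all add: \<eta>_def)
  ultimately have \<eta>: "\<eta> > 0" "\<eta> \<le> 1" "2 * R * \<eta> \<le> \<mu>" by blast+
  have \<eta>4: "2 * r * \<eta> \<le> \<delta> / 4"
  proof -
    have "2 * r * \<eta> \<le> 2 * (r + 1) * \<eta>" using \<eta>(1) by simp
    also have "\<dots> \<le> 2 * (r + 1) * (\<delta> / (8 * (r + 1)))"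
      using r by (intro mult_left_mono) (auto simp: \<eta>_def)
    also have "\<dots> = \<delta> / 4" using r by (simp add: field_simps)
    finally show ?thesis .
  qed
  have "\<bar>((infdist (x + t *\<^sub>R w) K)\<^sup>2 - r\<^sup>2) / t - t * (norm w)\<^sup>2 - 2 * slope x K v\<bar> < \<delta>"
    if t: "0 < t" "t < \<eta>" and w: "norm (w - v) < \<eta>" for t w
  proof -
    define y where "y = x + t *\<^sub>R w"
    define X where "X = ((infdist y K)\<^sup>2 - r\<^sup>2) / t - t * (norm w)\<^sup>2"
    have wR: "norm w \<le> R"
      using norm_triangle_ineq[of v "w - v"] w \<eta>(2) by (simp add: R_def)
    have sl: "\<bar>slope x K w - slope x K v\<bar> \<le> r * \<eta>"
      using slope_lipschitz[OF K, of x w v] w r unfolding r_def[symmetric]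
      by (meson less_imp_le mult_left_mono order_trans)
    \<comment> \<open>Upper bound: a foot of \<open>x\<close> that minimizes in direction
      \<open>w\<close> is a competitor for the distance from \<open>y\<close>.\<close>
    obtain p' where p': "p' \<in> foot x K" "slope x K w = w \<bullet> (x - p')"
      using slope_attained[OF K, of x w] by metis
    have "infdist y K \<le> norm (y - p')"
      using infdist_le[of p' K y] p'(1) by (auto simp: foot_def dist_norm)
    then have "(infdist y K)\<^sup>2 \<le> (norm (y - p'))\<^sup>2" by (simp add: infdist_nonneg power_mono)
    also have "\<dots> = r\<^sup>2 + 2 * t * slope x K w + t\<^sup>2 * (norm w)\<^sup>2"
      unfolding y_def norm_add_scaleR_sq p'(2) by (simp add: norm_foot[OF p'(1)] r_def)
    finally have "X \<le> 2 * slope x K w"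
      using t(1) by (simp add: X_def field_simps power2_eq_square)
    then have up: "X \<le> 2 * slope x K v + \<delta> / 4" using sl \<eta>4 by linarith
    \<comment> \<open>Lower bound: a nearest point \<open>p\<close> of \<open>y\<close> is almost
      nearest to \<open>x\<close>, hence close to a foot \<open>p1\<close>, whose inner product with
      \<open>w\<close> is controlled by the slope.\<close>
    obtain p where p: "p \<in> K" "infdist y K = dist y p" by (rule infdist_attains_inf[OF K, of y])
    have xy: "dist x y \<le> t * R" using wR t(1) by (simp add: y_def dist_norm)
    have "dist x p \<le> dist x y + dist y p" by (rule dist_triangle)
    also have "dist y p \<le> r + dist x y"
      using infdist_triangle[of y K x] p(2) by (simp add: r_def dist_commute)
    finally have "dist x p \<le> r + 2 * (t * R)" using xy by simp
    also have "\<dots> < r + \<mu>" using \<eta>(3) mult_strict_right_mono[OF t(2) R] by (simp only: mult_ac)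
    finally obtain p1 where p1: "p1 \<in> foot x K" "dist p p1 < \<epsilon>" using \<mu>(2) p(1) by blast
    have "w \<bullet> (p - p1) \<le> norm w * norm (p - p1)" by (rule norm_cauchy_schwarz)
    also have "\<dots> \<le> R * \<epsilon>" using wR p1(2) R by (intro mult_mono) (auto simp: dist_norm)
    finally have "slope x K w - R * \<epsilon> \<le> w \<bullet> (x - p)"
      using slope_le[OF K(1) p1(1), of w] by (simp add: inner_diff_right)
    then have "2 * t * (slope x K w - R * \<epsilon>) \<le> 2 * t * (w \<bullet> (x - p))"
      using t(1) by (intro mult_left_mono) auto
    moreover have "r\<^sup>2 \<le> (norm (x - p))\<^sup>2"
      using infdist_le[OF p(1), of x] r by (intro power_mono) (auto simp: r_def dist_norm)
    ultimately have "r\<^sup>2 + 2 * t * (slope x K w - R * \<epsilon>) + t\<^sup>2 * (norm w)\<^sup>2 \<le> (infdist y K)\<^sup>2"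
      unfolding p(2) unfolding y_def dist_norm norm_add_scaleR_sq by linarith
    then have "2 * slope x K w - 2 * R * \<epsilon> \<le> X"
      using t(1) by (simp add: X_def field_simps power2_eq_square)
    then have "2 * slope x K v - \<delta> / 2 \<le> X" using sl \<eta>4 e(2) by linarith
    with up show ?thesis using \<open>\<delta> > 0\<close> unfolding X_def y_def by linarith
  qed
  then show ?thesis using \<eta>(1) unfolding r_def by blast
qed

text \<open>A lexicographic comparison, by distance at \<open>x\<close> first and by slope in case
  of equality. It is designed to force \<open>K\<close> to be strictly closer than \<open>L\<close>
  along short steps in all directions near \<open>v\<close>.\<close>

definition nearer :: "'a::euclidean_space \<Rightarrow> 'a \<Rightarrow> 'a set \<Rightarrow> 'a set \<Rightarrow> bool" where
  "nearer x v K L \<longleftrightarrow> infdist x K < infdist x L \<or> infdist x K = infdist x L \<and> slope x K v < slope x L v"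

text \<open>A strict gap at \<open>x\<close> survives short steps because distances are 1-Lipschitz.
  In case of equality the two expansions are compared with error below the difference of the slopes,
  and the common quadratic term cancels.\<close>

lemma nearer_infdist_less:
  assumes K: "closed K" "K \<noteq> {}" and L: "closed L" "L \<noteq> {}" and "nearer x v K L"
  shows "\<exists>\<eta>>0. \<forall>t w. 0 < t \<and> t < \<eta> \<and> norm (w - v) < \<eta> \<longrightarrow>
    infdist (x + t *\<^sub>R w) K < infdist (x + t *\<^sub>R w) L"
  using assms(5) unfolding nearer_def
proof (elim disjE conjE)
  assume less: "infdist x K < infdist x L"
  define R where "R = norm v + 1"
  have R: "R > 0" by (simp add: R_def add_nonneg_pos)
  define \<eta> where "\<eta> = min 1 ((infdist x L - infdist x K) / (2 * R))"
  have "\<eta> \<le> (infdist x L - infdist x K) / (2 * R)" by (simp add: \<eta>_def)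
  then have "2 * R * \<eta> \<le> infdist x L - infdist x K" using R by (simp add: field_simps)
  moreover have "\<eta> > 0" "\<eta> \<le> 1" using R less by (simp_all add: \<eta>_def)
  ultimately have \<eta>: "\<eta> > 0" "\<eta> \<le> 1" "2 * R * \<eta> \<le> infdist x L - infdist x K" by blast+
  have "infdist (x + t *\<^sub>R w) K < infdist (x + t *\<^sub>R w) L"
    if t: "0 < t" "t < \<eta>" and w: "norm (w - v) < \<eta>" for t w
  proof -
    have "norm w \<le> R"
      using norm_triangle_ineq[of v "w - v"] w \<eta>(2) by (simp add: R_def)
    then have "dist x (x + t *\<^sub>R w) \<le> t * R" using t(1) by (simp add: dist_norm)
    also have "\<dots> < \<eta> * R" using t(2) R by simp
    finally have d: "2 * dist x (x + t *\<^sub>R w) < infdist x L - infdist x K" using \<eta>(3) by (simp add: algebra_simps)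
    show ?thesis
      using infdist_triangle[of "x + t *\<^sub>R w" K x] infdist_triangle[of x L "x + t *\<^sub>R w"] d
      by (simp add: dist_commute)
  qed
  then show ?thesis using \<eta>(1) by blast
next
  assume eq: "infdist x K = infdist x L" and less: "slope x K v < slope x L v"
  define \<delta> where "\<delta> = slope x L v - slope x K v"
  have "\<delta> > 0" using less by (simp add: \<delta>_def)
  from infdist_sq_expansion[OF K \<open>\<delta> > 0\<close>, of v x] obtain \<eta>1 where \<eta>1: "\<eta>1 > 0"
    and 1: "\<And>t w. 0 < t \<Longrightarrow> t < \<eta>1 \<Longrightarrow> norm (w - v) < \<eta>1 \<Longrightarrow>
      \<bar>((infdist (x + t *\<^sub>R w) K)\<^sup>2 - (infdist x K)\<^sup>2) / t - t * (norm w)\<^sup>2 - 2 * slope x K v\<bar> < \<delta>"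
    by auto
  from infdist_sq_expansion[OF L \<open>\<delta> > 0\<close>, of v x] obtain \<eta>2 where \<eta>2: "\<eta>2 > 0"
    and 2: "\<And>t w. 0 < t \<Longrightarrow> t < \<eta>2 \<Longrightarrow> norm (w - v) < \<eta>2 \<Longrightarrow>
      \<bar>((infdist (x + t *\<^sub>R w) L)\<^sup>2 - (infdist x L)\<^sup>2) / t - t * (norm w)\<^sup>2 - 2 * slope x L v\<bar> < \<delta>"
    by auto
  have "infdist (x + t *\<^sub>R w) K < infdist (x + t *\<^sub>R w) L"
    if t: "0 < t" "t < min \<eta>1 \<eta>2" and w: "norm (w - v) < min \<eta>1 \<eta>2" for t w
  proof -
    have "((infdist (x + t *\<^sub>R w) K)\<^sup>2 - (infdist x K)\<^sup>2) / t < ((infdist (x + t *\<^sub>R w) L)\<^sup>2 - (infdist x L)\<^sup>2) / t"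
      using 1[of t w] 2[of t w] t w unfolding \<delta>_def by linarith
    then have "(infdist (x + t *\<^sub>R w) K)\<^sup>2 < (infdist (x + t *\<^sub>R w) L)\<^sup>2"
      using t(1) eq by (simp add: divide_less_cancel)
    then show ?thesis by (rule power2_less_imp_less) (simp add: infdist_nonneg)
  qed
  then show ?thesis using \<eta>1 \<eta>2 by (intro exI[of _ "min \<eta>1 \<eta>2"]) auto
qed

lemma finite_common_radius:
  assumes "finite J" "\<And>l. l \<in> J \<Longrightarrow> \<exists>\<eta>>0. \<forall>t w. 0 < t \<and> t < \<eta> \<and> norm (w - v) < \<eta> \<longrightarrow> P l t w"
  shows "\<exists>\<eta>>(0::real). \<forall>l\<in>J. \<forall>t w. 0 < t \<and> t < \<eta> \<and> norm (w - v) < \<eta> \<longrightarrow> P l t w"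
  using assms
proof (induction J rule: finite_induct)
  case empty
  then show ?case by (intro exI[of _ 1]) auto
next
  case (insert j J)
  have "\<exists>\<eta>>0. \<forall>l\<in>J. \<forall>t w. 0 < t \<and> t < \<eta> \<and> norm (w - v) < \<eta> \<longrightarrow> P l t w"
    by (rule insert.IH, rule insert.prems) simp
  then obtain \<eta>1 where 1: "\<eta>1 > 0" "\<forall>l\<in>J. \<forall>t w. 0 < t \<and> t < \<eta>1 \<and> norm (w - v) < \<eta>1 \<longrightarrow> P l t w"
    by blast
  obtain \<eta>2 where 2: "\<eta>2 > 0" "\<forall>t w. 0 < t \<and> t < \<eta>2 \<and> norm (w - v) < \<eta>2 \<longrightarrow> P j t w"
    using insert.prems[of j] by blast
  show ?case using 1 2 by (intro exI[of _ "min \<eta>1 \<eta>2"]) simp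
qed

section \<open>Stability of minimizing feet and the bisecting direction\<close>

lemma min_foot_close:
  assumes K: "closed K" and p: "p \<in> foot x K"
    and sep: "\<And>z. z \<in> foot x K \<Longrightarrow> (norm (p - z))\<^sup>2 / 2 \<le> w0 \<bullet> (p - z)"
    and w: "norm (w - w0) \<le> \<rho>" and z: "z \<in> foot x K" "w \<bullet> (x - z) \<le> w \<bullet> (x - p)"
  shows "norm (p - z) \<le> 2 * \<rho>"
proof -
  have "w \<bullet> (p - z) \<le> 0" using z(2) by (simp add: inner_diff_right)
  then have "w0 \<bullet> (p - z) \<le> (w0 - w) \<bullet> (p - z)" by (simp add: inner_diff_left)
  also have "\<dots> \<le> norm (w0 - w) * norm (p - z)" by (rule norm_cauchy_schwarz)
  also have "\<dots> \<le> \<rho> * norm (p - z)"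
    using w by (intro mult_right_mono) (auto simp: norm_minus_commute)
  \<comment> \<open>The quadratic growth in \<open>sep\<close> competes with a perturbation that is
    linear in the distance, so one factor \<open>norm (p - z)\<close> cancels.\<close>
  finally have "norm (p - z) * norm (p - z) \<le> (2 * \<rho>) * norm (p - z)"
    using sep[OF z(1)] by (simp add: power2_eq_square)
  moreover have "0 \<le> \<rho>" using w norm_ge_zero[of "w - w0"] by linarith
  ultimately show ?thesis by (cases "p = z") (auto dest: mult_right_le_imp_le)
qed

text \<open>An envelope argument: the increment lies between the linear increments given by a
  minimizer \<open>z'\<close> for the new direction and a minimizer \<open>z\<close> for the old
  one. Both are within \<open>2 * \<rho>\<close> of \<open>p\<close>.\<close>

lemma slope_increment:
  assumes K: "closed K" and p: "p \<in> foot x K"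
    and sep: "\<And>z. z \<in> foot x K \<Longrightarrow> (norm (p - z))\<^sup>2 / 2 \<le> w0 \<bullet> (p - z)"
    and w: "norm (w - w0) \<le> \<rho>" "norm (w + s *\<^sub>R e - w0) \<le> \<rho>" and e: "norm e = 1" and "s \<ge> 0"
  shows "\<bar>slope x K (w + s *\<^sub>R e) - slope x K w - s * (e \<bullet> (x - p))\<bar> \<le> s * (2 * \<rho>)"
proof -
  have ne: "K \<noteq> {}" using p by (auto simp: foot_def)
  have *: "\<bar>e \<bullet> (p - z)\<bar> \<le> 2 * \<rho>" if "norm (p - z) \<le> 2 * \<rho>" for z
    using Cauchy_Schwarz_ineq2[of e "p - z"] e that by simp
  obtain z where z: "z \<in> foot x K" "slope x K w = w \<bullet> (x - z)" "w \<bullet> (x - z) \<le> w \<bullet> (x - p)"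
    using slope_attained[OF K ne, of x w] p by metis
  obtain z' where z': "z' \<in> foot x K" "slope x K (w + s *\<^sub>R e) = (w + s *\<^sub>R e) \<bullet> (x - z')"
     "(w + s *\<^sub>R e) \<bullet> (x - z') \<le> (w + s *\<^sub>R e) \<bullet> (x - p)"
    using slope_attained[OF K ne, of x "w + s *\<^sub>R e"] p by metis
  have "\<bar>e \<bullet> (p - z)\<bar> \<le> 2 * \<rho>" "\<bar>e \<bullet> (p - z')\<bar> \<le> 2 * \<rho>"
    using min_foot_close[OF K p sep w(1) z(1,3)] min_foot_close[OF K p sep w(2) z'(1,3)] * by blast+
  then have "e \<bullet> (p - z) \<le> 2 * \<rho>" "- (e \<bullet> (p - z')) \<le> 2 * \<rho>" by auto
  from this[THEN mult_left_mono[OF _ \<open>s \<ge> 0\<close>]]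
  have "s * (e \<bullet> (p - z)) \<le> s * (2 * \<rho>)" "s * (- (e \<bullet> (p - z'))) \<le> s * (2 * \<rho>)" .
  moreover have "slope x K (w + s *\<^sub>R e) \<le> slope x K w + s * (e \<bullet> (x - z))"
    using slope_le[OF K z(1), of "w + s *\<^sub>R e"] z(2) by (simp add: inner_add_left)
  moreover have "slope x K w + s * (e \<bullet> (x - z')) \<le> slope x K (w + s *\<^sub>R e)"
    using slope_le[OF K z'(1), of w] z'(2) by (simp add: inner_add_left)
  ultimately show ?thesis by (simp add: inner_diff_right algebra_simps abs_le_iff)
qed

text \<open>The pairs of feet of different sets form a finite union of compact products, so the
  inner product has a maximum. When all feet are equally far from \<open>x\<close>, this pair has
  the least mutual distance.\<close>

lemma closest_feet:
  assumes I: "finite I" "i0 \<in> I" "j0 \<in> I" "i0 \<noteq> j0"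
    and X: "\<And>l. l \<in> I \<Longrightarrow> closed (X l)" "\<And>l. l \<in> I \<Longrightarrow> X l \<noteq> {}"
  obtains i j p q where "i \<in> I" "j \<in> I" "i \<noteq> j" "p \<in> foot x (X i)" "q \<in> foot x (X j)"
    "\<And>i' j' p' q'. i' \<in> I \<Longrightarrow> j' \<in> I \<Longrightarrow> i' \<noteq> j' \<Longrightarrow> p' \<in> foot x (X i') \<Longrightarrow> q' \<in> foot x (X j') \<Longrightarrow>
      (x - p') \<bullet> (x - q') \<le> (x - p) \<bullet> (x - q)"
proof -
  define T where "T = {(i, j). i \<in> I \<and> j \<in> I \<and> i \<noteq> j}"
  define C where "C = (\<Union>(i, j)\<in>T. foot x (X i) \<times> foot x (X j))"
  have "finite T" using I(1) by (auto simp: T_def intro: finite_subset[of _ "I \<times> I"])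
  then have C: "compact C"
    unfolding C_def using X(1) by (intro compact_UN) (auto simp: T_def intro!: compact_Times compact_foot)
  obtain p0 q0 where "p0 \<in> foot x (X i0)" "q0 \<in> foot x (X j0)"
    using foot_nonempty X I by (metis ex_in_conv)
  then have "(p0, q0) \<in> C" using I by (auto simp: C_def T_def)
  then have "C \<noteq> {}" by blast
  moreover have "continuous_on C (\<lambda>z. (x - fst z) \<bullet> (x - snd z))" by (intro continuous_intros)
  ultimately obtain z where z: "z \<in> C"
    "\<And>z'. z' \<in> C \<Longrightarrow> (x - fst z') \<bullet> (x - snd z') \<le> (x - fst z) \<bullet> (x - snd z)"
    using continuous_attains_sup[OF C] by blast
  from z(1) obtain i j where ij: "(i, j) \<in> T" "fst z \<in> foot x (X i)" "snd z \<in> foot x (X j)"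
    by (auto simp: C_def)
  show thesis
  proof (rule that[of i j "fst z" "snd z"])
    fix i' j' p' q'
    assume "i' \<in> I" "j' \<in> I" "i' \<noteq> j'" "p' \<in> foot x (X i')" "q' \<in> foot x (X j')"
    then have "(p', q') \<in> C" by (auto simp: C_def T_def)
    from z(2)[OF this] show "(x - p') \<bullet> (x - q') \<le> (x - fst z) \<bullet> (x - snd z)" by simp
  qed (use ij in \<open>auto simp: T_def\<close>)
qed

text \<open>The direction \<open>w0\<close> is minus the sum of the two outer vectors \<open>x - p\<close>, \<open>x - q\<close> of a pair of
  feet at maximal inner product; there \<open>p\<close> and \<open>q\<close> are the unique minimizers.\<close>

lemma bisecting_direction:
  fixes X :: "nat \<Rightarrow> (real ^ 'n) set"
  assumes I: "finite I" "i0 \<in> I" "j0 \<in> I" "i0 \<noteq> j0"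
    and X: "\<And>l. l \<in> I \<Longrightarrow> closed (X l)" "\<And>l. l \<in> I \<Longrightarrow> X l \<noteq> {}"
    and r: "\<And>l. l \<in> I \<Longrightarrow> infdist x (X l) = r"
    and disj: "disjoint_family_on X I"
  obtains i j w0 m \<rho> \<kappa> where "i \<in> I" "j \<in> I" "i \<noteq> j" "\<rho> > 0" "\<kappa> > 0"
    "slope x (X i) w0 = slope x (X j) w0"
    "\<And>l w. l \<in> I \<Longrightarrow> l \<noteq> i \<Longrightarrow> l \<noteq> j \<Longrightarrow> norm (w - w0) \<le> \<rho> \<Longrightarrow> slope x (X i) w < slope x (X l) w"
    "\<And>w s. s \<ge> 0 \<Longrightarrow> norm (w - w0) \<le> \<rho> \<Longrightarrow> norm (w + s *\<^sub>R axis m 1 - w0) \<le> \<rho> \<Longrightarrow>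
      slope x (X i) w - slope x (X j) w + \<kappa> * s \<le>
      slope x (X i) (w + s *\<^sub>R axis m 1) - slope x (X j) (w + s *\<^sub>R axis m 1)"
proof -
  obtain i1 j1 p1 q1 where 1: "i1 \<in> I" "j1 \<in> I" "i1 \<noteq> j1" "p1 \<in> foot x (X i1)" "q1 \<in> foot x (X j1)"
    "\<And>i' j' p' q'. i' \<in> I \<Longrightarrow> j' \<in> I \<Longrightarrow> i' \<noteq> j' \<Longrightarrow> p' \<in> foot x (X i') \<Longrightarrow> q' \<in> foot x (X j') \<Longrightarrow>
      (x - p') \<bullet> (x - q') \<le> (x - p1) \<bullet> (x - q1)"
    using closest_feet[of I i0 j0 X, OF I X] by blast
  have "X i1 \<inter> X j1 = {}" using disj 1(1-3) by (auto simp: disjoint_family_on_def)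
  then have "p1 \<noteq> q1" using 1(4,5) by (auto simp: foot_def)
  then obtain m where "p1 $ m \<noteq> q1 $ m" by (auto simp: vec_eq_iff)
  \<comment> \<open>The two feet differ in coordinate \<open>m\<close>. Maximality is symmetric in
    the pair, so the names can be chosen with \<open>p $ m < q $ m\<close>, which fixes the sign of
    the later monotonicity.\<close>
  then have "\<exists>i j p q. i \<in> I \<and> j \<in> I \<and> i \<noteq> j \<and> p \<in> foot x (X i) \<and> q \<in> foot x (X j) \<and> p $ m < q $ m \<and>
    (\<forall>i' j' p' q'. i' \<in> I \<longrightarrow> j' \<in> I \<longrightarrow> i' \<noteq> j' \<longrightarrow> p' \<in> foot x (X i') \<longrightarrow> q' \<in> foot x (X j') \<longrightarrow>
      (x - p') \<bullet> (x - q') \<le> (x - p) \<bullet> (x - q))"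
  proof (rule linorder_neqE)
    assume "p1 $ m < q1 $ m"
    with 1 show ?thesis by blast
  next
    assume *: "p1 $ m > q1 $ m"
    have "(x - q1) \<bullet> (x - p1) = (x - p1) \<bullet> (x - q1)" by (rule inner_commute)
    with 1 * show ?thesis by (intro exI[of _ j1] exI[of _ i1] exI[of _ q1] exI[of _ p1]) auto
  qed
  then obtain i j p q where ij: "i \<in> I" "j \<in> I" "i \<noteq> j" "p \<in> foot x (X i)" "q \<in> foot x (X j)" "p $ m < q $ m"
    and max: "\<And>i' j' p' q'. i' \<in> I \<Longrightarrow> j' \<in> I \<Longrightarrow> i' \<noteq> j' \<Longrightarrow> p' \<in> foot x (X i') \<Longrightarrow> q' \<in> foot x (X j') \<Longrightarrow>
      (x - p') \<bullet> (x - q') \<le> (x - p) \<bullet> (x - q)" by metis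
  define w0 where "w0 = - ((x - p) + (x - q))"
  have nrm: "(x - z) \<bullet> (x - z) = r\<^sup>2" if "l \<in> I" "z \<in> foot x (X l)" for l z
    using norm_foot[OF that(2)] r[OF that(1)] by (simp add: power2_norm_eq_inner[symmetric])
  \<comment> \<open>All feet have distance \<open>r\<close> from \<open>x\<close>, so the left side
    is \<open>r\<^sup>2 - (x - p) \<bullet> (x - z)\<close>. The right side exceeds it by
    \<open>(x - p) \<bullet> (x - q) - (x - z) \<bullet> (x - q)\<close>, which is nonnegative by
    maximality.\<close>
  have sep_i: "(norm (p - z))\<^sup>2 / 2 \<le> w0 \<bullet> (p - z)" if z: "z \<in> foot x (X i)" for z
  proof -
    have "p - z = (x - z) - (x - p)" by simp
    then show ?thesis
      using nrm[OF ij(1) ij(4)] nrm[OF ij(1) z] max[OF ij(1,2,3) z ij(5)]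
      unfolding power2_norm_eq_inner w0_def
      by (simp only: inner_diff_left inner_diff_right inner_add_left inner_add_right inner_minus_left
          inner_commute[of z p] inner_commute[of x p] inner_commute[of x q] inner_commute[of x z] inner_commute[of q p] inner_commute[of z q]) argo
  qed
  have sep_j: "(norm (q - z))\<^sup>2 / 2 \<le> w0 \<bullet> (q - z)" if z: "z \<in> foot x (X j)" for z
  proof -
    have "q - z = (x - z) - (x - q)" by simp
    then show ?thesis
      using nrm[OF ij(2) ij(5)] nrm[OF ij(2) z] max[OF ij(1,2,3) ij(4) z]
      unfolding power2_norm_eq_inner w0_def
      by (simp only: inner_diff_left inner_diff_right inner_add_left inner_add_right inner_minus_left
          inner_commute[of z p] inner_commute[of x p] inner_commute[of x q] inner_commute[of x z] inner_commute[of q p] inner_commute[of z q]) argo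
  qed
  have slope_eq: "slope x (X l) w0 = w0 \<bullet> (x - p')"
    if l: "l \<in> I" and p': "p' \<in> foot x (X l)" and sep: "\<And>z. z \<in> foot x (X l) \<Longrightarrow> (norm (p' - z))\<^sup>2 / 2 \<le> w0 \<bullet> (p' - z)" for l p'
  proof (rule antisym)
    show "slope x (X l) w0 \<le> w0 \<bullet> (x - p')" by (rule slope_le[OF X(1)[OF l] p'])
    obtain z where z: "z \<in> foot x (X l)" "slope x (X l) w0 = w0 \<bullet> (x - z)"
      using slope_attained[OF X[OF l], of x w0] by metis
    have "0 \<le> w0 \<bullet> (p' - z)" using sep[OF z(1)] by (rule order_trans[rotated]) simp
    then show "w0 \<bullet> (x - p') \<le> slope x (X l) w0" unfolding z(2) by (simp add: inner_diff_right)
  qed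
  have si: "slope x (X i) w0 = w0 \<bullet> (x - p)" by (rule slope_eq[OF ij(1,4) sep_i])
  have sj: "slope x (X j) w0 = w0 \<bullet> (x - q)" by (rule slope_eq[OF ij(2,5) sep_j])
  have wp: "w0 \<bullet> (x - p) = - (r\<^sup>2 + (x - p) \<bullet> (x - q))"
    using nrm[OF ij(1,4)] by (simp only: w0_def inner_minus_left inner_add_left inner_commute[of "x - q"])
  have wq: "w0 \<bullet> (x - q) = - (r\<^sup>2 + (x - p) \<bullet> (x - q))"
    using nrm[OF ij(2,5)] by (simp only: w0_def inner_minus_left inner_add_left add.commute)
  have pq: "(x - p) \<bullet> (x - q) < r\<^sup>2"
  proof -
    have "0 < (norm ((x - p) - (x - q)))\<^sup>2" using ij(6) by auto
    also have "\<dots> = (x - p) \<bullet> (x - p) + (x - q) \<bullet> (x - q) - 2 * ((x - p) \<bullet> (x - q))"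
      unfolding power2_norm_eq_inner by (simp only: inner_diff_left[of "x - p"] inner_diff_right[of _ "x - p"] inner_commute[of "x - q" "x - p"])
    finally show ?thesis using nrm[OF ij(1,4)] nrm[OF ij(2,5)] by linarith
  qed
  have others: "slope x (X i) w0 < slope x (X l) w0" if l: "l \<in> I - {i, j}" for l
  proof -
    from l have lI: "l \<in> I" by blast
    obtain z where z: "z \<in> foot x (X l)" "slope x (X l) w0 = w0 \<bullet> (x - z)"
      using slope_attained[OF X[OF lI], of x w0] by metis
    \<comment> \<open>Maximality applies to \<open>z\<close> paired with \<open>p\<close> and with
      \<open>q\<close>, because \<open>l\<close> differs from both \<open>i\<close> and
      \<open>j\<close>. Strictness then comes from \<open>pq\<close>.\<close>
    have "(x - p) \<bullet> (x - z) \<le> (x - p) \<bullet> (x - q)" "(x - z) \<bullet> (x - q) \<le> (x - p) \<bullet> (x - q)"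
      using max[OF ij(1) lI _ ij(4) z(1)] max[OF lI ij(2) _ z(1) ij(5)] l by blast+
    then have "- (2 * ((x - p) \<bullet> (x - q))) \<le> w0 \<bullet> (x - z)"
      by (simp only: w0_def inner_minus_left inner_add_left inner_commute[of "x - q" "x - z"])
    then show ?thesis using si wp z(2) pq by linarith
  qed
  have "\<forall>\<^sub>F w in nhds w0. \<forall>l\<in>I - {i, j}. slope x (X i) w < slope x (X l) w"
  proof (intro eventually_ball_finite ballI)
    fix l assume l: "l \<in> I - {i, j}"
    have "continuous_on UNIV (\<lambda>w. slope x (X l) w - slope x (X i) w)"
      using l ij(1) X by (intro continuous_intros continuous_slope) auto
    then have "((\<lambda>w. slope x (X l) w - slope x (X i) w) \<longlongrightarrow> slope x (X l) w0 - slope x (X i) w0) (nhds w0)"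
      using tendsto_at_iff_tendsto_nhds[of "\<lambda>w. slope x (X l) w - slope x (X i) w" w0]
      by (simp add: continuous_on_eq_continuous_at isCont_def)
    then have "\<forall>\<^sub>F w in nhds w0. 0 < slope x (X l) w - slope x (X i) w"
      using others[OF l] by (intro order_tendstoD(1)) auto
    then show "\<forall>\<^sub>F w in nhds w0. slope x (X i) w < slope x (X l) w" by eventually_elim simp
  qed (use I(1) in auto)
  then obtain d where d: "d > 0" "\<And>w l. dist w w0 < d \<Longrightarrow> l \<in> I - {i, j} \<Longrightarrow> slope x (X i) w < slope x (X l) w"
    unfolding eventually_nhds_metric by blast
  \<comment> \<open>The main terms of the two slopes differ by \<open>2 * \<kappa>\<close> per unit
    step along the axis. The errors from \<open>slope_increment\<close> amount to at most
    \<open>4 * \<rho>\<close>, so \<open>4 * \<rho> \<le> \<kappa>\<close> leaves a growth rate of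
    at least \<open>\<kappa>\<close>.\<close>
  define \<kappa> where "\<kappa> = (q $ m - p $ m) / 2"
  define \<rho> where "\<rho> = min (d / 2) (\<kappa> / 4)"
  have \<kappa>: "\<kappa> > 0" using ij(6) by (simp add: \<kappa>_def)
  have "\<rho> \<le> d / 2" "\<rho> \<le> \<kappa> / 4" by (simp_all add: \<rho>_def)
  moreover have "\<rho> > 0" using d(1) \<kappa> by (simp add: \<rho>_def)
  ultimately have \<rho>: "\<rho> > 0" "\<rho> < d" "4 * \<rho> \<le> \<kappa>" by linarith+
  show thesis
  proof (rule that[of i j \<rho> \<kappa> w0 m])
    show "slope x (X i) w0 = slope x (X j) w0" using si sj wp wq by simp
    show "slope x (X i) w < slope x (X l) w" if "l \<in> I" "l \<noteq> i" "l \<noteq> j" "norm (w - w0) \<le> \<rho>" for l w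
      using d(2)[of w l] that \<rho>(2) by (auto simp: dist_norm)
    fix w s assume s: "s \<ge> 0" and w: "norm (w - w0) \<le> \<rho>" "norm (w + s *\<^sub>R axis m 1 - w0) \<le> \<rho>"
    have e: "norm (axis m (1::real)) = 1" by simp
    have "s * (axis m 1 \<bullet> (x - p)) - s * (axis m 1 \<bullet> (x - q)) = s * (2 * \<kappa>)"
      by (simp add: inner_axis' \<kappa>_def algebra_simps)
    moreover have "s * (4 * \<rho>) \<le> s * \<kappa>" using s \<rho>(3) by (intro mult_left_mono)
    ultimately show "slope x (X i) w - slope x (X j) w + \<kappa> * s \<le>
      slope x (X i) (w + s *\<^sub>R axis m 1) - slope x (X j) (w + s *\<^sub>R axis m 1)"
      using slope_increment[OF X(1)[OF ij(1)] ij(4) sep_i w e s]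
        slope_increment[OF X(1)[OF ij(2)] ij(5) sep_j w e s]
      by (simp add: abs_le_iff algebra_simps)
  qed (use ij \<rho> \<kappa> in auto)
qed

section \<open>Definability in Euclidean space and arcs\<close>

definition idx :: "'n::finite \<Rightarrow> nat" where
  "idx k = to_nat_on UNIV k"

definition point :: "(nat \<Rightarrow> real) \<Rightarrow> real ^ 'n" where
  "point y = (\<chi> k. y (idx k))"

lemma idx_less [simp]: "idx (k :: 'n::finite) < CARD('n)"
  using to_nat_on_finite[of "UNIV :: 'n set"] by (auto simp: idx_def bij_betw_def)

lemma from_nat_into_idx [simp]: "from_nat_into UNIV (idx k) = k"
  by (simp add: idx_def)

lemma idx_from_nat_into [simp]: "i < CARD('n) \<Longrightarrow> idx (from_nat_into UNIV i :: 'n::finite) = i"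
  using to_nat_on_finite[of "UNIV :: 'n set"]
  unfolding idx_def by (intro to_nat_on_from_nat_into) (simp add: bij_betw_def)

lemma point_nth [simp]: "point y $ k = y (idx k)"
  by (simp add: point_def)

lemma coords_idx [simp]: "coords x (idx k) = x $ k"
  by (simp add: coords_def)

lemma coords_ge: "i \<ge> CARD('n) \<Longrightarrow> coords (x :: real ^ 'n) i = 0"
  by (simp add: coords_def)

lemma coords_rspace [simp]: "coords (x :: real ^ 'n) \<in> rspace CARD('n)"
  by (simp add: rspace_def coords_ge)

lemma point_coords [simp]: "point (coords x) = x"
  by (simp add: vec_eq_iff)

lemma coords_point: "coords (point y :: real ^ 'n) = restr CARD('n) y"
  by (auto simp: coords_def restr_def fun_eq_iff)

lemma point_restr: "point (restr CARD('n) y) = (point y :: real ^ 'n)"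
  by (simp add: vec_eq_iff)

lemma coords_image: "coords ` S = {y \<in> rspace CARD('n). point y \<in> (S :: (real ^ 'n) set)}"
proof (intro set_eqI iffI)
  fix y assume "y \<in> {y \<in> rspace CARD('n). point y \<in> S}"
  then have "y = coords (point y :: real ^ 'n)" "point y \<in> S" by (auto simp: coords_point restr_rspace)
  then show "y \<in> coords ` S" by blast
qed auto

context omin_real_field
begin

section \<open>Definability of vectors, slopes and squared distances\<close>

definition def_vec :: "((nat \<Rightarrow> real) \<Rightarrow> real ^ 'n) \<Rightarrow> bool" where
  "def_vec f \<longleftrightarrow> (\<forall>k. def_fun (\<lambda>e. f e $ k))"

lemma def_vec_point [def_intros]: "(\<And>i. def_fun (\<lambda>e. F e i)) \<Longrightarrow> def_vec (\<lambda>e. point (F e))"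
  by (simp add: def_vec_def)

lemma def_vec_const [def_intros]: "def_vec (\<lambda>e. c)"
  by (simp add: def_vec_def def_fun_const)

lemma def_vec_add [def_intros]: "def_vec f \<Longrightarrow> def_vec g \<Longrightarrow> def_vec (\<lambda>e. f e + g e)"
  by (simp add: def_vec_def def_fun_add)

lemma def_vec_diff [def_intros]: "def_vec f \<Longrightarrow> def_vec g \<Longrightarrow> def_vec (\<lambda>e. f e - g e)"
  by (simp add: def_vec_def def_fun_diff)

lemma def_vec_scaleR [def_intros]: "def_fun f \<Longrightarrow> def_vec g \<Longrightarrow> def_vec (\<lambda>e. f e *\<^sub>R g e)"
  by (simp add: def_vec_def def_fun_mult)

lemma def_vec_reindex: "def_vec f \<Longrightarrow> def_vec (\<lambda>e. f (\<lambda>i. e (\<sigma> i)))"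
  unfolding def_vec_def using def_fun_reindex by blast

lemma def_fun_nth [def_intros]: "def_vec f \<Longrightarrow> def_fun (\<lambda>e. f e $ k)"
  by (simp add: def_vec_def)

lemma def_fun_coords [def_intros]:
  fixes f :: "(nat \<Rightarrow> real) \<Rightarrow> real ^ 'n"
  shows "def_vec f \<Longrightarrow> def_fun (\<lambda>e. coords (f e) i)"
  unfolding coords_def by (cases "i < CARD('n)") (simp_all add: def_fun_nth def_fun_const)

lemma def_fun_inner [def_intros]: "def_vec f \<Longrightarrow> def_vec g \<Longrightarrow> def_fun (\<lambda>e. f e \<bullet> g e)"
  unfolding inner_vec_def inner_real_def by (intro def_intros)

lemma def_pred_mem [def_intros]:
  fixes S :: "(real ^ 'n) set"
  assumes "definable D S" "def_vec f"
  shows "def_pred (\<lambda>e. f e \<in> S)"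
proof -
  have "def_pred (\<lambda>e. coords (f e) \<in> coords ` S)"
    by (rule D_mem[OF assms(1)[unfolded definable_def]])
      (simp_all add: coords_ge def_fun_coords[OF assms(2)])
  then show ?thesis by (simp add: coords_image)
qed

lemma definableI:
  fixes S :: "(real ^ 'n) set"
  shows "def_pred (\<lambda>e. point e \<in> S) \<Longrightarrow> definable D S"
  unfolding definable_def coords_image by (rule def_pred_D)

lemma def_pred_ex_point [def_intros]:
  fixes P :: "(nat \<Rightarrow> real) \<Rightarrow> real ^ 'n \<Rightarrow> bool"
  assumes "def_pred (\<lambda>e. P (\<lambda>i. e (CARD('n) + i)) (point e))"
  shows "def_pred (\<lambda>e. \<exists>x. P e x)"
proof -
  have "def_pred (\<lambda>e. \<exists>y. P e (point y))"
    using assms by (intro def_pred_ex_seq[where n = "CARD('n)"]) (simp_all add: point_restr)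
  moreover have "(\<exists>y. P e (point y)) = (\<exists>x. P e x)" for e
    by (metis point_coords)
  ultimately show ?thesis by simp
qed

lemma def_pred_all_point [def_intros]:
  fixes P :: "(nat \<Rightarrow> real) \<Rightarrow> real ^ 'n \<Rightarrow> bool"
  assumes "def_pred (\<lambda>e. P (\<lambda>i. e (CARD('n) + i)) (point e))"
  shows "def_pred (\<lambda>e. \<forall>x. P e x)"
  using def_pred_not[OF def_pred_ex_point[of "\<lambda>e x. \<not> P e x", OF def_pred_not[OF assms]]] by simp

text \<open>An attained minimum is described in first-order terms as a value that is taken and is a
  lower bound. Slopes and squared distances are both of this form.\<close>

lemma def_fun_attained_min:
  fixes K :: "(real ^ 'n) set"
  assumes K: "definable D K" and G: "def_fun (\<lambda>e. G (\<lambda>i. e (CARD('n) + i)) (point e))"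
    and m: "\<And>e. \<exists>p\<in>K. m e = G e p" "\<And>e p. p \<in> K \<Longrightarrow> m e \<le> G e p"
  shows "def_fun m"
proof -
  have "e 0 = m (\<lambda>i. e (Suc i)) \<longleftrightarrow>
    (\<exists>p. p \<in> K \<and> e 0 = G (\<lambda>i. e (Suc i)) p) \<and> (\<forall>p. p \<in> K \<longrightarrow> e 0 \<le> G (\<lambda>i. e (Suc i)) p)" for e
    using m by (metis order_antisym)
  moreover have "def_pred (\<lambda>e. (\<exists>p. p \<in> K \<and> e 0 = G (\<lambda>i. e (Suc i)) p) \<and> (\<forall>p. p \<in> K \<longrightarrow> e 0 \<le> G (\<lambda>i. e (Suc i)) p))"
  proof -
    \<comment> \<open>Below the quantifier over \<open>p\<close> the environment lists the
      coordinates of \<open>p\<close>, then the value of \<open>m\<close>, then the parameters. The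
      renaming skips the entry of that value.\<close>
    have "def_fun (\<lambda>e. G (\<lambda>i. e (CARD('n) + Suc i)) (point e))"
      using def_fun_reindex[OF G, of "\<lambda>i. if i < CARD('n) then i else Suc i"]
      by (rule back_subst[of def_fun]) (auto simp: fun_eq_iff vec_eq_iff intro!: arg_cong2[of _ _ _ _ G])
    then show ?thesis by (intro def_intros K)
  qed
  ultimately show ?thesis unfolding def_fun_def by simp
qed

lemma definable_foot:
  fixes K :: "(real ^ 'n) set"
  assumes K: "definable D K"
  shows "definable D (foot x K)"
proof (rule definableI)
  have "dist x p = infdist x K \<longleftrightarrow> (x - p) \<bullet> (x - p) = (infdist x K)\<^sup>2" for p
    by (simp add: dist_norm power2_norm_eq_inner[symmetric] infdist_nonneg)
  then have "(point e \<in> foot x K) = (point e \<in> K \<and> (x - point e) \<bullet> (x - point e) = (infdist x K)\<^sup>2)" for e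
    by (simp add: foot_def)
  moreover have "def_pred (\<lambda>e. point e \<in> K \<and> (x - point e) \<bullet> (x - point e) = (infdist x K)\<^sup>2)"
    by (intro def_intros K)
  ultimately show "def_pred (\<lambda>e. point e \<in> foot x K)" by simp
qed

lemma def_fun_slope:
  fixes K :: "(real ^ 'n) set"
  assumes K: "definable D K" "closed K" "K \<noteq> {}" and f: "def_vec f"
  shows "def_fun (\<lambda>e. slope x K (f e))"
proof (rule def_fun_attained_min[OF definable_foot[OF K(1)], where G = "\<lambda>e p. f e \<bullet> (x - p)"])
  show "def_fun (\<lambda>e. f (\<lambda>i. e (CARD('n) + i)) \<bullet> (x - point e))"
    by (intro def_intros def_vec_reindex[OF f])
  show "\<exists>p\<in>foot x K. slope x K (f e) = f e \<bullet> (x - p)" for e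
    using slope_attained[OF K(2,3), of x "f e"] by metis
  show "slope x K (f e) \<le> f e \<bullet> (x - p)" if "p \<in> foot x K" for e p
    by (rule slope_le[OF K(2) that])
qed

lemma def_fun_infdist_sq:
  fixes K :: "(real ^ 'n) set"
  assumes K: "definable D K" "closed K" "K \<noteq> {}" and f: "def_vec f"
  shows "def_fun (\<lambda>e. (infdist (f e) K)\<^sup>2)"
proof (rule def_fun_attained_min[OF K(1), where G = "\<lambda>e p. (f e - p) \<bullet> (f e - p)"])
  show "def_fun (\<lambda>e. (f (\<lambda>i. e (CARD('n) + i)) - point e) \<bullet> (f (\<lambda>i. e (CARD('n) + i)) - point e))"
    by (intro def_intros def_vec_reindex[OF f])
  fix e
  obtain p where "p \<in> K" "infdist (f e) K = dist (f e) p" by (rule infdist_attains_inf[OF K(2,3)])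
  then show "\<exists>p\<in>K. (infdist (f e) K)\<^sup>2 = (f e - p) \<bullet> (f e - p)"
    by (auto simp: dist_norm power2_norm_eq_inner)
  show "(infdist (f e) K)\<^sup>2 \<le> (f e - p) \<bullet> (f e - p)" if "p \<in> K" for p
    using infdist_le[OF that, of "f e"] infdist_nonneg[of "f e" K]
    by (simp add: dist_norm power2_norm_eq_inner[symmetric] power_mono)
qed

section \<open>One-sided germs and definable arcs\<close>

lemma definable_line_right_germ:
  assumes "def_pred (\<lambda>e. e 0 \<in> A)"
  obtains \<epsilon> where "\<epsilon> > 0" "{0<..<\<epsilon>} \<subseteq> A \<or> {0<..<\<epsilon>} \<inter> A = {}"
proof -
  obtain \<J> where \<J>: "finite \<J>" "\<forall>J\<in>\<J>. is_interval (J :: real set)" "A = \<Union>\<J>"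
    using definable_line[OF assms] .
  \<comment> \<open>If an interval contains \<open>u\<close> but misses some \<open>z\<close>
    between 0 and \<open>u\<close>, then by convexity it misses everything between 0 and
    \<open>z\<close>.\<close>
  have germ: "\<exists>\<epsilon>>0. {0<..<\<epsilon>} \<subseteq> J \<or> {0<..<\<epsilon>} \<inter> J = {}" if "is_interval J" for J :: "real set"
  proof (cases "{0<..<1} \<inter> J = {}")
    case False
    then obtain u where u: "0 < u" "u < 1" "u \<in> J" by auto
    show ?thesis
    proof (cases "{0<..<u} \<subseteq> J")
      case True
      with u show ?thesis by blast
    next
      case False
      then obtain z where z: "0 < z" "z < u" "z \<notin> J" by fastforce
      have "{0<..<z} \<inter> J = {}"
      proof (rule ccontr)
        assume "{0<..<z} \<inter> J \<noteq> {}"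
        then obtain y where "y < z" "y \<in> J" by auto
        with z u(3) that have "z \<in> J" unfolding is_interval_1 by (meson less_imp_le)
        with z(3) show False ..
      qed
      with z(1) show ?thesis by blast
    qed
  qed (use zero_less_one in blast)
  have "\<exists>\<epsilon>>0. {0<..<\<epsilon>} \<subseteq> \<Union>\<J> \<or> {0<..<\<epsilon>} \<inter> \<Union>\<J> = {}"
    using \<J>(1,2)
  proof (induction \<J> rule: finite_induct)
    case empty
    then show ?case by (intro exI[of _ 1]) auto
  next
    case (insert J \<J>)
    then obtain \<epsilon>1 where 1: "\<epsilon>1 > 0" "{0<..<\<epsilon>1} \<subseteq> \<Union>\<J> \<or> {0<..<\<epsilon>1} \<inter> \<Union>\<J> = {}" by auto
    obtain \<epsilon>2 where 2: "\<epsilon>2 > 0" "{0<..<\<epsilon>2} \<subseteq> J \<or> {0<..<\<epsilon>2} \<inter> J = {}"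
      using germ[of J] insert.prems by auto
    have "{0<..<min \<epsilon>1 \<epsilon>2} = {0<..<\<epsilon>1} \<inter> {0<..<\<epsilon>2}" by auto
    with 1 2 show ?case by (intro exI[of _ "min \<epsilon>1 \<epsilon>2"]) auto
  qed
  with that \<J>(3) show thesis by blast
qed

lemma def_fun_comp1: "def_fun (\<lambda>e. s (e 0)) \<Longrightarrow> def_fun f \<Longrightarrow> def_fun (\<lambda>e. s (f e))"
  using def_fun_subst[of "\<lambda>e. s (e 0)" "\<lambda>_. f"] by simp

lemma def_fun_comp2:
  "def_fun (\<lambda>e. h (e 0) (e 1)) \<Longrightarrow> def_fun f \<Longrightarrow> def_fun g \<Longrightarrow> def_fun (\<lambda>e. h (f e) (g e))"
proof -
  assume h: "def_fun (\<lambda>e. h (e 0) (e 1))" and fg: "def_fun f" "def_fun g"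
  have "def_fun (if i = 0 then f else g)" for i :: nat using fg by simp
  from def_fun_subst[OF h, of "\<lambda>i. if i = 0 then f else g", OF this] show ?thesis by simp
qed

text \<open>The continuity points form a definable set, which contains or misses a right
  neighbourhood of 0. The one-dimensional case of \<open>generic_continuity\<close> excludes the
  second alternative.\<close>

lemma definable_right_continuous:
  assumes s: "def_fun (\<lambda>e. s (e 0))"
  obtains \<epsilon> where "\<epsilon> > 0" "continuous_on {0<..<\<epsilon>} s"
proof -
  have iff: "isCont s t \<longleftrightarrow> (\<forall>\<epsilon>. 0 < \<epsilon> \<longrightarrow> (\<exists>\<delta>. 0 < \<delta> \<and> (\<forall>y. \<bar>y - t\<bar> < \<delta> \<longrightarrow> \<bar>s y - s t\<bar> < \<epsilon>)))" for t
    unfolding continuous_at_eps_delta dist_real_def by simp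
  have "def_pred (\<lambda>e. e 0 \<in> {t. isCont s t})"
    unfolding mem_Collect_eq iff by (intro def_intros def_fun_comp1[OF s])
  then obtain \<epsilon> where \<epsilon>: "\<epsilon> > 0" "{0<..<\<epsilon>} \<subseteq> {t. isCont s t} \<or> {0<..<\<epsilon>} \<inter> {t. isCont s t} = {}"
    by (rule definable_line_right_germ)
  have "\<exists>t\<in>{0<..<\<epsilon>}. isCont s t"
  proof -
    have "(s (e 0)) = s (restr 1 e 0)" for e by simp
    from generic_continuity[OF s this, of "\<lambda>_. 0" "\<lambda>_. \<epsilon>"] \<epsilon>(1)
    obtain a b where ab: "a 0 < b 0" "obox 1 a b \<subseteq> obox 1 (\<lambda>_. 0) (\<lambda>_. \<epsilon>)"
      "continuous_on (obox 1 a b) (\<lambda>e. s (e 0))" by auto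
    define c where "c t = (\<lambda>i::nat. if i = 0 then t else 0)" for t :: real
    have cb: "c t \<in> obox 1 a' b' \<longleftrightarrow> a' 0 < t \<and> t < b' 0" for t a' b'
      by (auto simp: c_def obox_def rspace_def)
    have "continuous_on UNIV c"
      by (rule continuous_on_coordinatewise_then_product, rename_tac i, case_tac "i = 0") (simp_all add: c_def)
    then have "continuous_on {a 0<..<b 0} c" by (rule continuous_on_subset) simp
    moreover have "c ` {a 0<..<b 0} \<subseteq> obox 1 a b" unfolding image_subset_iff cb by simp
    ultimately have "continuous_on {a 0<..<b 0} (\<lambda>t. s (c t 0))"
      by (rule continuous_on_compose2[OF ab(3)])
    then have cont: "continuous_on {a 0<..<b 0} s" by (simp add: c_def)
    define t where "t = (a 0 + b 0) / 2"
    have t: "t \<in> {a 0<..<b 0}" using ab(1) by (auto simp: t_def)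
    then have "isCont s t" using cont by (simp add: continuous_on_eq_continuous_at)
    moreover have "t \<in> {0<..<\<epsilon>}" using ab(2) t cb[of t a b] cb[of t "\<lambda>_. 0" "\<lambda>_. \<epsilon>"] by auto
    ultimately show ?thesis by blast
  qed
  with \<epsilon> have "{0<..<\<epsilon>} \<subseteq> {t. isCont s t}" by blast
  then have "continuous_on {0<..<\<epsilon>} s" by (intro continuous_at_imp_continuous_on) auto
  with that \<epsilon>(1) show thesis by blast
qed

text \<open>The criterion for producing tangent vectors. The correction \<open>s t\<close> in
  direction \<open>e\<close> tends to 0, so the arc has velocity \<open>v\<close> at 0. Continuity
  on a short interval comes from the definability of \<open>s\<close>.\<close>

lemma arc_in_tangent_cone:
  fixes x v e :: "real ^ 'n"
  assumes s: "def_fun (\<lambda>z. s (z 0))"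
    and lim: "\<And>\<delta>. \<delta> > 0 \<Longrightarrow> \<exists>\<eta>>0. \<forall>t. 0 < t \<and> t < \<eta> \<longrightarrow> \<bar>s t\<bar> < \<delta>"
    and Y: "x \<in> Y" "\<epsilon> > 0" "\<And>t. 0 < t \<Longrightarrow> t < \<epsilon> \<Longrightarrow> x + t *\<^sub>R (v + s t *\<^sub>R e) \<in> Y"
  shows "x + v \<in> tangent_cone D x Y"
proof -
  obtain \<epsilon>1 where \<epsilon>1: "\<epsilon>1 > 0" "continuous_on {0<..<\<epsilon>1} s" using definable_right_continuous[OF s] .
  define \<epsilon>' where "\<epsilon>' = min \<epsilon> \<epsilon>1"
  have \<epsilon>': "\<epsilon>' > 0" "\<epsilon>' \<le> \<epsilon>" "\<epsilon>' \<le> \<epsilon>1" using Y(2) \<epsilon>1(1) by (auto simp: \<epsilon>'_def)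
  define \<gamma> where "\<gamma> t = x + t *\<^sub>R (v + s t *\<^sub>R e)" for t
  have "((\<lambda>t. (1 / norm (t - 0)) *\<^sub>R (\<gamma> t - (\<gamma> 0 + (t - 0) *\<^sub>R v))) \<longlongrightarrow> 0) (at 0 within {0..<\<epsilon>'})"
    unfolding Lim_within
  proof (intro allI impI)
    fix \<delta> :: real assume "\<delta> > 0"
    then have "\<delta> / (norm e + 1) > 0" by (simp add: add_nonneg_pos)
    from lim[OF this] obtain \<eta> where \<eta>: "\<eta> > 0" "\<And>t. 0 < t \<Longrightarrow> t < \<eta> \<Longrightarrow> \<bar>s t\<bar> < \<delta> / (norm e + 1)" by blast
    have "dist ((1 / norm (t - 0)) *\<^sub>R (\<gamma> t - (\<gamma> 0 + (t - 0) *\<^sub>R v))) 0 < \<delta>" if t: "0 < t" "t < \<eta>" for t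
    proof -
      have "(1 / norm (t - 0)) *\<^sub>R (\<gamma> t - (\<gamma> 0 + (t - 0) *\<^sub>R v)) = s t *\<^sub>R e"
        using t(1) by (simp add: \<gamma>_def algebra_simps)
      moreover have "\<bar>s t\<bar> * norm e \<le> \<bar>s t\<bar> * (norm e + 1)" by (simp add: mult_left_mono)
      moreover have "\<bar>s t\<bar> * (norm e + 1) < \<delta>"
        using \<eta>(2)[OF t] by (simp add: pos_less_divide_eq add_nonneg_pos)
      ultimately show ?thesis by simp
    qed
    with \<eta>(1) show "\<exists>d>0. \<forall>t\<in>{0..<\<epsilon>'}. 0 < dist t 0 \<and> dist t 0 < d \<longrightarrow>
        dist ((1 / norm (t - 0)) *\<^sub>R (\<gamma> t - (\<gamma> 0 + (t - 0) *\<^sub>R v))) 0 < \<delta>"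
      by (intro exI[of _ \<eta>]) auto
  qed
  then have deriv: "(\<gamma> has_vector_derivative v) (at 0 within {0..<\<epsilon>'})"
    unfolding has_vector_derivative_def has_derivative_within by (simp add: bounded_linear_scaleR_left)
  have "continuous_on {0..<\<epsilon>'} \<gamma>"
    unfolding continuous_on_eq_continuous_within
  proof
    fix t assume t: "t \<in> {0..<\<epsilon>'}"
    show "continuous (at t within {0..<\<epsilon>'}) \<gamma>"
    proof (cases "t = 0")
      case True
      with deriv show ?thesis by (auto intro: has_vector_derivative_continuous)
    next
      case False
      with t \<epsilon>' have "t \<in> {0<..<\<epsilon>1}" by auto
      moreover have "continuous_on {0<..<\<epsilon>1} \<gamma>" unfolding \<gamma>_def by (intro continuous_intros \<epsilon>1(2))
      ultimately have "isCont \<gamma> t" by (simp add: continuous_on_eq_continuous_at)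
      then show ?thesis by (rule continuous_at_imp_continuous_at_within)
    qed
  qed
  moreover have "\<gamma> ` {0..<\<epsilon>'} \<subseteq> Y"
  proof
    fix y assume "y \<in> \<gamma> ` {0..<\<epsilon>'}"
    then obtain t where "0 \<le> t" "t < \<epsilon>" "y = \<gamma> t" using \<epsilon>' by auto
    then show "y \<in> Y" using Y by (cases "t = 0") (auto simp: \<gamma>_def)
  qed
  moreover have "(\<lambda>t. case_nat t (coords (\<gamma> t))) ` {0..<\<epsilon>'} \<in> D (Suc CARD('n))"
  proof -
    have "def_vec (\<lambda>z. \<gamma> (z 0))" unfolding \<gamma>_def by (intro def_intros s)
    then have "{z \<in> rspace (Suc CARD('n)). 0 \<le> z 0 \<and> z 0 < \<epsilon>' \<and> (\<forall>i<CARD('n). z (Suc i) = coords (\<gamma> (z 0)) i)} \<in> D (Suc CARD('n))"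
      by (intro def_pred_D def_intros)
    also have "{z \<in> rspace (Suc CARD('n)). 0 \<le> z 0 \<and> z 0 < \<epsilon>' \<and> (\<forall>i<CARD('n). z (Suc i) = coords (\<gamma> (z 0)) i)} =
        (\<lambda>t. case_nat t (coords (\<gamma> t))) ` {0..<\<epsilon>'}"
    proof (intro set_eqI iffI)
      fix z assume z: "z \<in> {z \<in> rspace (Suc CARD('n)). 0 \<le> z 0 \<and> z 0 < \<epsilon>' \<and> (\<forall>i<CARD('n). z (Suc i) = coords (\<gamma> (z 0)) i)}"
      have "z = case_nat (z 0) (coords (\<gamma> (z 0)))"
      proof
        fix i show "z i = case_nat (z 0) (coords (\<gamma> (z 0))) i"
          using z by (cases i; cases "i \<le> CARD('n)") (auto simp: rspace_def coords_ge)
      qed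
      then show "z \<in> (\<lambda>t. case_nat t (coords (\<gamma> t))) ` {0..<\<epsilon>'}" using z by (intro image_eqI[of _ _ "z 0"]) auto
    qed (auto simp: rspace_def coords_ge split: nat.split)
    finally show ?thesis .
  qed
  moreover have "\<gamma> 0 = x" by (simp add: \<gamma>_def)
  ultimately show ?thesis
    unfolding tangent_cone_def definable_arc_def using deriv \<epsilon>'(1) by blast
qed

text \<open>The selected zero is one of least absolute value, the positive one in case of a tie.\<close>

lemma definable_zero_selection:
  assumes h: "def_fun (\<lambda>e. h (e 0) (e 1))" and cont: "\<And>t. continuous_on UNIV (h t)"
    and zero: "\<And>\<delta>. \<delta> > 0 \<Longrightarrow> \<exists>\<eta>>0. \<forall>t. 0 < t \<and> t < \<eta> \<longrightarrow> (\<exists>u. \<bar>u\<bar> < \<delta> \<and> h t u = (0::real))"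
  obtains s \<eta> where "def_fun (\<lambda>e. s (e 0))" "\<And>\<delta>. \<delta> > 0 \<Longrightarrow> \<exists>\<eta>>0. \<forall>t. 0 < t \<and> t < \<eta> \<longrightarrow> \<bar>s t\<bar> < \<delta>"
    "\<eta> > 0" "\<And>t. 0 < t \<Longrightarrow> t < \<eta> \<Longrightarrow> h t (s t) = 0"
proof -
  define Z where "Z t = {u. h t u = 0}" for t
  \<comment> \<open>The least absolute value of a zero, if there is one. For empty
    \<open>Z t\<close> the distance has the default value 0, which is the second alternative in
    \<open>m_iff\<close>.\<close>
  define m where "m t = infdist 0 (Z t)" for t
  define s where "s t = (if h t (m t) = 0 then m t else if h t (- m t) = 0 then - m t else 0)" for t
  have Z: "closed (Z t)" for t
    using continuous_closed_vimage[of "{0}" "h t"] cont[of t]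
    by (auto simp: Z_def vimage_def continuous_on_eq_continuous_at)
  have m_min: "\<exists>u. h t u = 0 \<and> m t = \<bar>u\<bar>" if nz: "h t u0 = 0" for t u0
  proof -
    have "Z t \<noteq> {}" using nz by (auto simp: Z_def)
    then obtain u where "u \<in> Z t" "infdist 0 (Z t) = dist 0 u" by (rule infdist_attains_inf[OF Z])
    then show ?thesis by (auto simp: Z_def m_def)
  qed
  have m_le: "m t \<le> \<bar>u\<bar>" if "h t u = 0" for t u
    using infdist_le[of u "Z t" 0] that by (auto simp: Z_def m_def)
  have s_zero: "h t (s t) = 0" if nz: "h t u = 0" for t u
  proof -
    obtain u' where "h t u' = 0" "m t = \<bar>u'\<bar>" using m_min nz by blast
    then have "h t (m t) = 0 \<or> h t (- m t) = 0" by (cases "u' \<ge> 0") auto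
    then show ?thesis by (auto simp: s_def)
  qed
  have s_le: "\<bar>s t\<bar> \<le> \<bar>u\<bar>" if "h t u = 0" for t u
    using m_le[OF that] infdist_nonneg[of 0 "Z t"] by (auto simp: s_def m_def)
  note hc = def_fun_comp2[OF h]
  have m_iff: "y = m t \<longleftrightarrow> (\<exists>u. h t u = 0 \<and> y = \<bar>u\<bar> \<and> (\<forall>u'. h t u' = 0 \<longrightarrow> \<bar>u\<bar> \<le> \<bar>u'\<bar>)) \<or>
      (\<not> (\<exists>u. h t u = 0) \<and> y = 0)" for y t
  proof (cases "\<exists>u. h t u = 0")
    case True
    then obtain u where u: "h t u = 0" "m t = \<bar>u\<bar>" using m_min by blast
    have "(\<exists>u. h t u = 0 \<and> y = \<bar>u\<bar> \<and> (\<forall>u'. h t u' = 0 \<longrightarrow> \<bar>u\<bar> \<le> \<bar>u'\<bar>)) \<longleftrightarrow> y = m t"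
    proof
      assume "y = m t"
      with u m_le show "\<exists>u. h t u = 0 \<and> y = \<bar>u\<bar> \<and> (\<forall>u'. h t u' = 0 \<longrightarrow> \<bar>u\<bar> \<le> \<bar>u'\<bar>)" by metis
    next
      assume "\<exists>u. h t u = 0 \<and> y = \<bar>u\<bar> \<and> (\<forall>u'. h t u' = 0 \<longrightarrow> \<bar>u\<bar> \<le> \<bar>u'\<bar>)"
      then obtain u' where "h t u' = 0" "y = \<bar>u'\<bar>" "\<bar>u'\<bar> \<le> \<bar>u\<bar>" using u(1) by blast
      with u(2) m_le[of t u'] show "y = m t" by linarith
    qed
    with True show ?thesis by blast
  next
    case False
    then have "Z t = {}" by (auto simp: Z_def)
    with False show ?thesis by (simp add: m_def infdist_def)
  qed
  have "def_fun (\<lambda>e. m (e 0))"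
    unfolding def_fun_def m_iff by (intro def_intros hc)
  then have "def_fun (\<lambda>e. s (e 0))"
    unfolding s_def by (intro def_intros hc)
  moreover have "\<exists>\<eta>>0. \<forall>t. 0 < t \<and> t < \<eta> \<longrightarrow> \<bar>s t\<bar> < \<delta>" if "\<delta> > 0" for \<delta>
    using zero[OF that] s_le by (meson le_less_trans)
  moreover obtain \<eta> where "\<eta> > 0" "\<And>t. 0 < t \<Longrightarrow> t < \<eta> \<Longrightarrow> h t (s t) = 0"
    using zero[of 1] s_zero zero_less_one by metis
  ultimately show thesis by (rule that)
qed

end

section \<open>Territories and conflict sets\<close>

locale conflict_data = omin_real_field D for D +
  fixes k :: nat and X :: "nat \<Rightarrow> (real ^ 'n) set" and x0 :: "real ^ 'n"
  assumes X_nonempty: "i \<in> {1..k} \<Longrightarrow> X i \<noteq> {}"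
    and X_closed: "i \<in> {1..k} \<Longrightarrow> closed (X i)"
    and X_definable: "i \<in> {1..k} \<Longrightarrow> definable D (X i)"
    and X_disjoint: "disjoint_family_on X {1..k}"
begin

section \<open>The sets at minimal distance from the base point\<close>

definition active :: "nat set" where
  "active = {l \<in> {1..k}. x0 \<in> territory k X l}"

lemma active_iff: "l \<in> active \<longleftrightarrow> l \<in> {1..k} \<and> (\<forall>j\<in>{1..k}. infdist x0 (X l) \<le> infdist x0 (X j))"
  by (auto simp: active_def territory_def)

lemma finite_active: "finite active"
  by (simp add: active_def)

lemma active_infdist_eq: "l \<in> active \<Longrightarrow> i \<in> active \<Longrightarrow> infdist x0 (X l) = infdist x0 (X i)"
  by (auto simp: active_iff intro: order_antisym)

lemma inactive_infdist_less:
  assumes "i \<in> active" "l \<in> {1..k}" "l \<notin> active"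
  shows "infdist x0 (X i) < infdist x0 (X l)"
proof (rule ccontr)
  assume "\<not> ?thesis"
  then have "infdist x0 (X l) \<le> infdist x0 (X j)" if "j \<in> {1..k}" for j
    using assms(1) that unfolding active_iff by (meson not_less order_trans)
  with assms(2,3) show False by (auto simp: active_iff)
qed

lemma foot_disjoint: "i \<in> {1..k} \<Longrightarrow> l \<in> {1..k} \<Longrightarrow> i \<noteq> l \<Longrightarrow> p \<in> foot x (X i) \<Longrightarrow> q \<in> foot x (X l) \<Longrightarrow> p \<noteq> q"
  using X_disjoint unfolding foot_def disjoint_family_on_def by blast

text \<open>By disjointness, \<open>x0 - p\<close> and \<open>x0 - q\<close> are distinct vectors of
  equal length, so their inner product is strictly below the squared length.\<close>

lemma inner_feet_less:
  assumes "i \<in> active" "l \<in> active" "l \<noteq> i" "p \<in> foot x0 (X i)" "q \<in> foot x0 (X l)"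
  shows "(x0 - p) \<bullet> (x0 - q) < (infdist x0 (X i))\<^sup>2"
proof -
  have "p \<noteq> q" using foot_disjoint[of i l p x0 q] assms by (auto simp: active_iff)
  then have "0 < (norm ((x0 - p) - (x0 - q)))\<^sup>2" by simp
  also have "\<dots> = (x0 - p) \<bullet> (x0 - p) + (x0 - q) \<bullet> (x0 - q) - 2 * ((x0 - p) \<bullet> (x0 - q))"
    unfolding power2_norm_eq_inner by (simp only: inner_diff_left[of "x0 - p"] inner_diff_right[of _ "x0 - p"] inner_commute[of "x0 - q" "x0 - p"])
  finally show ?thesis
    using norm_foot[OF assms(4)] norm_foot[OF assms(5)] active_infdist_eq[OF assms(1,2)]
    by (simp add: power2_norm_eq_inner[symmetric])
qed

lemma nearerI:
  assumes "i \<in> active" "l \<in> {1..k}" "l \<in> active \<Longrightarrow> slope x0 (X i) v < slope x0 (X l) v"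
  shows "nearer x0 v (X i) (X l)"
proof (cases "l \<in> active")
  case True
  with assms active_infdist_eq show ?thesis unfolding nearer_def by blast
qed (use assms inactive_infdist_less in \<open>auto simp: nearer_def\<close>)

lemma uniformly_nearer:
  assumes i: "i \<in> {1..k}" and "J \<subseteq> {1..k}" "\<And>l. l \<in> J \<Longrightarrow> nearer x0 v (X i) (X l)"
  obtains \<eta> where "\<eta> > 0" "\<And>l t w. l \<in> J \<Longrightarrow> 0 < t \<Longrightarrow> t < \<eta> \<Longrightarrow> norm (w - v) < \<eta> \<Longrightarrow>
    infdist (x0 + t *\<^sub>R w) (X i) < infdist (x0 + t *\<^sub>R w) (X l)"
proof -
  have "finite J" using assms(2) finite_subset by blast
  moreover have "\<exists>\<eta>>0. \<forall>t w. 0 < t \<and> t < \<eta> \<and> norm (w - v) < \<eta> \<longrightarrow>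
      infdist (x0 + t *\<^sub>R w) (X i) < infdist (x0 + t *\<^sub>R w) (X l)" if "l \<in> J" for l
    using assms that by (intro nearer_infdist_less X_closed X_nonempty) auto
  ultimately show thesis
    using finite_common_radius[of J v "\<lambda>l t w. infdist (x0 + t *\<^sub>R w) (X i) < infdist (x0 + t *\<^sub>R w) (X l)"] that
    by blast
qed

text \<open>Strict nearness is stable under small changes of the direction. Hence the straight
  segments in a whole ball of directions around \<open>p - x0\<close> stay in the territory, and
  each of them is an admissible arc.\<close>

lemma interior_tangent_cone_territory:
  assumes i: "i \<in> active"
  shows "interior (tangent_cone D x0 (territory k X i)) \<noteq> {}"
proof -
  have ik: "i \<in> {1..k}" using i by (simp add: active_def)
  obtain p where p: "p \<in> foot x0 (X i)" using foot_nonempty[OF X_closed X_nonempty] ik by blast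
  define v where "v = - (x0 - p)"
  have "nearer x0 v (X i) (X l)" if l: "l \<in> {1..k} - {i}" for l
  proof (rule nearerI[OF i])
    assume la: "l \<in> active"
    obtain q where q: "q \<in> foot x0 (X l)" "slope x0 (X l) v = v \<bullet> (x0 - q)"
      using slope_attained[OF X_closed X_nonempty, of l x0 v] l by blast
    have "slope x0 (X i) v \<le> v \<bullet> (x0 - p)" by (rule slope_le[OF X_closed[OF ik] p])
    also have "\<dots> = - (infdist x0 (X i))\<^sup>2"
      using norm_foot[OF p] unfolding v_def inner_minus_left by (simp add: power2_norm_eq_inner[symmetric])
    also have "\<dots> < - ((x0 - p) \<bullet> (x0 - q))" using inner_feet_less[OF i la _ p q(1)] l by simp
    also have "\<dots> = slope x0 (X l) v" by (simp only: q(2)) (simp only: v_def inner_minus_left)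
    finally show "slope x0 (X i) v < slope x0 (X l) v" .
  qed (use l in auto)
  then obtain \<eta> where \<eta>: "\<eta> > 0" "\<And>l t w. l \<in> {1..k} - {i} \<Longrightarrow> 0 < t \<Longrightarrow> t < \<eta> \<Longrightarrow> norm (w - v) < \<eta> \<Longrightarrow>
      infdist (x0 + t *\<^sub>R w) (X i) < infdist (x0 + t *\<^sub>R w) (X l)"
    using uniformly_nearer[OF ik, of "{1..k} - {i}" v] by blast
  have "ball (x0 + v) \<eta> \<subseteq> tangent_cone D x0 (territory k X i)"
  proof
    fix y assume y: "y \<in> ball (x0 + v) \<eta>"
    define w where "w = y - x0"
    have w: "norm (w - v) < \<eta>" using y by (simp add: w_def dist_norm norm_minus_commute algebra_simps)
    have "x0 + w \<in> tangent_cone D x0 (territory k X i)"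
    proof (rule arc_in_tangent_cone[where s = "\<lambda>_. 0" and e = 0, OF def_fun_const])
      show "x0 \<in> territory k X i" using i by (simp add: active_def)
      show "x0 + t *\<^sub>R (w + 0 *\<^sub>R 0) \<in> territory k X i" if "0 < t" "t < \<eta>" for t
        using \<eta>(2)[OF _ that w] by (auto simp: territory_def) (metis less_imp_le order_refl)
    qed (use \<eta>(1) in \<open>auto intro: exI[of _ 1]\<close>)
    then show "y \<in> tangent_cone D x0 (territory k X i)" by (simp add: w_def)
  qed
  with \<eta>(1) show ?thesis by (metis centre_in_ball empty_iff interior_maximal open_ball subsetD)
qed

section \<open>Tangent directions of the conflict set are ties, so they have no interior\<close>

lemma tangent_conflict_tie:
  assumes "x0 + v \<in> tangent_cone D x0 (conflict_set k X)"
  obtains i j where "i \<in> active" "j \<in> active" "i \<noteq> j" "slope x0 (X i) v = slope x0 (X j) v"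
    "\<And>l. l \<in> active \<Longrightarrow> slope x0 (X i) v \<le> slope x0 (X l) v"
proof -
  obtain \<gamma> \<epsilon> where \<gamma>: "\<epsilon> > 0" "\<gamma> ` {0..<\<epsilon>} \<subseteq> conflict_set k X" "\<gamma> 0 = x0"
    "(\<gamma> has_vector_derivative v) (at 0 within {0..<\<epsilon>})"
    using assms by (auto simp: tangent_cone_def definable_arc_def)
  then have "x0 \<in> conflict_set k X" by force
  then have "active \<noteq> {}" by (auto simp: conflict_set_def active_def)
  then obtain i where i: "i \<in> active" "\<And>l. l \<in> active \<Longrightarrow> slope x0 (X i) v \<le> slope x0 (X l) v"
    using finite_active ex_min_if_finite[of "(\<lambda>l. slope x0 (X l) v) ` active"]
    by (metis (no_types, lifting) arg_min_if_finite(1) arg_min_least)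
  show thesis
  proof (cases "\<exists>j\<in>active. j \<noteq> i \<and> slope x0 (X i) v = slope x0 (X j) v")
    case True
    with that i show thesis by metis
  next
    case False
    have ik: "i \<in> {1..k}" using i by (simp add: active_def)
    \<comment> \<open>With a unique minimal slope, \<open>X i\<close> would be strictly nearest at
      all points reached by short steps in directions near \<open>v\<close>. Points of the arc near
      \<open>x0\<close> are of this kind, yet each belongs to two territories.\<close>
    have "nearer x0 v (X i) (X l)" if "l \<in> {1..k} - {i}" for l
      using that False i by (intro nearerI) (auto simp: order_less_le)
    then obtain \<eta> where \<eta>: "\<eta> > 0" "\<And>l t w. l \<in> {1..k} - {i} \<Longrightarrow> 0 < t \<Longrightarrow> t < \<eta> \<Longrightarrow> norm (w - v) < \<eta> \<Longrightarrow>
        infdist (x0 + t *\<^sub>R w) (X i) < infdist (x0 + t *\<^sub>R w) (X l)"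
      using uniformly_nearer[OF ik, of "{1..k} - {i}" v] by blast
    have "((\<lambda>t. (1 / norm (t - 0)) *\<^sub>R (\<gamma> t - (\<gamma> 0 + (t - 0) *\<^sub>R v))) \<longlongrightarrow> 0) (at 0 within {0..<\<epsilon>})"
      using \<gamma>(4) unfolding has_vector_derivative_def has_derivative_within by blast
    then obtain d where d: "d > 0" "\<And>t. t \<in> {0..<\<epsilon>} \<Longrightarrow> 0 < dist t 0 \<Longrightarrow> dist t 0 < d \<Longrightarrow>
        dist ((1 / norm (t - 0)) *\<^sub>R (\<gamma> t - (\<gamma> 0 + (t - 0) *\<^sub>R v))) 0 < \<eta>"
      unfolding Lim_within using \<eta>(1) by meson
    define t where "t = min (min d \<eta>) \<epsilon> / 2"
    have t: "0 < t" "t < d" "t < \<eta>" "t < \<epsilon>" using d(1) \<eta>(1) \<gamma>(1) by (auto simp: t_def min_def)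
    \<comment> \<open>The difference quotient of the arc, which differentiability at 0 places within
      \<open>\<eta>\<close> of \<open>v\<close>.\<close>
    define w where "w = (1 / t) *\<^sub>R (\<gamma> t - x0)"
    have gt: "\<gamma> t = x0 + t *\<^sub>R w" using t(1) by (simp add: w_def)
    have "(1 / norm (t - 0)) *\<^sub>R (\<gamma> t - (\<gamma> 0 + (t - 0) *\<^sub>R v)) = w - v"
      using t(1) \<gamma>(3) by (simp add: gt algebra_simps)
    moreover have "t \<in> {0..<\<epsilon>}" "0 < dist t 0" "dist t 0 < d" using t by auto
    ultimately have "norm (w - v) < \<eta>" using d(2)[of t] by (simp only: dist_0_norm dist_norm diff_zero)
    from \<eta>(2)[OF _ t(1,3) this]
    have less: "infdist (\<gamma> t) (X i) < infdist (\<gamma> t) (X l)" if "l \<in> {1..k} - {i}" for l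
      using that gt by simp
    have "\<gamma> t \<in> conflict_set k X" using \<gamma>(2) t by auto
    then obtain a b where "a \<in> {1..k}" "b \<in> {1..k}" "a \<noteq> b" "\<gamma> t \<in> territory k X a" "\<gamma> t \<in> territory k X b"
      by (auto simp: conflict_set_def)
    then obtain l where "l \<in> {1..k} - {i}" "\<gamma> t \<in> territory k X l"
      by (cases "a = i") auto
    with less[of l] ik have False by (auto simp: territory_def not_le[symmetric])
    then show thesis ..
  qed
qed

text \<open>Around an interior direction every direction would be a tie. Starting from a minimal
  slope at \<open>v\<close>, a small step towards a minimizing foot of \<open>X i\<close> makes the
  slope of \<open>X i\<close> strictly smaller than all other active slopes.\<close>

lemma interior_tangent_cone_conflict_set:
  "interior (tangent_cone D x0 (conflict_set k X)) = {}"
proof (rule ccontr)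
  assume "interior (tangent_cone D x0 (conflict_set k X)) \<noteq> {}"
  then obtain c \<epsilon> where c: "\<epsilon> > 0" "ball c \<epsilon> \<subseteq> tangent_cone D x0 (conflict_set k X)"
    by (metis ex_in_conv mem_interior)
  define v where "v = c - x0"
  have tie: "x0 + w \<in> tangent_cone D x0 (conflict_set k X)" if "norm (w - v) < \<epsilon>" for w
    using c(2) that by (auto simp: v_def dist_norm norm_minus_commute algebra_simps subset_iff)
  have "x0 + v \<in> tangent_cone D x0 (conflict_set k X)" by (rule tie) (simp add: c(1))
  then obtain i where i: "i \<in> active" "\<And>l. l \<in> active \<Longrightarrow> slope x0 (X i) v \<le> slope x0 (X l) v"
    by (rule tangent_conflict_tie) blast
  have Xl: "closed (X l)" "X l \<noteq> {}" if "l \<in> active" for l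
    using that X_closed X_nonempty by (auto simp: active_def)
  obtain p where p: "p \<in> foot x0 (X i)" "slope x0 (X i) v = v \<bullet> (x0 - p)"
    using slope_attained[OF Xl[OF i(1)], of x0 v] by metis
  \<comment> \<open>The step stays inside the ball of radius \<open>\<epsilon>\<close>; the summand
    1 avoids a division by 0 when \<open>x0\<close> lies in \<open>X i\<close>.\<close>
  define s where "s = \<epsilon> / (2 * (norm (x0 - p) + 1))"
  have s: "s > 0" "s * norm (x0 - p) < \<epsilon>"
  proof -
    show "s > 0" using c(1) by (simp add: s_def add_nonneg_pos)
    then have "s * norm (x0 - p) \<le> s * (norm (x0 - p) + 1)" by simp
    also have "\<dots> = \<epsilon> / 2"
    proof -
      define N where "N = norm (x0 - p) + 1"
      have "N > 0" by (simp add: N_def add_nonneg_pos)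
      then have "\<epsilon> / (2 * N) * N = \<epsilon> / 2" by simp
      then show ?thesis by (simp only: N_def s_def)
    qed
    finally show "s * norm (x0 - p) < \<epsilon>" using c(1) by simp
  qed
  define w where "w = v - s *\<^sub>R (x0 - p)"
  have less: "slope x0 (X i) w < slope x0 (X l) w" if l: "l \<in> active" "l \<noteq> i" for l
  proof -
    obtain q where q: "q \<in> foot x0 (X l)" "slope x0 (X l) w = w \<bullet> (x0 - q)"
      using slope_attained[OF Xl[OF l(1)], of x0 w] by metis
    have "slope x0 (X i) w \<le> w \<bullet> (x0 - p)" by (rule slope_le[OF Xl(1)[OF i(1)] p(1)])
    also have "\<dots> = slope x0 (X i) v - s * (infdist x0 (X i))\<^sup>2"
      using norm_foot[OF p(1)] unfolding p(2) w_def
      by (simp add: inner_diff_left[of v] power2_norm_eq_inner[symmetric])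
    also have "\<dots> < slope x0 (X i) v - s * ((x0 - p) \<bullet> (x0 - q))"
      using inner_feet_less[OF i(1) l p(1) q(1)] s(1) by simp
    also have "\<dots> \<le> slope x0 (X l) v - s * ((x0 - p) \<bullet> (x0 - q))" using i(2)[OF l(1)] by simp
    also have "\<dots> \<le> w \<bullet> (x0 - q)"
      using slope_le[OF Xl(1)[OF l(1)] q(1), of v] by (simp add: w_def inner_diff_left[of v])
    finally show ?thesis using q(2) by simp
  qed
  have "x0 + w \<in> tangent_cone D x0 (conflict_set k X)"
    using s by (intro tie) (simp add: w_def)
  then obtain a b where ab: "a \<in> active" "b \<in> active" "a \<noteq> b" "slope x0 (X a) w = slope x0 (X b) w"
    "\<And>l. l \<in> active \<Longrightarrow> slope x0 (X a) w \<le> slope x0 (X l) w"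
    by (rule tangent_conflict_tie) blast
  show False
  proof (cases "a = i")
    case True
    with less[OF ab(2)] ab(3,4) show False by simp
  next
    case False
    with less[OF ab(1)] ab(5)[OF i(1)] show False by simp
  qed
qed

section \<open>Ties near the bisecting direction are tangent directions and contain a cell\<close>

lemma tie_in_tangent_cone:
  assumes x0: "x0 \<in> conflict_set k X"
    and ij: "i \<in> active" "j \<in> active" "i \<noteq> j" and "\<kappa> > 0"
    and others: "\<And>l. l \<in> active \<Longrightarrow> l \<noteq> i \<Longrightarrow> l \<noteq> j \<Longrightarrow> slope x0 (X i) w < slope x0 (X l) w"
    and incr: "\<And>v s. s \<ge> 0 \<Longrightarrow> norm (v - w0) \<le> \<rho> \<Longrightarrow> norm (v + s *\<^sub>R axis m 1 - w0) \<le> \<rho> \<Longrightarrow>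
      slope x0 (X i) v - slope x0 (X j) v + \<kappa> * s \<le>
      slope x0 (X i) (v + s *\<^sub>R axis m 1) - slope x0 (X j) (v + s *\<^sub>R axis m 1)"
    and w: "norm (w - w0) < \<rho>" "slope x0 (X i) w = slope x0 (X j) w"
  shows "x0 + w \<in> tangent_cone D x0 (conflict_set k X)"
proof -
  define e :: "real ^ 'n" where "e = axis m 1"
  have e: "norm e = 1" by (simp add: e_def)
  have k: "i \<in> {1..k}" "j \<in> {1..k}" using ij by (auto simp: active_def)
  \<comment> \<open>Zeros of \<open>h t\<close> are exactly the corrections \<open>u\<close> along
    the axis that reach a point equidistant from \<open>X i\<close> and \<open>X j\<close>. Squared
    distances are used because \<open>def_fun_infdist_sq\<close> makes them definable.\<close>
  define h where "h t u = (infdist (x0 + t *\<^sub>R (w + u *\<^sub>R e)) (X i))\<^sup>2 - (infdist (x0 + t *\<^sub>R (w + u *\<^sub>R e)) (X j))\<^sup>2" for t u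
  have h_def_fun: "def_fun (\<lambda>z. h (z 0) (z 1))"
    unfolding h_def using k by (intro def_intros def_fun_infdist_sq X_closed X_definable X_nonempty)
  have cont: "continuous_on A (h t)" for A t
    unfolding h_def by (intro continuous_intros continuous_on_infdist)
  have zero: "\<exists>\<eta>>0. \<forall>t. 0 < t \<and> t < \<eta> \<longrightarrow> (\<exists>u. \<bar>u\<bar> < \<delta> \<and> h t u = 0)" if "\<delta> > 0" for \<delta>
  proof -
    \<comment> \<open>Moving \<open>w\<close> by \<open>\<delta>'\<close> along the axis in either
      direction stays in the ball where \<open>incr\<close> holds. The slopes there compare in
      opposite ways, so \<open>h t\<close> changes sign between \<open>- \<delta>'\<close> and
      \<open>\<delta>'\<close> for small \<open>t\<close>.\<close>
    define \<delta>' where "\<delta>' = min (\<delta> / 2) ((\<rho> - norm (w - w0)) / 2)"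
    have d: "\<delta>' > 0" "\<delta>' < \<delta>" "norm (w - w0) + \<delta>' \<le> \<rho>"
    proof -
      have "\<delta>' \<le> \<delta> / 2" "\<delta>' \<le> (\<rho> - norm (w - w0)) / 2" unfolding \<delta>'_def by (rule min.cobounded1 min.cobounded2)+
      then show "\<delta>' < \<delta>" "norm (w - w0) + \<delta>' \<le> \<rho>"
        using \<open>\<delta> > 0\<close> w(1) by (simp_all add: field_simps)
      show "\<delta>' > 0" using \<open>\<delta> > 0\<close> w(1) by (simp add: \<delta>'_def)
    qed
    have n: "norm (w - w0) \<le> \<rho>" "norm (w + \<delta>' *\<^sub>R e - w0) \<le> \<rho>" "norm (w - \<delta>' *\<^sub>R e - w0) \<le> \<rho>"
      using w(1) d(1,3) e norm_triangle_ineq[of "w - w0" "\<delta>' *\<^sub>R e"] norm_triangle_ineq4[of "w - w0" "\<delta>' *\<^sub>R e"]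
      by (auto simp: algebra_simps)
    have "\<kappa> * \<delta>' > 0" using d(1) \<open>\<kappa> > 0\<close> by simp
    then have "slope x0 (X j) (w + \<delta>' *\<^sub>R e) < slope x0 (X i) (w + \<delta>' *\<^sub>R e)"
      "slope x0 (X i) (w - \<delta>' *\<^sub>R e) < slope x0 (X j) (w - \<delta>' *\<^sub>R e)"
      using incr[of \<delta>' w] incr[of \<delta>' "w - \<delta>' *\<^sub>R e"] n d(1) w(2) unfolding e_def by auto
    then have "nearer x0 (w + \<delta>' *\<^sub>R e) (X j) (X i)" "nearer x0 (w - \<delta>' *\<^sub>R e) (X i) (X j)"
      using ij k by (auto intro: nearerI)
    then obtain \<eta>1 \<eta>2 where \<eta>: "\<eta>1 > 0" "\<eta>2 > 0"
      "\<And>t. 0 < t \<Longrightarrow> t < \<eta>1 \<Longrightarrow> infdist (x0 + t *\<^sub>R (w + \<delta>' *\<^sub>R e)) (X j) < infdist (x0 + t *\<^sub>R (w + \<delta>' *\<^sub>R e)) (X i)"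
      "\<And>t. 0 < t \<Longrightarrow> t < \<eta>2 \<Longrightarrow> infdist (x0 + t *\<^sub>R (w - \<delta>' *\<^sub>R e)) (X i) < infdist (x0 + t *\<^sub>R (w - \<delta>' *\<^sub>R e)) (X j)"
      using uniformly_nearer[of j "{i}" "w + \<delta>' *\<^sub>R e"] uniformly_nearer[of i "{j}" "w - \<delta>' *\<^sub>R e"] k
      by (metis diff_self empty_subsetI insert_subset norm_zero singletonD singletonI)
    have "\<exists>u. \<bar>u\<bar> < \<delta> \<and> h t u = 0" if t: "0 < t" "t < min \<eta>1 \<eta>2" for t
    proof -
      have "0 \<le> h t \<delta>'" "h t (- \<delta>') \<le> 0"
        using \<eta>(3)[of t] \<eta>(4)[of t] t by (auto simp: h_def infdist_nonneg intro!: power_mono)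
      moreover have "- \<delta>' \<le> \<delta>'" using d(1) by simp
      ultimately obtain u where "- \<delta>' \<le> u" "u \<le> \<delta>'" "h t u = 0"
        using IVT'[of "h t" "- \<delta>'" 0 "\<delta>'"] cont by blast
      with d(2) show ?thesis by (intro exI[of _ u]) auto
    qed
    then show ?thesis using \<eta>(1,2) by (intro exI[of _ "min \<eta>1 \<eta>2"]) auto
  qed
  obtain s \<eta> where s: "def_fun (\<lambda>e. s (e 0))" "\<And>\<delta>. \<delta> > 0 \<Longrightarrow> \<exists>\<eta>>0. \<forall>t. 0 < t \<and> t < \<eta> \<longrightarrow> \<bar>s t\<bar> < \<delta>"
    "\<eta> > 0" "\<And>t. 0 < t \<Longrightarrow> t < \<eta> \<Longrightarrow> h t (s t) = 0"
    using definable_zero_selection[of h, OF h_def_fun cont zero] by blast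
  have "nearer x0 w (X i) (X l)" if "l \<in> {1..k} - {i, j}" for l
    using that others ij by (intro nearerI) auto
  then obtain \<eta>' where \<eta>': "\<eta>' > 0" "\<And>l t v. l \<in> {1..k} - {i, j} \<Longrightarrow> 0 < t \<Longrightarrow> t < \<eta>' \<Longrightarrow> norm (v - w) < \<eta>' \<Longrightarrow>
      infdist (x0 + t *\<^sub>R v) (X i) < infdist (x0 + t *\<^sub>R v) (X l)"
    using uniformly_nearer[OF k(1), of "{1..k} - {i, j}" w] by blast
  obtain \<mu> where \<mu>: "\<mu> > 0" "\<And>t. 0 < t \<Longrightarrow> t < \<mu> \<Longrightarrow> \<bar>s t\<bar> < \<eta>'" using s(2)[OF \<eta>'(1)] by blast
  show ?thesis
  proof (rule arc_in_tangent_cone[OF s(1,2) x0])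
    show "0 < min \<eta> (min \<eta>' \<mu>)" using s(3) \<eta>'(1) \<mu>(1) by simp
    fix t assume t: "0 < t" "t < min \<eta> (min \<eta>' \<mu>)"
    define y where "y = x0 + t *\<^sub>R (w + s t *\<^sub>R e)"
    have "h t (s t) = 0" using s(4) t by simp
    then have eq: "infdist y (X i) = infdist y (X j)"
      by (simp add: h_def y_def infdist_nonneg power2_eq_iff_nonneg)
    have "infdist y (X i) < infdist y (X l)" if "l \<in> {1..k} - {i, j}" for l
      unfolding y_def using t \<mu>(2)[of t] e by (intro \<eta>'(2) that) auto
    then have "infdist y (X i) \<le> infdist y (X l)" if "l \<in> {1..k}" for l
      using that eq by (cases "l = i \<or> l = j") (auto intro: less_imp_le)
    then have "y \<in> territory k X i" "y \<in> territory k X j" using eq by (auto simp: territory_def)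
    then show "x0 + t *\<^sub>R (w + s t *\<^sub>R e) \<in> conflict_set k X"
      using ij(3) k unfolding conflict_set_def y_def by blast
  qed
qed

text \<open>The slope difference \<open>g\<close> is Lipschitz, vanishes at \<open>w0\<close> and
  grows along axis \<open>m\<close>, so it changes sign on every axis-parallel line close to
  \<open>w0\<close>. The ties in a closed cube thus meet all lines in direction \<open>m\<close>
  over a box, and \<open>codim1_cell\<close> applies.\<close>

lemma cell_in_ties:
  fixes w0 :: "real ^ 'n"
  assumes ij: "i \<in> {1..k}" "j \<in> {1..k}" "infdist x0 (X i) = infdist x0 (X j)" and "\<rho> > 0" "\<kappa> > 0"
    and eq: "slope x0 (X i) w0 = slope x0 (X j) w0"
    and incr: "\<And>v s. s \<ge> 0 \<Longrightarrow> norm (v - w0) \<le> \<rho> \<Longrightarrow> norm (v + s *\<^sub>R axis m 1 - w0) \<le> \<rho> \<Longrightarrow>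
      slope x0 (X i) v - slope x0 (X j) v + \<kappa> * s \<le>
      slope x0 (X i) (v + s *\<^sub>R axis m 1) - slope x0 (X j) (v + s *\<^sub>R axis m 1)"
  shows "\<exists>js C. length js = CARD('n) \<and> Suc (sum_list js) = CARD('n) \<and> cell D js C \<and>
    C \<subseteq> coords ` {x0 + w | w. norm (w - w0) < \<rho> \<and> slope x0 (X i) w = slope x0 (X j) w}"
proof -
  define n where "n = CARD('n)"
  have n: "n > 0" by (simp add: n_def)
  define c where "c = x0 + w0"
  define g where "g w = slope x0 (X i) w - slope x0 (X j) w" for w
  have g_cont: "continuous_on A g" for A
    unfolding g_def using ij X_closed X_nonempty by (intro continuous_intros continuous_slope) auto
  define r where "r = infdist x0 (X i)"
  have r: "r \<ge> 0" by (simp add: r_def infdist_nonneg)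
  have g_lip: "\<bar>g w - g w'\<bar> \<le> 2 * r * norm (w - w')" for w w'
    using slope_lipschitz[OF X_closed[OF ij(1)] X_nonempty[OF ij(1)], of x0 w w']
      slope_lipschitz[OF X_closed[OF ij(2)] X_nonempty[OF ij(2)], of x0 w w'] ij(3)
    unfolding g_def r_def by (simp add: abs_le_iff)
  \<comment> \<open>Half side of the cube, small enough for the sum of the coordinate deviations to
    stay below \<open>\<rho>\<close>.\<close>
  define \<beta> where "\<beta> = \<rho> / (2 * real n)"
  have \<beta>: "\<beta> > 0" "real n * \<beta> < \<rho>" "\<beta> \<le> \<rho>"
  proof -
    show b0: "\<beta> > 0" using \<open>\<rho> > 0\<close> n by (simp add: \<beta>_def)
    have "real n * \<beta> = \<rho> / 2" using n by (simp add: \<beta>_def)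
    then show b1: "real n * \<beta> < \<rho>" using \<open>\<rho> > 0\<close> by simp
    have "1 * \<beta> \<le> real n * \<beta>" using n b0 by (intro mult_right_mono) auto
    with b1 show "\<beta> \<le> \<rho>" by simp
  qed
  \<comment> \<open>Sideways deviations of at most \<open>\<tau>\<close> per coordinate change
    \<open>g\<close> by at most \<open>\<kappa> * \<beta>\<close>, which is the guaranteed change of
    \<open>g\<close> over a step \<open>\<beta>\<close> along the axis. Hence the signs at both ends
    of the line persist.\<close>
  define \<tau> where "\<tau> = min \<beta> (\<kappa> * \<beta> / (2 * (r + 1) * real n))"
  have \<tau>: "\<tau> > 0" "\<tau> \<le> \<beta>" "2 * r * (real n * \<tau>) \<le> \<kappa> * \<beta>"
  proof -
    show t0: "\<tau> > 0" using \<beta>(1) \<open>\<kappa> > 0\<close> r n by (simp add: \<tau>_def)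
    show "\<tau> \<le> \<beta>" by (simp add: \<tau>_def)
    have "2 * r * (real n * \<tau>) \<le> \<tau> * (2 * (r + 1) * real n)" using t0 by (simp add: algebra_simps)
    also have "\<dots> \<le> \<kappa> * \<beta>"
      using r n min.cobounded2[of \<beta> "\<kappa> * \<beta> / (2 * (r + 1) * real n)"] unfolding \<tau>_def[symmetric]
      by (subst (asm) pos_le_divide_eq) auto
    finally show "2 * r * (real n * \<tau>) \<le> \<kappa> * \<beta>" .
  qed
  have l1: "norm z \<le> real n * B" if "\<And>l. \<bar>z $ l\<bar> \<le> B" for z :: "real ^ 'n" and B
  proof -
    have "norm z \<le> (\<Sum>l\<in>UNIV. \<bar>z $ l\<bar>)" by (rule norm_le_l1_cart)
    also have "\<dots> \<le> of_nat (card (UNIV :: 'n set)) * B" by (rule sum_bounded_above) (rule that)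
    finally show ?thesis by (simp add: n_def)
  qed
  define S where "S = {x. (\<forall>l\<in>UNIV. \<bar>x $ l - c $ l\<bar> \<le> \<beta>) \<and> g (x - x0) = 0}"
  have S_sub: "S \<subseteq> {x0 + w | w. norm (w - w0) < \<rho> \<and> slope x0 (X i) w = slope x0 (X j) w}"
  proof
    fix x assume x: "x \<in> S"
    have "norm (x - x0 - w0) \<le> real n * \<beta>" using x by (intro l1) (auto simp: S_def c_def algebra_simps)
    with \<beta>(2) x show "x \<in> {x0 + w | w. norm (w - w0) < \<rho> \<and> slope x0 (X i) w = slope x0 (X j) w}"
      by (auto simp: S_def g_def intro!: exI[of _ "x - x0"])
  qed
  have "def_pred (\<lambda>e. point e \<in> S)"
    unfolding S_def mem_Collect_eq g_def using ij
    by (intro def_intros def_fun_slope X_closed X_nonempty X_definable) auto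
  then have S_D: "coords ` S \<in> D n" using definableI[of S] by (simp add: definable_def n_def)
  have cpt: "compact {t. y(l := t) \<in> coords ` S}" if l: "l < n" for y l
  proof (cases "y \<in> rspace n")
    case False
    then have "{t. y(l := t) \<in> coords ` S} = {}" using l by (auto simp: coords_image rspace_upd n_def)
    then show ?thesis by (simp only: compact_empty)
  next
    case True
    define f :: "real \<Rightarrow> real ^ 'n" where "f t = point (y(l := t))" for t
    have f_nth: "f t $ a = (if idx a = l then t else y (idx a))" for t a by (simp add: f_def)
    have f_cont: "continuous_on UNIV f"
      unfolding f_def point_def
      by (intro continuous_on_vec_lambda, rename_tac a, case_tac "idx a = l") (auto intro: continuous_intros)
    have "{t. y(l := t) \<in> coords ` S} = (\<Inter>a. {t. \<bar>f t $ a - c $ a\<bar> \<le> \<beta>}) \<inter> {t. g (f t - x0) = 0}"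
      using True l by (auto simp: coords_image rspace_upd n_def S_def f_def)
    moreover have "closed (\<Inter>a. {t. \<bar>f t $ a - c $ a\<bar> \<le> \<beta>})"
      by (intro closed_INT ballI closed_Collect_le continuous_intros f_cont)
    moreover have "closed {t. g (f t - x0) = 0}"
      by (intro closed_Collect_eq continuous_on_compose2[OF g_cont[of UNIV]] continuous_intros f_cont) auto
    ultimately have "closed {t. y(l := t) \<in> coords ` S}" by (simp add: closed_Int)
    moreover have "{t. y(l := t) \<in> coords ` S} \<subseteq> cball (c $ from_nat_into UNIV l) \<beta>"
    proof
      fix t assume "t \<in> {t. y(l := t) \<in> coords ` S}"
      then have "f t \<in> S" by (auto simp: coords_image f_def)
      then have "\<bar>f t $ (from_nat_into UNIV l) - c $ from_nat_into UNIV l\<bar> \<le> \<beta>" by (simp add: S_def)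
      moreover have "f t $ (from_nat_into UNIV l) = t" using l unfolding f_nth by (simp add: n_def)
      ultimately show "t \<in> cball (c $ from_nat_into UNIV l) \<beta>" by (simp add: dist_real_def abs_minus_commute)
    qed
    ultimately show ?thesis using bounded_cball bounded_subset compact_eq_bounded_closed by blast
  qed
  have cover: "\<exists>t. y(idx m := t) \<in> coords ` S"
    if y: "y \<in> obox n (\<lambda>l. coords c l - \<tau>) (\<lambda>l. coords c l + \<tau>)" for y
  proof -
    have yr: "y \<in> rspace n" using y by (simp add: obox_def)
    have y_near: "\<bar>y (idx a) - c $ a\<bar> \<le> \<tau>" for a
    proof -
      have "idx a < n" by (simp add: n_def)
      with y have "coords c (idx a) - \<tau> < y (idx a) \<and> y (idx a) < coords c (idx a) + \<tau>"
        unfolding obox_def by blast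
      then show ?thesis by (simp add: abs_le_iff)
    qed
    define f :: "real \<Rightarrow> real ^ 'n" where "f t = point (y(idx m := t))" for t
    have idx_eq: "idx a = idx b \<longleftrightarrow> a = b" for a b :: 'n by (metis from_nat_into_idx)
    have f_nth: "f t $ a = (if a = m then t else y (idx a))" for t a by (simp add: f_def idx_eq)
    have f_cont: "continuous_on A f" for A
      unfolding f_def point_def
      by (intro continuous_on_vec_lambda, rename_tac a, case_tac "idx a = idx m") (auto intro: continuous_intros)
    \<comment> \<open>The line through \<open>y\<close> is compared with the axis line through
      \<open>w0\<close> at equal parameter; the points differ only in coordinates other than
      \<open>m\<close>.\<close>
    have near: "\<bar>g (f (c $ m + b) - x0) - g (w0 + b *\<^sub>R axis m 1)\<bar> \<le> \<kappa> * \<beta>" for b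
    proof -
      have "norm (f (c $ m + b) - x0 - (w0 + b *\<^sub>R axis m 1)) \<le> real n * \<tau>"
      proof (rule l1)
        fix a show "\<bar>(f (c $ m + b) - x0 - (w0 + b *\<^sub>R axis m 1)) $ a\<bar> \<le> \<tau>"
          using y_near[of a] \<tau>(1) by (cases "a = m") (auto simp: f_nth c_def axis_def algebra_simps)
      qed
      then have "2 * r * norm (f (c $ m + b) - x0 - (w0 + b *\<^sub>R axis m 1)) \<le> 2 * r * (real n * \<tau>)"
        using r by (intro mult_left_mono) auto
      with g_lip[of "f (c $ m + b) - x0" "w0 + b *\<^sub>R axis m 1"] \<tau>(3) show ?thesis by linarith
    qed
    have "g w0 = 0" using eq by (simp add: g_def)
    have "\<kappa> * \<beta> \<le> g (w0 + \<beta> *\<^sub>R axis m 1)"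
      using incr[of \<beta> w0] \<beta> \<open>\<rho> > 0\<close> \<open>g w0 = 0\<close> by (simp add: g_def)
    moreover have "g (w0 + (- \<beta>) *\<^sub>R axis m 1) \<le> - (\<kappa> * \<beta>)"
      using incr[of \<beta> "w0 - \<beta> *\<^sub>R axis m 1"] \<beta> \<open>\<rho> > 0\<close> \<open>g w0 = 0\<close> by (simp add: g_def)
    ultimately have "g (f (c $ m + (- \<beta>)) - x0) \<le> 0" "0 \<le> g (f (c $ m + \<beta>) - x0)"
      using near[of \<beta>] near[of "- \<beta>"] by (auto simp: abs_le_iff)
    moreover have "continuous_on {c $ m + (- \<beta>)..c $ m + \<beta>} (\<lambda>t. g (f t - x0))"
      by (intro continuous_on_compose2[OF g_cont[of UNIV]] continuous_intros f_cont) auto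
    ultimately obtain t where t: "c $ m + (- \<beta>) \<le> t" "t \<le> c $ m + \<beta>" "g (f t - x0) = 0"
      using IVT'[of "\<lambda>t. g (f t - x0)" "c $ m + (- \<beta>)" 0 "c $ m + \<beta>"] \<beta>(1) by auto
    have "\<bar>f t $ a - c $ a\<bar> \<le> \<beta>" for a
      using t(1,2) y_near[of a] \<tau>(2) by (auto simp: f_nth abs_le_iff)
    with t(3) have "f t \<in> S" by (simp add: S_def)
    moreover have "y(idx m := t) \<in> rspace n" using yr by (simp add: rspace_upd n_def)
    ultimately show ?thesis unfolding coords_image f_def n_def by blast
  qed
  have "idx m < n" by (simp add: n_def)
  from codim1_cell[OF S_D this, of "\<lambda>l. coords c l - \<tau>" "\<lambda>l. coords c l + \<tau>"] cover cpt \<tau>(1)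
  obtain js C where "length js = n" "Suc (sum_list js) = n" "cell D js C" "C \<subseteq> coords ` S" by auto
  moreover have "coords ` S \<subseteq> coords ` {x0 + w | w. norm (w - w0) < \<rho> \<and> slope x0 (X i) w = slope x0 (X j) w}"
    using S_sub by blast
  ultimately show ?thesis unfolding n_def by blast
qed

lemma cell_in_tangent_cone_conflict_set:
  assumes x0: "x0 \<in> conflict_set k X"
  shows "\<exists>js C. length js = CARD('n) \<and> Suc (sum_list js) = CARD('n) \<and> cell D js C \<and>
    C \<subseteq> coords ` tangent_cone D x0 (conflict_set k X)"
proof -
  obtain i0 j0 where 0: "i0 \<in> active" "j0 \<in> active" "i0 \<noteq> j0"
    using x0 by (auto simp: conflict_set_def active_def)
  have disj: "disjoint_family_on X active"
    by (rule disjoint_family_on_mono[OF _ X_disjoint]) (auto simp: active_def)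
  have Xl: "closed (X l)" "X l \<noteq> {}" "infdist x0 (X l) = infdist x0 (X i0)" if "l \<in> active" for l
    using that X_closed X_nonempty active_infdist_eq[OF that 0(1)] by (auto simp: active_def)
  obtain i j w0 m \<rho> \<kappa> where ij: "i \<in> active" "j \<in> active" "i \<noteq> j" and \<rho>: "\<rho> > 0" "\<kappa> > 0"
    and eq: "slope x0 (X i) w0 = slope x0 (X j) w0"
    and others: "\<And>l w. l \<in> active \<Longrightarrow> l \<noteq> i \<Longrightarrow> l \<noteq> j \<Longrightarrow> norm (w - w0) \<le> \<rho> \<Longrightarrow> slope x0 (X i) w < slope x0 (X l) w"
    and incr: "\<And>w s. s \<ge> 0 \<Longrightarrow> norm (w - w0) \<le> \<rho> \<Longrightarrow> norm (w + s *\<^sub>R axis m 1 - w0) \<le> \<rho> \<Longrightarrow>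
      slope x0 (X i) w - slope x0 (X j) w + \<kappa> * s \<le>
      slope x0 (X i) (w + s *\<^sub>R axis m 1) - slope x0 (X j) (w + s *\<^sub>R axis m 1)"
    by (rule bisecting_direction[OF finite_active 0 Xl disj]) (assumption, assumption, assumption, rule that)
  have k: "i \<in> {1..k}" "j \<in> {1..k}" using ij by (auto simp: active_def)
  have "{x0 + w | w. norm (w - w0) < \<rho> \<and> slope x0 (X i) w = slope x0 (X j) w} \<subseteq> tangent_cone D x0 (conflict_set k X)"
    using tie_in_tangent_cone[OF x0 ij \<rho>(2) others incr] by (auto intro: less_imp_le)
  with cell_in_ties[OF k active_infdist_eq[OF ij(1,2)] \<rho> eq incr] show ?thesis by blast
qed

section \<open>The dimension of the tangent cone\<close>

lemma cell_sum_less: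
  assumes C: "cell D js C" "length js = CARD('n)" "C \<subseteq> coords ` T" and T: "interior (T :: (real ^ 'n) set) = {}"
  shows "sum_list js < CARD('n)"
proof (rule ccontr)
  assume *: "\<not> ?thesis"
  have le: "sum_list xs \<le> length xs" if "set xs \<subseteq> {0, 1}" for xs :: "nat list"
    using that by (induction xs) auto
  have ones: "set xs \<subseteq> {1}" if "set xs \<subseteq> {0, 1}" "length xs \<le> sum_list xs" for xs :: "nat list"
    using that
  proof (induction xs)
    case (Cons a xs)
    with le[of xs] show ?case by auto
  qed simp
  \<comment> \<open>Entries are 0 or 1, so a sum as large as the length forces all of them to be 1.
    The cell is then open and contains a box, whose center is the center of a ball in
    \<open>T\<close>.\<close>
  have "set js \<subseteq> {1}" using ones[OF cell_le_1[OF C(1)]] * C(2) by simp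
  from open_cell_has_box[OF C(1) this] C(2,3) obtain a b where
    ab: "\<forall>i<CARD('n). a i < b i" "obox CARD('n) a b \<subseteq> coords ` T"
    by (auto simp: has_box_def)
  define y where "y = restr CARD('n) (\<lambda>i. (a i + b i) / 2)"
  have y: "y \<in> obox CARD('n) a b" using ab(1) by (auto simp: obox_def y_def)
  obtain \<delta> where \<delta>: "\<delta> > 0" "\<And>y'. (\<forall>i<CARD('n). \<bar>y' i - y i\<bar> < \<delta>) \<Longrightarrow> restr CARD('n) y' \<in> obox CARD('n) a b"
    using obox_open[OF y] by blast
  have "ball (point y) \<delta> \<subseteq> T"
  proof
    fix x :: "real ^ 'n" assume x: "x \<in> ball (point y) \<delta>"
    have "\<bar>coords x l - y l\<bar> < \<delta>" if l: "l < CARD('n)" for l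
    proof -
      define a where "a = (from_nat_into UNIV l :: 'n)"
      have a: "idx a = l" using l by (simp add: a_def)
      have "\<bar>coords x l - y l\<bar> = \<bar>(x - point y) $ a\<bar>" by (simp add: a[symmetric])
      also have "\<dots> \<le> norm (x - point y)" by (rule component_le_norm_cart)
      also have "\<dots> < \<delta>" using x by (simp add: dist_norm norm_minus_commute)
      finally show ?thesis .
    qed
    with \<delta>(2)[of "coords x"] ab(2) have "coords x \<in> coords ` T" by (auto simp: restr_rspace)
    then show "x \<in> T" by (simp add: coords_image)
  qed
  with \<delta>(1) have "point y \<in> interior T" by (auto simp: mem_interior)
  with T show False by simp
qed

lemma ddim_tangent_cone_conflict_set:
  assumes "x0 \<in> conflict_set k X"
  shows "ddim D (tangent_cone D x0 (conflict_set k X)) = ereal (real CARD('n) - 1)"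
proof -
  let ?T = "tangent_cone D x0 (conflict_set k X)"
  let ?J = "{js. length js = CARD('n) \<and> (\<exists>C. cell D js C \<and> C \<subseteq> coords ` ?T)}"
  have "(SUP js\<in>?J. ereal (real (sum_list js))) = ereal (real CARD('n) - 1)"
  proof (rule antisym)
    show "(SUP js\<in>?J. ereal (real (sum_list js))) \<le> ereal (real CARD('n) - 1)"
    proof (rule SUP_least)
      fix js assume "js \<in> ?J"
      then obtain C where "length js = CARD('n)" "cell D js C" "C \<subseteq> coords ` ?T" by blast
      then have "sum_list js < CARD('n)" using cell_sum_less interior_tangent_cone_conflict_set by blast
      then show "ereal (real (sum_list js)) \<le> ereal (real CARD('n) - 1)" by simp
    qed
    \<comment> \<open>The upper bound is attained: the cell of codimension one from the bisecting
      direction is one of those in the supremum.\<close>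
    obtain js C where js: "length js = CARD('n)" "Suc (sum_list js) = CARD('n)" "cell D js C" "C \<subseteq> coords ` ?T"
      using cell_in_tangent_cone_conflict_set[OF assms] by blast
    have "ereal (real (sum_list js)) \<le> (SUP js\<in>?J. ereal (real (sum_list js)))"
      using js by (intro SUP_upper) blast
    moreover have "real (sum_list js) = real CARD('n) - 1" using js(2) by linarith
    ultimately show "ereal (real CARD('n) - 1) \<le> (SUP js\<in>?J. ereal (real (sum_list js)))" by simp
  qed
  then show ?thesis by (simp add: ddim_def omin_dim_def)
qed

end

theorem proposition2p6:
  fixes D :: "nat \<Rightarrow> (nat \<Rightarrow> real) set set"
    and k :: nat
    and X :: "nat \<Rightarrow> (real ^ 'n) set"
    and x\<^sub>0 :: "real ^ 'n"
  assumes "omin_real_field D"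
    and "\<And>i. i \<in> {1..k} \<Longrightarrow> X i \<noteq> {}"
    and "\<And>i. i \<in> {1..k} \<Longrightarrow> closed (X i)"
    and "\<And>i. i \<in> {1..k} \<Longrightarrow> definable D (X i)"
    and "disjoint_family_on X {1..k}"
  shows "(\<forall>i\<in>{1..k}. x\<^sub>0 \<in> territory k X i \<longrightarrow>
            interior (tangent_cone D x\<^sub>0 (territory k X i)) \<noteq> {}) \<and>
         (x\<^sub>0 \<in> conflict_set k X \<longrightarrow>
            ddim D (tangent_cone D x\<^sub>0 (conflict_set k X)) = ereal (real CARD('n) - 1))"
proof -
  interpret omin_real_field D by (rule assms(1))
  interpret conflict_data D k X x\<^sub>0 by unfold_locales (use assms in auto)
  show ?thesis
    using interior_tangent_cone_territory ddim_tangent_cone_conflict_set by (auto simp: active_def)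
qed

end
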